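(* Fix a modulus $r \ge 1$, an integer $k \ge 1$, and $k$ congruence classes $c_1, \dots, c_k$ modulo $r$. Let $q \ge 1$ be a squarefree integer with $(r,q) = 1$. Then for $h \ge 3$, \[ V_k(q,h;r,c_1,\dots, c_k) = \sum_{\sigma \in \mathcal B_k} \prod_{(i,j) \in \sigma} V_2(q,h;r,c_i,c_j) + O_{r,k}\left(h^{k/2-1/(7k)}\left(\frac{q}{\phi(q)}\right)^{2^k + k/2}\right). \]
   Context: Write $e(x) = e^{2\pi i x}$; $\mu$ is the Möbius function and $\phi$ is Euler's totient function. For $h \ge 1$, a modulus $r$, a class $c \bmod r$ and $\alpha \in \mathbb R$, let \[E_{r,c}(\alpha) := \sum_{\substack{1 \le m \le h \\ m \equiv c \bmod r}} e(m\alpha).\] For $k\ge 1$, an integer $q\ge1$ and classes $c_1,\dots,c_k \bmod r$, define \[ V_k(q,h;r,c_1, \dots, c_k) := \sum_{\substack{q_1, \dots, q_k \\ 1 < q_i \mid q \\ (q_i,r) = 1}} \prod_{i=1}^k\frac{\mu(q_i)}{\phi(q_i)} \sum_{\substack{a_1, \dots, a_k \\ 1\le a_i \le q_i \\ (a_i,q_i) = 1 \\ \sum_i a_i/q_i \in \mathbb Z}} \prod_{i=1}^k E_{r,c_i}\left(\frac{a_i}{q_i}\right). \] A perfect matching of a finite set $A$ is a set $\sigma$ of unordered pairs of distinct elements of $A$ such that each element of $A$ lies in exactly one pair; pairs are written $(i,j)$ with $i<j$. $\mathcal B_k$ denotes the set of perfect matchings of $\{1,\dots,k\}$ (empty if $k$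 is odd). *)

theory Defs
  imports "HOL-Analysis.Analysis" "HOL-Number_Theory.Number_Theory"
    "HOL-Computational_Algebra.Squarefree"
begin

definition e :: "real \<Rightarrow> complex" where
  "e x = exp (2 * of_real pi * \<i> * of_real x)"

definition moebius_mu :: "nat \<Rightarrow> int" where
  "moebius_mu n = (if squarefree n then (-1) ^ card (prime_factors n) else 0)"

text \<open>A class modulo \<open>r\<close> is given by any integer representative \<open>c\<close>.\<close>

definition E :: "real \<Rightarrow> nat \<Rightarrow> int \<Rightarrow> real \<Rightarrow> complex" where
  "E h r c \<alpha> = (\<Sum>m | 1 \<le> m \<and> real m \<le> h \<and> [int m = c] (mod int r). e (real m * \<alpha>))"

text \<open>The classes are \<open>c 1, \<dots>, c k\<close>; other values of \<open>c\<close> are irrelevant.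
  The sets \<open>PiE {1..k} _\<close> are the \<open>k\<close>-tuples indexed by \<open>1, \<dots>, k\<close>.\<close>

definition V :: "nat \<Rightarrow> nat \<Rightarrow> real \<Rightarrow> nat \<Rightarrow> (nat \<Rightarrow> int) \<Rightarrow> complex" where
  "V k q h r c =
     (\<Sum>d \<in> PiE {1..k} (\<lambda>_. {n. 1 < n \<and> n dvd q \<and> coprime n r}).
        (\<Prod>i=1..k. of_int (moebius_mu (d i)) / of_nat (totient (d i))) *
        (\<Sum>a | a \<in> PiE {1..k} (\<lambda>i. {b. 1 \<le> b \<and> b \<le> d i \<and> coprime b (d i)}) \<and>
               (\<Sum>i=1..k. real (a i) / real (d i)) \<in> \<int>.
           \<Prod>i=1..k. E h r (c i) (real (a i) / real (d i))))"

text \<open>An unordered pair of distinct elements is encoded as the pair \<open>(i, j)\<close> with \<open>i < j\<close>.\<close>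

definition perfect_matchings :: "'a::linorder set \<Rightarrow> ('a \<times> 'a) set set" where
  "perfect_matchings A =
     {\<sigma>. \<sigma> \<subseteq> {(i, j). i \<in> A \<and> j \<in> A \<and> i < j} \<and>
         (\<forall>x\<in>A. \<exists>!p. p \<in> \<sigma> \<and> (x = fst p \<or> x = snd p))}"

end

theory Submission
  imports Defs
begin

text \<open>
  Write each fraction \<open>a\<^sub>i / q\<^sub>i\<close> as \<open>x\<^sub>i / q\<close>. Then \<open>V\<^sub>k\<close> is a sum over residues \<open>x\<^sub>1, \<dots>, x\<^sub>k\<close> modulo \<open>q\<close>
  with \<open>\<Sum> x\<^sub>i \<equiv> 0\<close>, and the sum over matchings weights the same terms by the number of matchings \<open>\<sigma>\<close>
  with \<open>x\<^sub>i + x\<^sub>j \<equiv> 0\<close> for all \<open>(i, j) \<in> \<sigma>\<close>. Hence only tuples with no such matching, or with several,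
  contribute to the difference, and these are bounded in absolute value, using
  \<open>|E(\<rho>)| \<le> 2 min(h, 1 / \<parallel>r\<rho>\<parallel>)\<close>; the substitution \<open>x \<mapsto> r x\<close> removes \<open>r\<close>.

  Cancelling pairs are split off one at a time, which leaves tuples without any cancelling pair. By the
  Montgomery--Vaughan inequality a denominator below \<open>H = h\<^bsup>1 - 2/(7k)\<^esup>\<close> already saves enough.
  Otherwise the denominator of \<open>x\<^sub>1\<close> divides the product of its gcds with the other denominators, so one
  of these gcds is at least \<open>H\<^bsup>1/(k - 1)\<^esup>\<close>. The two fractions are merged into their sum
  \<open>\<beta> \<noteq> 0\<close>, and the same inequality is applied to \<open>k - 1\<close> variables. The saving comes from the \<open>L\<^sup>2\<close> norm of
  the merged weight: both fractions are near \<open>0\<close> only if \<open>\<beta>\<close> is, and the fractions that occur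
  for one \<open>\<beta>\<close> are well spaced.
\<close>

section \<open>Sums over separated points\<close>

text \<open>Used directly, the Montgomery--Vaughan inequality gives \<open>h\<close> to the power
  \<open>k / 2\<close> and no saving: every index costs \<open>sqrt (8 * h)\<close>, whatever its
  denominator. One index must do better, and it must not come from a cancelling pair, where \<beta>
  = 0 and the peak has its full height \<open>h\<close>. For \<beta> \<noteq> 0 the obstacle is that
  \<beta> has very many representations as a sum of two fractions. They are classified by the
  distribution of the primes of its denominator over three factors \<open>r1\<close>,
  \<open>r2\<close>, \<open>s\<close>, and by the part \<open>t\<close> that cancels. The
  distribution costs a factor 3 per prime, so the inequality is proved with a factor
  \<open>c i\<close> for each prime of a denominator; this only affects the power of q/\<phi>(q),
  and it fits because one index with factor 3 replaces two with factor 1. The part \<open>t\<close>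
  is controlled by spacing, over dyadic ranges when it is small and for each \<open>t\<close>
  separately when it is large. Tuples with several matchings are cheap: two of their residues are
  determined by the others, which saves a full factor \<open>h\<close>.\<close>

definition dist_int :: "real \<Rightarrow> real" where
  "dist_int x = \<bar>x - of_int (round x)\<bar>"

text \<open>For \<open>h > 0\<close> this is the minimum of \<open>h\<close> and the reciprocal of
  the distance to the nearest integer. As a single reciprocal it needs no separate case at the
  integers, where that distance vanishes.\<close>

definition peak :: "real \<Rightarrow> real \<Rightarrow> real" where
  "peak h x = 1 / max (1 / h) (dist_int x)"

lemma dist_int_le: "dist_int x \<le> \<bar>x - of_int n\<bar>"
  unfolding dist_int_def by (rule round_diff_minimal)

lemma dist_int_nonneg: "0 \<le> dist_int x"
  by (simp add: dist_int_def)

lemma dist_int_le_half: "dist_int x \<le> 1 / 2"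
  unfolding dist_int_def by (metis abs_minus_commute of_int_round_abs_le)

lemma dist_int_add_of_int: "dist_int (x + of_int n) = dist_int x"
proof (rule antisym)
  show "dist_int (x + of_int n) \<le> dist_int x"
    using dist_int_le[of "x + of_int n" "round x + n"] by (simp add: dist_int_def[of x])
  show "dist_int x \<le> dist_int (x + of_int n)"
    using dist_int_le[of x "round (x + of_int n) - n"]
    by (simp add: dist_int_def[of "x + of_int n"] algebra_simps)
qed

lemma dist_int_add: "dist_int (x + y) \<le> dist_int x + dist_int y"
  using dist_int_le[of "x + y" "round x + round y"] by (simp add: dist_int_def)

lemma peak_nonneg: "0 \<le> peak h x"
  using dist_int_nonneg[of x] by (simp add: peak_def)

lemma peak_add_of_int: "peak h (x + of_int n) = peak h x"
  by (simp add: peak_def dist_int_add_of_int)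

lemma peak_le_inverse: "\<lbrakk>\<delta> > 0; \<delta> \<le> dist_int x\<rbrakk> \<Longrightarrow> peak h x \<le> 1 / \<delta>"
  by (simp add: peak_def frac_le)

lemma inverse_le_twice_inverse: "\<lbrakk>0 < a; 0 < b; b \<le> 2 * a\<rbrakk> \<Longrightarrow> 1 / a \<le> 2 / b" for a b :: real
  by (simp add: field_simps)

text \<open>Whichever of \<open>x\<close>, \<open>y\<close> is farther from the integers has at
  least half the distance of \<open>x + y\<close>, so its peak is at most
  \<open>2 * peak h (x + y)\<close>. This is how the peak of a merged fraction is extracted from the
  peaks of its two parts.\<close>

lemma peak_mult_le:
  assumes "h > 0"
  shows "peak h x * peak h y \<le> 2 * peak h (x + y) * (peak h x + peak h y)"
proof -
  have main: "peak h x * peak h y \<le> 2 * peak h (x + y) * (peak h x + peak h y)"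
    if "dist_int x \<le> dist_int y" for x y
  proof -
    have "max (1 / h) (dist_int (x + y)) \<le> 2 * max (1 / h) (dist_int y)"
      using dist_int_add[of x y] that dist_int_nonneg[of y] assms by (auto simp: max_def)
    moreover have "0 < max (1 / h) (dist_int (x + y))" "0 < max (1 / h) (dist_int y)"
      using assms by (auto simp: less_max_iff_disj)
    ultimately have "peak h y \<le> 2 * peak h (x + y)"
      using inverse_le_twice_inverse by (fastforce simp: peak_def)
    then have "peak h x * peak h y \<le> peak h x * (2 * peak h (x + y))"
      by (intro mult_left_mono peak_nonneg)
    also have "\<dots> \<le> 2 * peak h (x + y) * (peak h x + peak h y)"
      by (simp add: algebra_simps peak_nonneg)
    finally show ?thesis .
  qed
  show ?thesis
  proof (cases "dist_int x \<le> dist_int y")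
    case False
    then show ?thesis using main[of y x] by (simp add: ac_simps)
  qed (rule main)
qed

text \<open>After subtraction of the nearest integer the numerator is some
  \<open>y \<noteq> 0\<close>, and \<open>n * y\<close> is a nonzero multiple of \<open>q\<close>,
  whence \<open>q \<le> n * \<bar>y\<bar>\<close>.\<close>

lemma dist_int_ge_inverse:
  fixes x :: int
  assumes "q > 0" and "n > 0" and "\<not> int q dvd x" and "int q dvd int n * x"
  shows "1 / real n \<le> dist_int (real_of_int x / real q)"
proof -
  define y where "y = x - int q * round (real_of_int x / real q)"
  have "int q dvd int n * y"
    using assms(4) by (simp add: y_def right_diff_distrib)
  moreover have "y \<noteq> 0"
    using assms(3) by (metis dvd_triv_left eq_iff_diff_eq_0 y_def)
  ultimately have "int q \<le> \<bar>int n * y\<bar>"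
    using assms(2) dvd_imp_le_int[of "int n * y" "int q"] by simp
  then have "int q \<le> int n * \<bar>y\<bar>"
    by (simp add: abs_mult)
  then have "real_of_int (int q) \<le> real_of_int (int n * \<bar>y\<bar>)"
    by (simp only: of_int_le_iff)
  then have "real q \<le> real n * \<bar>real_of_int y\<bar>"
    by simp
  moreover
  have "real_of_int x / real q - real_of_int (round (real_of_int x / real q)) = real_of_int y / real q"
    using assms(1) by (simp add: y_def field_simps)
  then have d: "dist_int (real_of_int x / real q) = \<bar>real_of_int y\<bar> / real q"
    by (simp add: dist_int_def abs_divide)
  ultimately show ?thesis
    using assms(1,2) unfolding d by (simp add: field_simps)
qed

text \<open>The distances are sorted into bins of width \<delta>. Points on the same side of their
  nearest integer occupy distinct bins, and the two sides account for the factor 2. Starting at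
  \<open>j0 = 1\<close> instead of 0 removes the bin at the integers.\<close>

lemma sum_separated_le:
  fixes u :: "'a \<Rightarrow> real" and G :: "real \<Rightarrow> real"
  assumes "finite A" and "\<delta> > 0"
    and sep: "\<And>x y. \<lbrakk>x \<in> A; y \<in> A; x \<noteq> y\<rbrakk> \<Longrightarrow> \<delta> \<le> dist_int (u x - u y)"
    and low: "\<And>x. x \<in> A \<Longrightarrow> \<delta> * real j0 \<le> dist_int (u x)"
    and anti: "\<And>x y. \<lbrakk>0 \<le> x; x \<le> y\<rbrakk> \<Longrightarrow> G y \<le> G x"
    and pos: "\<And>x. 0 \<le> x \<Longrightarrow> 0 \<le> G x"
  shows "(\<Sum>x\<in>A. G (dist_int (u x))) \<le> 2 * (\<Sum>j = j0..nat \<lfloor>1 / (2 * \<delta>)\<rfloor>. G (\<delta> * real j))"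
proof -
  let ?s = "\<lambda>x. u x - of_int (round (u x))"
  let ?J = "nat \<lfloor>1 / (2 * \<delta>)\<rfloor>"
  have half: "(\<Sum>x\<in>B. G (dist_int (u x))) \<le> (\<Sum>j = j0..?J. G (\<delta> * real j))"
    if "B \<subseteq> A" and sgn: "(\<forall>x\<in>B. 0 \<le> ?s x) \<or> (\<forall>x\<in>B. ?s x \<le> 0)" for B
  proof -
    let ?k = "\<lambda>x. nat \<lfloor>dist_int (u x) / \<delta>\<rfloor>"
    have k: "real (?k x) \<le> dist_int (u x) / \<delta>" "dist_int (u x) / \<delta> < real (?k x) + 1" for x
      using dist_int_nonneg[of "u x"] \<open>\<delta> > 0\<close> by auto
    have inj: "inj_on ?k B"
    proof (rule inj_onI, rule ccontr)
      fix x y assume xy: "x \<in> B" "y \<in> B" "?k x = ?k y" "x \<noteq> y"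
      have "\<bar>dist_int (u x) / \<delta> - dist_int (u y) / \<delta>\<bar> < 1"
        using k[of x] k[of y] xy(3) by linarith
      then have "\<bar>dist_int (u x) - dist_int (u y)\<bar> < \<delta>"
        using \<open>\<delta> > 0\<close> by (simp add: diff_divide_distrib[symmetric] abs_divide)
      moreover have "\<bar>?s x - ?s y\<bar> = \<bar>dist_int (u x) - dist_int (u y)\<bar>"
        using sgn xy(1,2) by (auto simp: dist_int_def)
      moreover have "dist_int (u x - u y) \<le> \<bar>?s x - ?s y\<bar>"
        using dist_int_le[of "u x - u y" "round (u x) - round (u y)"] by (simp add: algebra_simps)
      ultimately show False
        using sep[of x y] xy that by auto
    qed
    have img: "?k ` B \<subseteq> {j0..?J}"
    proof
      fix j assume "j \<in> ?k ` B"
      then obtain x where x: "x \<in> B" "j = ?k x" by auto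
      have "real j0 \<le> dist_int (u x) / \<delta>"
        using low[of x] x that \<open>\<delta> > 0\<close> by (auto simp: field_simps)
      then have "j0 \<le> ?k x" by (simp add: le_nat_floor)
      moreover have "dist_int (u x) / \<delta> \<le> 1 / (2 * \<delta>)"
        using dist_int_le_half[of "u x"] \<open>\<delta> > 0\<close> by (simp add: field_simps)
      then have "?k x \<le> ?J" by (intro nat_mono floor_mono)
      ultimately show "j \<in> {j0..?J}" using x by auto
    qed
    have "(\<Sum>x\<in>B. G (dist_int (u x))) \<le> (\<Sum>x\<in>B. G (\<delta> * real (?k x)))"
      using k(1) \<open>\<delta> > 0\<close> by (intro sum_mono anti) (auto simp: field_simps)
    also have "\<dots> = (\<Sum>j\<in>?k ` B. G (\<delta> * real j))"
      using inj by (simp add: sum.reindex)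
    also have "\<dots> \<le> (\<Sum>j = j0..?J. G (\<delta> * real j))"
      using img pos \<open>\<delta> > 0\<close> by (intro sum_mono2) auto
    finally show ?thesis .
  qed
  let ?P = "{x\<in>A. 0 \<le> ?s x}" and ?N = "{x\<in>A. \<not> 0 \<le> ?s x}"
  have "(\<Sum>x\<in>A. G (dist_int (u x))) = (\<Sum>x\<in>?P. G (dist_int (u x))) + (\<Sum>x\<in>?N. G (dist_int (u x)))"
    using \<open>finite A\<close> by (subst sum.union_disjoint[symmetric]) (auto intro!: sum.cong)
  also have "\<dots> \<le> (\<Sum>j = j0..?J. G (\<delta> * real j)) + (\<Sum>j = j0..?J. G (\<delta> * real j))"
    by (intro add_mono half) auto
  finally show ?thesis by simp
qed

text \<open>Comparison with the integral of \<open>1 / (y + \<delta> * x)\<close>, done by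
  telescoping; \<open>ln x \<le> x - 1\<close> supplies each step.\<close>

lemma sum_inverse_linear_le:
  fixes y \<delta> :: real
  assumes "y > 0" and "\<delta> > 0"
  shows "(\<Sum>j = 1..J. 1 / (y + \<delta> * real j)) \<le> ln ((y + \<delta> * real J) / y) / \<delta>"
proof (induction J)
  case 0
  then show ?case using assms by simp
next
  case (Suc J)
  let ?a = "y + \<delta> * real J" and ?b = "y + \<delta> * real (Suc J)"
  have pos: "?a > 0" "?b > 0" using assms by (auto intro!: add_pos_nonneg)
  have "ln (?a / ?b) \<le> ?a / ?b - 1"
    using pos by (intro ln_le_minus_one) auto
  also have "\<dots> = - \<delta> / ?b"
    using pos by (simp add: field_simps)
  finally have "\<delta> / ?b \<le> ln ?b - ln ?a"
    using pos by (simp add: ln_div)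
  then have "1 / ?b \<le> (ln ?b - ln ?a) / \<delta>"
    using assms by (simp add: field_simps)
  then have "(\<Sum>j = 1..Suc J. 1 / (y + \<delta> * real j)) \<le> ln (?a / y) / \<delta> + (ln ?b - ln ?a) / \<delta>"
    using Suc by simp
  also have "\<dots> = ln (?b / y) / \<delta>"
    using pos assms by (simp add: ln_div add_divide_distrib[symmetric])
  finally show ?case .
qed

lemma sum_inverse_square_linear_le:
  fixes y \<delta> :: real
  assumes "y > 0" and "\<delta> > 0"
  shows "(\<Sum>j = 1..J. 1 / (y + \<delta> * real j)\<^sup>2) \<le> (1 / y - 1 / (y + \<delta> * real J)) / \<delta>"
proof (induction J)
  case 0
  then show ?case by simp
next
  case (Suc J)
  let ?a = "y + \<delta> * real J" and ?b = "y + \<delta> * real (Suc J)"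
  have pos: "?a > 0" "?b > 0" using assms by (auto intro!: add_pos_nonneg)
  have "1 / ?b\<^sup>2 \<le> 1 / (?a * ?b)"
    unfolding power2_eq_square
    using pos assms by (intro divide_left_mono mult_right_mono mult_pos_pos) auto
  also have "\<dots> = (1 / ?a - 1 / ?b) / \<delta>"
  proof -
    have "1 / ?a - 1 / ?b = \<delta> / (?a * ?b)"
      using pos by (subst diff_frac_eq) (auto simp: algebra_simps)
    then show ?thesis using assms by simp
  qed
  finally have "(\<Sum>j = 1..Suc J. 1 / (y + \<delta> * real j)\<^sup>2) \<le> (1 / y - 1 / ?a) / \<delta> + (1 / ?a - 1 / ?b) / \<delta>"
    using Suc by simp
  also have "\<dots> = (1 / y - 1 / ?b) / \<delta>"
    by (simp add: add_divide_distrib[symmetric])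
  finally show ?case .
qed

lemma sum_inverse_squares_le_2: "(\<Sum>j = 1..J. 1 / (real j)\<^sup>2) \<le> 2"
proof -
  have "(\<Sum>j = 1..Suc J. 1 / (real j)\<^sup>2) \<le> 2 - 1 / real (Suc J)" for J
  proof (induction J)
    case (Suc J)
    have "1 / (real (Suc (Suc J)))\<^sup>2 \<le> 1 / (real (Suc J) * real (Suc (Suc J)))"
      unfolding power2_eq_square by (intro divide_left_mono mult_right_mono mult_pos_pos) auto
    also have "\<dots> = 1 / real (Suc J) - 1 / real (Suc (Suc J))"
      by (simp add: field_simps)
    finally show ?case using Suc by simp
  qed simp
  from this[of "J - 1"] show ?thesis
    by (cases J) (auto intro: order_trans)
qed

section \<open>Peak sums over fractions whose differences have denominators at most
  \<open>N\<close>\<close>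

context
  fixes h :: real and q :: nat and A :: "'a set" and u :: "'a \<Rightarrow> int" and N :: real
  assumes h: "h \<ge> 3" and q: "q > 0" and A: "finite A" and N: "N > 0"
    and sep: "\<And>x y. \<lbrakk>x \<in> A; y \<in> A; x \<noteq> y\<rbrakk> \<Longrightarrow> \<not> int q dvd u x - u y \<and>
            (\<exists>n>0. real n \<le> N \<and> int q dvd int n * (u x - u y))"
begin

lemma dist_int_cyclic:
  assumes "x \<in> A" "y \<in> A" "x \<noteq> y"
  shows "1 / N \<le> dist_int (real_of_int (u x) / real q - real_of_int (u y) / real q)"
proof -
  obtain n where n: "n > 0" "real n \<le> N" "int q dvd int n * (u x - u y)"
    using sep[OF assms] by auto
  have "1 / N \<le> 1 / real n" using n N by (simp add: frac_le)
  also have "\<dots> \<le> dist_int (real_of_int (u x - u y) / real q)"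
    using sep[OF assms] n q by (intro dist_int_ge_inverse) auto
  finally show ?thesis by (simp add: diff_divide_distrib)
qed

lemma peak_grid_le: "1 / max (1 / h) y \<le> 2 / (1 / h + y)" if "y \<ge> 0"
proof -
  have "1 / h + y \<le> 2 * max (1 / h) y" by (auto simp: max_def)
  then show ?thesis using h that
    by (intro inverse_le_twice_inverse) (auto simp: add_pos_nonneg less_max_iff_disj)
qed

lemma sum_peak_grid_le:
  "(\<Sum>j = 1..nat \<lfloor>1 / (2 * (1 / N))\<rfloor>. 1 / max (1 / h) (1 / N * real j)) \<le> 2 * N * ln h"
proof -
  let ?J = "nat \<lfloor>1 / (2 * (1 / N))\<rfloor>"
  have J: "real ?J \<le> N / 2" using N of_nat_floor[of "N / 2"] by simp
  have "(\<Sum>j = 1..?J. 1 / max (1 / h) (1 / N * real j)) \<le> (\<Sum>j = 1..?J. 2 * (1 / (1 / h + 1 / N * real j)))"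
  proof (rule sum_mono)
    fix j
    show "1 / max (1 / h) (1 / N * real j) \<le> 2 * (1 / (1 / h + 1 / N * real j))"
      using peak_grid_le[of "1 / N * real j"] N by simp
  qed
  also have "\<dots> \<le> 2 * (ln ((1 / h + 1 / N * real ?J) / (1 / h)) / (1 / N))"
    unfolding sum_distrib_left[symmetric]
    using h N by (intro mult_left_mono sum_inverse_linear_le) auto
  also have "(1 / h + 1 / N * real ?J) / (1 / h) = 1 + h * (real ?J / N)"
    using h N by (simp add: field_simps)
  \<comment> \<open>Distances do not exceed 1/2, so only about \<open>N / 2\<close> bins occur, and
    \<open>1 + h / 2 \<le> h\<close> keeps the logarithm at \<open>ln h\<close>.\<close>
  also have "2 * (ln (1 + h * (real ?J / N)) / (1 / N)) \<le> 2 * (ln h / (1 / N))"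
  proof -
    have "real ?J / N \<le> 1 / 2" using J N by (simp add: field_simps)
    then have "h * (real ?J / N) \<le> h * (1 / 2)" using h by (intro mult_left_mono) auto
    then have "1 + h * (real ?J / N) \<le> h" using h by linarith
    moreover have "0 < 1 + h * (real ?J / N)" using h N by (intro add_pos_nonneg) auto
    ultimately show ?thesis using N h by (intro mult_left_mono divide_right_mono) auto
  qed
  finally show ?thesis by (simp add: mult.commute mult.left_commute)
qed

lemma sum_peak_square_grid_le:
  "(\<Sum>j = 1..nat \<lfloor>1 / (2 * (1 / N))\<rfloor>. (1 / max (1 / h) (1 / N * real j))\<^sup>2) \<le> 4 * h * N"
proof -
  let ?J = "nat \<lfloor>1 / (2 * (1 / N))\<rfloor>"
  have "(1 / max (1 / h) (1 / N * real j))\<^sup>2 \<le> 4 * (1 / (1 / h + 1 / N * real j)\<^sup>2)" for j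
  proof -
    have "(1 / max (1 / h) (1 / N * real j))\<^sup>2 \<le> (2 / (1 / h + 1 / N * real j))\<^sup>2"
      using h N by (intro power_mono peak_grid_le) (auto simp: le_max_iff_disj)
    then show ?thesis by (simp add: power_divide)
  qed
  then have "(\<Sum>j = 1..?J. (1 / max (1 / h) (1 / N * real j))\<^sup>2) \<le> (\<Sum>j = 1..?J. 4 * (1 / (1 / h + 1 / N * real j)\<^sup>2))"
    by (intro sum_mono) auto
  also have "\<dots> \<le> 4 * ((1 / (1 / h) - 1 / (1 / h + 1 / N * real ?J)) / (1 / N))"
    unfolding sum_distrib_left[symmetric]
    using h N by (intro mult_left_mono sum_inverse_square_linear_le) auto
  also have "\<dots> \<le> 4 * (h / (1 / N))"
    using h N by (intro mult_left_mono divide_right_mono) auto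
  finally show ?thesis by simp
qed

lemma antimono_peak_profile:
  assumes "0 \<le> x" "x \<le> y"
  shows "1 / max (1 / h) y \<le> 1 / max (1 / h) x" "(1 / max (1 / h) y)\<^sup>2 \<le> (1 / max (1 / h) x)\<^sup>2"
proof -
  show *: "1 / max (1 / h) y \<le> 1 / max (1 / h) x"
    using assms h by (intro divide_left_mono mult_pos_pos) (auto simp: less_max_iff_disj)
  show "(1 / max (1 / h) y)\<^sup>2 \<le> (1 / max (1 / h) x)\<^sup>2"
    using assms h by (intro power_mono *) (auto simp: max_def)
qed

lemma peak_profile_nonneg: "0 \<le> 1 / max (1 / h) x" "0 \<le> (1 / max (1 / h) x)\<^sup>2"
  using h by (simp_all add: le_max_iff_disj)

text \<open>Differences with denominators at most \<open>N\<close> make the points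
  \<open>1 / N\<close>-separated. The bin at the integers contributes the terms in \<open>h\<close>
  and \<open>h\<^sup>2\<close>; the other bins contribute a logarithmic and a convergent
  sum.\<close>

lemma sum_peak_cyclic_le:
  "(\<Sum>x\<in>A. peak h (real_of_int (u x) / real q)) \<le> 2 * h + 4 * N * ln h"
  "(\<Sum>x\<in>A. (peak h (real_of_int (u x) / real q))\<^sup>2) \<le> 2 * h\<^sup>2 + 8 * h * N"
proof -
  let ?J = "nat \<lfloor>1 / (2 * (1 / N))\<rfloor>"
  have split: "(\<Sum>j = 0..?J. G (1 / N * real j)) = G 0 + (\<Sum>j = 1..?J. G (1 / N * real j))" for G :: "real \<Rightarrow> real"
    by (simp add: sum.atLeast_Suc_atMost)
  have "(\<Sum>x\<in>A. 1 / max (1 / h) (dist_int (real_of_int (u x) / real q)))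
      \<le> 2 * (\<Sum>j = 0..?J. 1 / max (1 / h) (1 / N * real j))"
    by (rule sum_separated_le[OF A _ dist_int_cyclic _ antimono_peak_profile(1) peak_profile_nonneg(1)])
      (use N dist_int_nonneg in simp_all)
  also have "\<dots> \<le> 2 * (h + 2 * N * ln h)"
    unfolding split[of "\<lambda>y. 1 / max (1 / h) y"] using h sum_peak_grid_le
    by (intro mult_left_mono add_mono) auto
  finally show "(\<Sum>x\<in>A. peak h (real_of_int (u x) / real q)) \<le> 2 * h + 4 * N * ln h"
    by (simp add: peak_def)
  have "(\<Sum>x\<in>A. (1 / max (1 / h) (dist_int (real_of_int (u x) / real q)))\<^sup>2)
      \<le> 2 * (\<Sum>j = 0..?J. (1 / max (1 / h) (1 / N * real j))\<^sup>2)"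
    by (rule sum_separated_le[OF A _ dist_int_cyclic _ antimono_peak_profile(2) peak_profile_nonneg(2)])
      (use N dist_int_nonneg in simp_all)
  also have "\<dots> \<le> 2 * (h\<^sup>2 + 4 * h * N)"
    unfolding split[of "\<lambda>y. (1 / max (1 / h) y)\<^sup>2"] using h sum_peak_square_grid_le
    by (intro mult_left_mono add_mono) auto
  finally show "(\<Sum>x\<in>A. (peak h (real_of_int (u x) / real q))\<^sup>2) \<le> 2 * h\<^sup>2 + 8 * h * N"
    by (simp add: peak_def)
qed

text \<open>Here the points themselves keep distance \<open>1 / N\<close> from the integers, so the
  bin at 0 is empty and the terms \<open>2 * h\<close> and \<open>2 * h\<^sup>2\<close> disappear.
  The third bound ignores the cap \<open>h\<close> of the peak and is the better one for
  \<open>N < 2 * h\<close>; it is what makes small denominators cheap.\<close>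

lemma sum_peak_cyclic_nonzero_le:
  assumes low: "\<And>x. x \<in> A \<Longrightarrow> \<not> int q dvd u x \<and> (\<exists>n>0. real n \<le> N \<and> int q dvd int n * u x)"
  shows "(\<Sum>x\<in>A. peak h (real_of_int (u x) / real q)) \<le> 4 * N * ln h" (is ?th1)
    and "(\<Sum>x\<in>A. (peak h (real_of_int (u x) / real q))\<^sup>2) \<le> 8 * h * N" (is ?th2)
    and "(\<Sum>x\<in>A. (peak h (real_of_int (u x) / real q))\<^sup>2) \<le> 4 * N\<^sup>2" (is ?th3)
proof -
  let ?J = "nat \<lfloor>1 / (2 * (1 / N))\<rfloor>"
  have low': "1 / N * real 1 \<le> dist_int (real_of_int (u x) / real q)" if x: "x \<in> A" for x
  proof -
    obtain n where n: "n > 0" "real n \<le> N" "int q dvd int n * u x"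
      using low[OF x] by auto
    have "1 / N \<le> 1 / real n" using n N by (simp add: frac_le)
    also have "\<dots> \<le> dist_int (real_of_int (u x) / real q)"
      using low[OF x] n q by (intro dist_int_ge_inverse) auto
    finally show ?thesis by simp
  qed
  have "(\<Sum>x\<in>A. 1 / max (1 / h) (dist_int (real_of_int (u x) / real q)))
      \<le> 2 * (\<Sum>j = 1..?J. 1 / max (1 / h) (1 / N * real j))"
    by (rule sum_separated_le[OF A _ dist_int_cyclic low' antimono_peak_profile(1) peak_profile_nonneg(1)])
      (use N in simp_all)
  also have "\<dots> \<le> 2 * (2 * N * ln h)"
    using sum_peak_grid_le by (intro mult_left_mono) auto
  finally show ?th1 by (simp add: peak_def)
  have *: "(\<Sum>x\<in>A. (1 / max (1 / h) (dist_int (real_of_int (u x) / real q)))\<^sup>2)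
      \<le> 2 * (\<Sum>j = 1..?J. (1 / max (1 / h) (1 / N * real j))\<^sup>2)"
    by (rule sum_separated_le[OF A _ dist_int_cyclic low' antimono_peak_profile(2) peak_profile_nonneg(2)])
      (use N in simp_all)
  also have "\<dots> \<le> 2 * (4 * h * N)"
    using sum_peak_square_grid_le by (intro mult_left_mono) auto
  finally show ?th2 by (simp add: peak_def)
  note *
  also have "(\<Sum>j = 1..?J. (1 / max (1 / h) (1 / N * real j))\<^sup>2) \<le> (\<Sum>j = 1..?J. N\<^sup>2 * (1 / (real j)\<^sup>2))"
  proof (rule sum_mono)
    fix j assume j: "j \<in> {1..?J}"
    have "1 / max (1 / h) (1 / N * real j) \<le> 1 / (1 / N * real j)"
      using j N h by (intro divide_left_mono mult_pos_pos) (auto simp: less_max_iff_disj)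
    then have "(1 / max (1 / h) (1 / N * real j))\<^sup>2 \<le> (1 / (1 / N * real j))\<^sup>2"
      using h by (intro power_mono) (auto simp: le_max_iff_disj)
    then show "(1 / max (1 / h) (1 / N * real j))\<^sup>2 \<le> N\<^sup>2 * (1 / (real j)\<^sup>2)"
      by (simp add: power_divide)
  qed
  also have "\<dots> \<le> N\<^sup>2 * 2"
    unfolding sum_distrib_left[symmetric] using sum_inverse_squares_le_2[of ?J]
    by (intro mult_left_mono) auto
  finally show ?th3 by (simp add: peak_def)
qed

end

section \<open>The Montgomery--Vaughan inequality\<close>

text \<open>The denominator of \<open>a / q\<close> in lowest terms.\<close>

definition den :: "nat \<Rightarrow> nat \<Rightarrow> nat" where
  "den q a = q div gcd a q"

lemma squarefree_induct [consumes 1, case_names one mult]: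
  fixes q :: nat
  assumes "squarefree q" and "P 1"
    and step: "\<And>p n. \<lbrakk>prime p; squarefree n; coprime p n; P n\<rbrakk> \<Longrightarrow> P (p * n)"
  shows "P q"
  using assms(1)
proof (induction q rule: less_induct)
  case (less q)
  show ?case
  proof (cases "q = 1")
    case False
    then obtain p where p: "prime p" "p dvd q" using prime_factor_nat by blast
    then obtain n where n: "q = p * n" by auto
    have "q \<noteq> 0" using less.prems by (metis not_squarefree_0)
    then have "n < q" using n p prime_gt_1_nat[of p] by simp
    moreover have "squarefree n" using less.prems n squarefree_multD by blast
    moreover have "coprime p n"
    proof (rule prime_imp_coprime[OF p(1)])
      show "\<not> p dvd n"
      proof
        assume "p dvd n"
        then have "p ^ 2 dvd q" using n by (auto simp: power2_eq_square)
        then show False using less.prems p(1) unfolding squarefree_def by auto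
      qed
    qed
    ultimately show ?thesis using less.IH step p(1) n by auto
  qed (use assms(2) in simp)
qed

lemma sum_PiE_insert:
  assumes "i \<notin> S"
  shows "(\<Sum>x\<in>PiE (insert i S) A. G x) = (\<Sum>u\<in>A i. \<Sum>x\<in>PiE S A. G (x(i := u)))"
proof -
  have "(\<Sum>x\<in>PiE (insert i S) A. G x) = (\<Sum>z\<in>A i \<times> PiE S A. G ((snd z)(i := fst z)))"
    using inj_combinator[OF assms, of A]
    by (simp add: PiE_insert_eq sum.reindex case_prod_unfold comp_def)
  then show ?thesis
    by (simp add: sum.cartesian_product case_prod_unfold)
qed

text \<open>The congruence lets each of \<open>u\<close>, \<open>v\<close> determine the other, so
  the admissible pairs form the graph of a partial injection and both projections are injective in
  the Cauchy--Schwarz inequality.\<close>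

lemma sum_pairs_congruence_le:
  fixes X Y :: "nat \<Rightarrow> real"
  assumes "\<And>x. 0 \<le> X x" "\<And>x. 0 \<le> Y x"
  shows "(\<Sum>u = 1..<p. X u * (\<Sum>v = 1..<p. if p dvd n + u + v then Y v else 0))
     \<le> sqrt (\<Sum>x = 1..<p. (X x)\<^sup>2) * sqrt (\<Sum>x = 1..<p. (Y x)\<^sup>2)"
proof -
  define R where "R = {z \<in> {1..<p} \<times> {1..<p}. p dvd n + fst z + snd z}"
  have fin: "finite R" by (simp add: R_def)
  have uniq: "v = v'" if "p dvd m + v" "p dvd m + v'" "v < p" "v' < p" for m v v' :: nat
  proof -
    have "[m + v = m + v'] (mod p)" using that by (simp add: cong_def)
    then have "[v = v'] (mod p)" by (simp add: cong_add_lcancel_nat)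
    then show ?thesis using that by (simp add: cong_def)
  qed
  have i1: "inj_on fst R"
  proof (rule inj_onI)
    fix z w assume "z \<in> R" "w \<in> R" "fst z = fst w"
    then show "z = w" using uniq[of "n + fst z" "snd z" "snd w"]
      by (auto simp: R_def prod_eq_iff)
  qed
  have i2: "inj_on snd R"
  proof (rule inj_onI)
    fix z w assume "z \<in> R" "w \<in> R" "snd z = snd w"
    then show "z = w" using uniq[of "n + snd z" "fst z" "fst w"]
      by (auto simp: R_def prod_eq_iff ac_simps)
  qed
  have "(\<Sum>u = 1..<p. X u * (\<Sum>v = 1..<p. if p dvd n + u + v then Y v else 0))
      = (\<Sum>z\<in>{1..<p} \<times> {1..<p}. if p dvd n + fst z + snd z then X (fst z) * Y (snd z) else 0)"
    by (simp add: sum_distrib_left sum.cartesian_product case_prod_unfold if_distrib cong: if_cong)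
  also have "\<dots> = (\<Sum>z\<in>R. X (fst z) * Y (snd z))"
    unfolding R_def by (rule sum.inter_filter[symmetric]) simp
  also have "\<dots> \<le> sqrt (\<Sum>z\<in>R. (X (fst z))\<^sup>2) * sqrt (\<Sum>z\<in>R. (Y (snd z))\<^sup>2)"
    unfolding real_sqrt_mult[symmetric]
    by (rule real_le_rsqrt) (rule Cauchy_Schwarz_ineq_sum)
  also have "\<dots> \<le> sqrt (\<Sum>x = 1..<p. (X x)\<^sup>2) * sqrt (\<Sum>x = 1..<p. (Y x)\<^sup>2)"
  proof (intro mult_mono)
    have "(\<Sum>z\<in>R. (X (fst z))\<^sup>2) = (\<Sum>x\<in>fst ` R. (X x)\<^sup>2)"
      using i1 by (simp add: sum.reindex)
    also have "\<dots> \<le> (\<Sum>x = 1..<p. (X x)\<^sup>2)"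
      by (intro sum_mono2) (auto simp: R_def)
    finally show "sqrt (\<Sum>z\<in>R. (X (fst z))\<^sup>2) \<le> sqrt (\<Sum>x = 1..<p. (X x)\<^sup>2)" by simp
    have "(\<Sum>z\<in>R. (Y (snd z))\<^sup>2) = (\<Sum>x\<in>snd ` R. (Y x)\<^sup>2)"
      using i2 by (simp add: sum.reindex)
    also have "\<dots> \<le> (\<Sum>x = 1..<p. (Y x)\<^sup>2)"
      by (intro sum_mono2) (auto simp: R_def)
    finally show "sqrt (\<Sum>z\<in>R. (Y (snd z))\<^sup>2) \<le> sqrt (\<Sum>x = 1..<p. (Y x)\<^sup>2)" by simp
  qed (auto intro!: sum_nonneg)
  finally show ?thesis .
qed

text \<open>Two variables absorb the congruence through \<open>sum_pairs_congruence_le\<close>;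
  every other variable is summed freely, at the cost of \<open>sqrt p\<close> by Cauchy--Schwarz.
  Granting \<open>sqrt p\<close> to those two as well leaves the factor
  \<open>1 / p\<close>.\<close>

lemma sum_prod_congruence_le:
  fixes X :: "'a \<Rightarrow> nat \<Rightarrow> real"
  assumes "finite S" and "card S \<ge> 2" and "p > 0" and nn: "\<And>i x. 0 \<le> X i x"
  shows "(\<Sum>x\<in>PiE S (\<lambda>_. {1..<p}). if p dvd n + (\<Sum>i\<in>S. x i) then \<Prod>i\<in>S. X i (x i) else 0)
     \<le> (\<Prod>i\<in>S. sqrt (real p * (\<Sum>x = 1..<p. (X i x)\<^sup>2))) / real p"
proof -
  define T where "T S n = (\<Sum>x\<in>PiE S (\<lambda>_. {1..<p}). if p dvd n + (\<Sum>i\<in>S. x i) then \<Prod>i\<in>S. X i (x i) else 0)" for S n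
  have ins: "T (insert i S) n = (\<Sum>u = 1..<p. X i u * T S (n + u))" if "finite S" "i \<notin> S" for i S n
  proof -
    have "(if p dvd n + (\<Sum>l\<in>insert i S. (x(i := u)) l) then \<Prod>l\<in>insert i S. X l ((x(i := u)) l) else 0)
        = X i u * (if p dvd n + u + (\<Sum>l\<in>S. x l) then \<Prod>l\<in>S. X l (x l) else 0)" for x u
    proof -
      have "(\<Sum>l\<in>S. (x(i := u)) l) = (\<Sum>l\<in>S. x l)" "(\<Prod>l\<in>S. X l ((x(i := u)) l)) = (\<Prod>l\<in>S. X l (x l))"
        using that by (auto intro!: sum.cong prod.cong)
      then show ?thesis using that by (simp add: add.assoc)
    qed
    then show ?thesis
      unfolding T_def sum_PiE_insert[OF that(2)] by (simp add: sum_distrib_left)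
  qed
  obtain i S' where i: "S = insert i S'" "i \<notin> S'" "card S' \<ge> 1"
    using assms(1,2) by (metis One_nat_def card_insert_disjoint card_le_Suc_iff le_add1 numeral_2_eq_2 finite_insert not_less_eq_eq Suc_le_mono)
  have "finite S'" using i assms(1) by auto
  then obtain j R where j: "S' = insert j R" "j \<notin> R"
    using i(3) by (metis card.empty ex_in_conv mk_disjoint_insert not_one_le_zero)
  have "finite R" using \<open>finite S'\<close> j by auto
  \<comment> \<open>The shift \<open>n\<close> must be arbitrary here: fixing one more variable to
    \<open>u\<close> replaces \<open>n\<close> by \<open>n + u\<close>.\<close>
  then have "T (R \<union> {i, j}) n \<le> (\<Prod>l\<in>R \<union> {i, j}. sqrt (real p * (\<Sum>x = 1..<p. (X l x)\<^sup>2))) / real p"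
    if "i \<notin> R" "j \<notin> R" "i \<noteq> j" for n
    using that
  proof (induction R arbitrary: n rule: finite_induct)
    case empty
    have "T {i, j} n = (\<Sum>u = 1..<p. X i u * (\<Sum>v = 1..<p. if p dvd n + u + v then X j v else 0))"
      using empty by (simp add: ins) (simp add: T_def if_distrib cong: if_cong)
    also have "\<dots> \<le> sqrt (\<Sum>x = 1..<p. (X i x)\<^sup>2) * sqrt (\<Sum>x = 1..<p. (X j x)\<^sup>2)"
      by (rule sum_pairs_congruence_le) (rule nn)+
    also have "\<dots> = (\<Prod>l\<in>{i, j}. sqrt (real p * (\<Sum>x = 1..<p. (X l x)\<^sup>2))) / real p"
      using empty \<open>p > 0\<close> by (simp add: real_sqrt_mult field_simps)
    finally show ?case by simp
  next
    case (insert l R)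
    let ?s = "\<lambda>l. sqrt (real p * (\<Sum>x = 1..<p. (X l x)\<^sup>2))"
    have l: "l \<notin> R \<union> {i, j}" "finite (R \<union> {i, j})" using insert by auto
    have "T (insert l R \<union> {i, j}) n = (\<Sum>u = 1..<p. X l u * T (R \<union> {i, j}) (n + u))"
      using ins[OF l(2,1)] by (simp add: insert_commute)
    also have "\<dots> \<le> (\<Sum>u = 1..<p. X l u * ((\<Prod>l\<in>R \<union> {i, j}. ?s l) / real p))"
      using insert by (intro sum_mono mult_left_mono nn) auto
    also have "\<dots> = (\<Sum>u = 1..<p. X l u) * ((\<Prod>l\<in>R \<union> {i, j}. ?s l) / real p)"
      by (simp only: sum_distrib_right)
    also have "\<dots> \<le> ?s l * ((\<Prod>l\<in>R \<union> {i, j}. ?s l) / real p)"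
    proof (rule mult_right_mono)
      have "(\<Sum>u = 1..<p. X l u)\<^sup>2 \<le> (\<Sum>u = 1..<p. (X l u)\<^sup>2) * (\<Sum>u = 1..<p. 1\<^sup>2)"
        using Cauchy_Schwarz_ineq_sum[of "X l" "\<lambda>_. 1" "{1..<p}"] by simp
      also have "\<dots> \<le> (\<Sum>u = 1..<p. (X l u)\<^sup>2) * real p"
        by (intro mult_left_mono sum_nonneg) auto
      finally show "(\<Sum>u = 1..<p. X l u) \<le> ?s l"
        by (intro real_le_rsqrt) (simp add: mult.commute)
    qed (auto intro!: divide_nonneg_nonneg prod_nonneg sum_nonneg mult_nonneg_nonneg)
    also have "\<dots> = (\<Prod>l\<in>insert l (R \<union> {i, j}). ?s l) / real p"
      using l by (subst prod.insert) auto
    also have "insert l (R \<union> {i, j}) = insert l R \<union> {i, j}" by auto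
    finally show ?case .
  qed
  moreover have "S = R \<union> {i, j}" using i j by auto
  ultimately show ?thesis using i j by (auto simp: T_def)
qed

section \<open>Splitting off one prime of the modulus\<close>

lemma den_mult_prime:
  assumes "prime p" "coprime p n"
  shows "den (p * n) a = (if p dvd a then 1 else p) * den n (a mod n)"
proof -
  have "p > 0" using assms(1) prime_gt_0_nat by blast
  have g: "gcd (a mod n) n = gcd a n" by (metis gcd.commute gcd_red_nat)
  show ?thesis
  proof (cases "p dvd a")
    case True
    then obtain b where b: "a = p * b" by auto
    have "gcd a (p * n) = p * gcd b n" using b by (simp add: gcd_mult_left)
    moreover have "gcd a n = gcd b n"
      using b assms(2) by (simp add: gcd_mult_left_left_cancel coprime_commute)
    ultimately show ?thesis using True \<open>p > 0\<close> g by (simp add: den_def)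
  next
    case False
    then have "coprime a p" using assms(1) prime_imp_coprime coprime_commute by blast
    then have "gcd a (p * n) = gcd a n" by (simp add: gcd_mult_right_left_cancel)
    then show ?thesis using False g by (simp add: den_def div_mult_swap)
  qed
qed

text \<open>Residue 0 modulo \<open>p\<close> means that \<open>p\<close> does not occur in the
  denominator, so tuples are sorted by the set \<open>S\<close> of indices where it does occur. The
  term \<open>0 +\<close> matches the shift in \<open>sum_prod_congruence_le\<close>.\<close>

lemma sum_prod_split_support:
  fixes I :: "'a set" and p :: nat
  assumes "finite I" "p > 0"
  shows "(\<Sum>x | x \<in> PiE I (\<lambda>_. {..<p}) \<and> p dvd (\<Sum>i\<in>I. x i). \<Prod>i\<in>I. X i (x i))
    = (\<Sum>S\<in>Pow I. (\<Prod>i\<in>I - S. X i 0) * (\<Sum>y\<in>PiE S (\<lambda>_. {1..<p}).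
          if p dvd 0 + (\<Sum>i\<in>S. y i) then \<Prod>i\<in>S. (X i (y i) :: real) else 0))"
    (is "sum ?f ?A = _")
proof -
  let ?supp = "\<lambda>x. {i\<in>I. x i \<noteq> (0::nat)}"
  have fin: "finite ?A" using assms by (intro finite_subset[OF _ finite_PiE[of I "\<lambda>_. {..<p}"]]) auto
  have "sum ?f ?A = (\<Sum>S\<in>Pow I. sum ?f {x \<in> ?A. ?supp x = S})"
    using fin assms by (intro sum.group[symmetric]) auto
  also have "\<dots> = (\<Sum>S\<in>Pow I. (\<Prod>i\<in>I - S. X i 0) * (\<Sum>y\<in>PiE S (\<lambda>_. {1..<p}).
          if p dvd 0 + (\<Sum>i\<in>S. y i) then \<Prod>i\<in>S. X i (y i) else 0))"
  proof (rule sum.cong[OF refl])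
    fix S assume "S \<in> Pow I"
    then have S: "S \<subseteq> I" "finite S" using assms finite_subset by auto
    have "sum ?f {x \<in> ?A. ?supp x = S}
        = (\<Sum>y | y \<in> PiE S (\<lambda>_. {1..<p}) \<and> p dvd 0 + (\<Sum>i\<in>S. y i). (\<Prod>i\<in>I - S. X i 0) * (\<Prod>i\<in>S. X i (y i)))"
    proof (rule sum.reindex_bij_witness[where j = "\<lambda>x. restrict x S" and i = "\<lambda>y. \<lambda>i\<in>I. if i \<in> S then y i else 0"])
      fix x assume x: "x \<in> {x \<in> ?A. ?supp x = S}"
      have outside: "x i = 0" if "i \<in> I - S" for i using x that by auto
      have sm: "(\<Sum>i\<in>I. x i) = (\<Sum>i\<in>S. x i)"
        using S assms outside by (intro sum.mono_neutral_right) auto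
      show "(\<lambda>i\<in>I. if i \<in> S then restrict x S i else 0) = x"
        using x by (intro ext) (auto simp: PiE_def extensional_def)
      show "restrict x S \<in> {y. y \<in> PiE S (\<lambda>_. {1..<p}) \<and> p dvd 0 + (\<Sum>i\<in>S. y i)}"
        using x sm by (auto simp: PiE_def Pi_def)
      have "(\<Prod>i\<in>I. X i (x i)) = (\<Prod>i\<in>I - S. X i (x i)) * (\<Prod>i\<in>S. X i (x i))"
        using S assms by (intro prod.subset_diff) auto
      then show "(\<Prod>i\<in>I - S. X i 0) * (\<Prod>i\<in>S. X i (restrict x S i)) = ?f x"
        using outside by simp
    next
      fix y assume y: "y \<in> {y. y \<in> PiE S (\<lambda>_. {1..<p}) \<and> p dvd 0 + (\<Sum>i\<in>S. y i)}"
      show "restrict (\<lambda>i\<in>I. if i \<in> S then y i else 0) S = y"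
        using y S by (intro ext) (auto simp: PiE_def extensional_def)
      have "(\<Sum>i\<in>I. if i \<in> S then y i else 0) = (\<Sum>i\<in>S. y i)"
        using S assms by (simp add: sum.If_cases Int_absorb1)
      moreover have "0 < y i" "y i < p" if "i \<in> S" for i using y that by (force simp: PiE_def Pi_def)+
      ultimately show "(\<lambda>i\<in>I. if i \<in> S then y i else 0) \<in> {x \<in> ?A. ?supp x = S}"
        using y S \<open>p > 0\<close> by auto
    qed
    also have "\<dots> = (\<Prod>i\<in>I - S. X i 0) * (\<Sum>y\<in>PiE S (\<lambda>_. {1..<p}).
          if p dvd 0 + (\<Sum>i\<in>S. y i) then \<Prod>i\<in>S. X i (y i) else 0)"
    proof -
      have "finite (PiE S (\<lambda>_. {1..<p}))" using S by (intro finite_PiE) auto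
      moreover have "{y. y \<in> PiE S (\<lambda>_. {1..<p}) \<and> p dvd 0 + (\<Sum>i\<in>S. y i)} = {y \<in> PiE S (\<lambda>_. {1..<p}). p dvd 0 + (\<Sum>i\<in>S. y i)}"
        by auto
      ultimately show ?thesis by (simp only: sum.inter_filter sum_distrib_left[symmetric])
    qed
    finally show "sum ?f {x \<in> ?A. ?supp x = S} = \<dots>" .
  qed
  finally show ?thesis .
qed

text \<open>A single nonzero residue is not divisible by \<open>p\<close>, so supports with one
  element contribute nothing. Every remaining nonempty support has two elements and thus earns the
  factor \<open>1 / p\<close>.\<close>

lemma sum_prod_single_modulus_le:
  fixes X :: "'a \<Rightarrow> nat \<Rightarrow> real"
  assumes "finite I" and "p > 0" and nn: "\<And>i x. 0 \<le> X i x"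
  shows "(\<Sum>x | x \<in> PiE I (\<lambda>_. {..<p}) \<and> p dvd (\<Sum>i\<in>I. x i). \<Prod>i\<in>I. X i (x i))
    \<le> (\<Prod>i\<in>I. X i 0) + (\<Sum>S | S \<subseteq> I \<and> 2 \<le> card S.
         (\<Prod>i\<in>I. if i \<in> S then sqrt (real p * (\<Sum>x = 1..<p. (X i x)\<^sup>2)) else X i 0) / real p)"
proof -
  let ?T = "\<lambda>S. (\<Prod>i\<in>I - S. X i 0) * (\<Sum>y\<in>PiE S (\<lambda>_. {1..<p}).
          if p dvd 0 + (\<Sum>i\<in>S. y i) then \<Prod>i\<in>S. X i (y i) else 0)"
  let ?U = "\<lambda>S. (\<Prod>i\<in>I. if i \<in> S then sqrt (real p * (\<Sum>x = 1..<p. (X i x)\<^sup>2)) else X i 0) / real p"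
  let ?P = "{S. S \<subseteq> I \<and> 2 \<le> card S}"
  have finP: "finite ?P" using assms(1) by auto
  have single: "?T S = 0" if S: "S \<subseteq> I" "card S = 1" for S
  proof -
    obtain i where i: "S = {i}" using S(2) card_1_singletonE by blast
    have "(\<Sum>y\<in>PiE S (\<lambda>_. {1..<p}). if p dvd 0 + (\<Sum>i\<in>S. y i) then \<Prod>i\<in>S. X i (y i) else 0) = 0"
    proof (rule sum.neutral, rule ballI)
      fix y assume "y \<in> PiE S (\<lambda>_. {1..<p})"
      then have "0 < y i" "y i < p" using i by (force simp: PiE_def Pi_def)+
      then have "\<not> p dvd y i" using nat_dvd_not_less by blast
      then show "(if p dvd 0 + (\<Sum>i\<in>S. y i) then \<Prod>i\<in>S. X i (y i) else 0) = 0"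
        using i by simp
    qed
    then show ?thesis by simp
  qed
  have "(\<Sum>x | x \<in> PiE I (\<lambda>_. {..<p}) \<and> p dvd (\<Sum>i\<in>I. x i). \<Prod>i\<in>I. X i (x i)) = (\<Sum>S\<in>Pow I. ?T S)"
    using assms by (intro sum_prod_split_support) auto
  also have "\<dots> = (\<Sum>S\<in>insert {} ?P. ?T S)"
  proof (rule sum.mono_neutral_right)
    show "\<forall>S\<in>Pow I - insert {} ?P. ?T S = 0"
    proof
      fix S assume S: "S \<in> Pow I - insert {} ?P"
      then have "finite S" using assms(1) finite_subset by auto
      then have "card S \<noteq> 0" using S by auto
      then have "card S = 1" using S by auto
      then show "?T S = 0" using single S by blast
    qed
  qed (use assms in auto)
  also have "\<dots> = ?T {} + (\<Sum>S\<in>?P. ?T S)"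
    using finP by (intro sum.insert) auto
  also have "?T {} = (\<Prod>i\<in>I. X i 0)" by simp
  also have "(\<Sum>S\<in>?P. ?T S) \<le> (\<Sum>S\<in>?P. ?U S)"
  proof (rule sum_mono)
    fix S assume S: "S \<in> ?P"
    have "?T S \<le> (\<Prod>i\<in>I - S. X i 0) * ((\<Prod>i\<in>S. sqrt (real p * (\<Sum>x = 1..<p. (X i x)\<^sup>2))) / real p)"
      using S assms finite_subset[of S I]
      by (intro mult_left_mono sum_prod_congruence_le prod_nonneg) auto
    also have "\<dots> = ?U S"
    proof -
      have "(\<Prod>i\<in>I. if i \<in> S then sqrt (real p * (\<Sum>x = 1..<p. (X i x)\<^sup>2)) else X i 0)
         = (\<Prod>i\<in>I - S. X i 0) * (\<Prod>i\<in>S. sqrt (real p * (\<Sum>x = 1..<p. (X i x)\<^sup>2)))"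
        using S assms(1) by (subst prod.subset_diff[of S I]) auto
      then show ?thesis by simp
    qed
    finally show "?T S \<le> ?U S" .
  qed
  finally show ?thesis by simp
qed

lemma crt_inverse:
  fixes p n :: nat
  assumes "coprime p n" "p > 0" "n > 0"
  obtains g where "\<And>x b. \<lbrakk>x < p; b < n\<rbrakk> \<Longrightarrow> g x b < p * n \<and> g x b mod p = x \<and> g x b mod n = b"
    and "\<And>a. a < p * n \<Longrightarrow> g (a mod p) (a mod n) = a"
proof -
  have ex: "\<exists>!a. a < p * n \<and> [a = x] (mod p) \<and> [a = b] (mod n)" for x b
    using assms by (intro binary_chinese_remainder_unique_nat) auto
  define g where "g x b = (THE a. a < p * n \<and> [a = x] (mod p) \<and> [a = b] (mod n))" for x b
  have g: "g x b < p * n \<and> [g x b = x] (mod p) \<and> [g x b = b] (mod n)" for x b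
    unfolding g_def by (rule theI'[OF ex])
  show thesis
  proof (rule that)
    show "g x b < p * n \<and> g x b mod p = x \<and> g x b mod n = b" if "x < p" "b < n" for x b
      using g[of x b] that by (simp add: cong_def)
    show "g (a mod p) (a mod n) = a" if "a < p * n" for a
      unfolding g_def by (rule the1_equality[OF ex]) (use that in simp)
  qed
qed

text \<open>Splitting off one prime \<open>p\<close> of \<open>q\<close>, the set of indices \<open>i\<close> for which \<open>p\<close> does not divide \<open>a\<^sub>i\<close> is empty or has at
  least two elements, and each nonempty choice costs a factor \<open>1 / p\<close>. All denominators are thus
  summed at once.\<close>

theorem sum_prod_cyclic_le:
  fixes I :: "'a set" and F :: "'a \<Rightarrow> nat \<Rightarrow> real" and B :: "'a \<Rightarrow> real" and c :: "'a \<Rightarrow> nat"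
  assumes "squarefree q" and fin: "finite I"
    and "\<And>i a. 0 \<le> F i a" and "\<And>i. 0 \<le> B i"
    and "\<And>i d. \<lbrakk>i \<in> I; d dvd q\<rbrakk> \<Longrightarrow>
           real d * (\<Sum>a | a < q \<and> den q a = d. (F i a)\<^sup>2) \<le> (real (c i) ^ card (prime_factors d) * B i)\<^sup>2"
  shows "(\<Sum>a | a \<in> PiE I (\<lambda>_. {..<q}) \<and> q dvd (\<Sum>i\<in>I. a i). \<Prod>i\<in>I. F i (a i))
      \<le> (\<Prod>i\<in>I. B i) * (\<Prod>p\<in>prime_factors q. 1 + real (\<Sum>S | S \<subseteq> I \<and> 2 \<le> card S. \<Prod>i\<in>S. c i) / real p)"
  using assms(1,3,4,5)
proof (induction q arbitrary: F B rule: squarefree_induct)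
  case one
  have "(\<Sum>a | a \<in> PiE I (\<lambda>_. {..<1}) \<and> 1 dvd (\<Sum>i\<in>I. a i). \<Prod>i\<in>I. F i (a i)) = (\<Prod>i\<in>I. F i 0)"
  proof -
    have "{a. a \<in> PiE I (\<lambda>_. {..<1}) \<and> 1 dvd (\<Sum>i\<in>I. a i)} = {\<lambda>i\<in>I. 0::nat}"
      by (auto simp: PiE_def extensional_def Pi_def fun_eq_iff restrict_def)
    then show ?thesis by simp
  qed
  also have "\<dots> \<le> (\<Prod>i\<in>I. B i)"
  proof (intro prod_mono conjI one)
    fix i assume "i \<in> I"
    moreover have "{a. a < 1 \<and> den 1 a = 1} = {0::nat}" by (auto simp: den_def)
    ultimately have "(F i 0)\<^sup>2 \<le> (B i)\<^sup>2" using one(3)[of i 1] by simp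
    then show "F i 0 \<le> B i" using one(2) by (rule power2_le_imp_le)
  qed
  finally show ?case by simp
next
  case (mult p n)
  note nn = mult(5) and Bnn = mult(6) and hyp = mult(7)
  have p0: "p > 0" and n0: "n > 0" using mult(1,2) prime_gt_0_nat by (auto intro!: gr0I)
  have pn: "\<not> p dvd d" if "d dvd n" for d
    using mult(1,3) that by (metis coprime_absorb_left dvd_trans not_prime_unit)
  obtain g where g: "\<And>x b. \<lbrakk>x < p; b < n\<rbrakk> \<Longrightarrow> g x b < p * n \<and> g x b mod p = x \<and> g x b mod n = b"
    and g': "\<And>a. a < p * n \<Longrightarrow> g (a mod p) (a mod n) = a"
    using crt_inverse[OF mult(3) p0 n0] by metis
  let ?tup = "\<lambda>m. {a. a \<in> PiE I (\<lambda>_. {..<m}) \<and> m dvd (\<Sum>i\<in>I. a i :: nat)}"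
  let ?P = "{S. S \<subseteq> I \<and> 2 \<le> card S}"
  define Z where "Z S i b = (if i \<in> S then sqrt (real p * (\<Sum>x = 1..<p. (F i (g x b))\<^sup>2)) else F i (g 0 b))" for S i b
  define B' where "B' S i = (if i \<in> S then real (c i) * B i else B i)" for S i
  define K where "K = (\<Sum>S\<in>?P. \<Prod>i\<in>S. c i)"
  define Q where "Q = (\<Prod>p\<in>prime_factors n. 1 + real K / real p)"
  have Qnn: "Q \<ge> 0" unfolding Q_def by (intro prod_nonneg) auto
  have finP: "finite ?P" using fin by auto
  have dvd_iff: "p * n dvd (\<Sum>i\<in>I. a i) \<longleftrightarrow> p dvd (\<Sum>i\<in>I. a i mod p) \<and> n dvd (\<Sum>i\<in>I. a i mod n)" for a :: "'a \<Rightarrow> nat"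
    using mult(3) by (simp add: dvd_eq_mod_eq_0 mod_sum_eq)
      (metis divides_mult dvd_eq_mod_eq_0 dvd_mult_left dvd_mult_right)
  have "(\<Sum>a\<in>?tup (p * n). \<Prod>i\<in>I. F i (a i))
      = (\<Sum>z\<in>?tup n \<times> ?tup p. \<Prod>i\<in>I. F i (g (snd z i) (fst z i)))"
  proof (rule sum.reindex_bij_witness[where j = "\<lambda>a. (\<lambda>i\<in>I. a i mod n, \<lambda>i\<in>I. a i mod p)"
        and i = "\<lambda>z. \<lambda>i\<in>I. g (snd z i) (fst z i)"])
    fix a assume a: "a \<in> ?tup (p * n)"
    then have lt: "a i < p * n" if "i \<in> I" for i using that by (auto simp: PiE_def Pi_def)
    show "(\<lambda>i\<in>I. g (snd (\<lambda>i\<in>I. a i mod n, \<lambda>i\<in>I. a i mod p) i) (fst (\<lambda>i\<in>I. a i mod n, \<lambda>i\<in>I. a i mod p) i)) = a"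
      using a lt g' by (intro ext) (auto simp: PiE_def extensional_def)
    show "(\<lambda>i\<in>I. a i mod n, \<lambda>i\<in>I. a i mod p) \<in> ?tup n \<times> ?tup p"
      using a p0 n0 dvd_iff[of a] by auto
    show "(\<Prod>i\<in>I. F i (g (snd (\<lambda>i\<in>I. a i mod n, \<lambda>i\<in>I. a i mod p) i) (fst (\<lambda>i\<in>I. a i mod n, \<lambda>i\<in>I. a i mod p) i))) = (\<Prod>i\<in>I. F i (a i))"
      using lt g' by (intro prod.cong) auto
  next
    fix z assume z: "z \<in> ?tup n \<times> ?tup p"
    then have lt: "snd z i < p" "fst z i < n" if "i \<in> I" for i
      using that by (auto simp: PiE_def Pi_def mem_Times_iff)
    have gz: "g (snd z i) (fst z i) < p * n" "g (snd z i) (fst z i) mod p = snd z i" "g (snd z i) (fst z i) mod n = fst z i"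
      if "i \<in> I" for i using g[OF lt[OF that]] by auto
    have z1: "(\<lambda>i\<in>I. (\<lambda>i\<in>I. g (snd z i) (fst z i)) i mod n) = fst z"
      using z gz by (intro ext) (auto simp: PiE_def extensional_def mem_Times_iff)
    have z2: "(\<lambda>i\<in>I. (\<lambda>i\<in>I. g (snd z i) (fst z i)) i mod p) = snd z"
      using z gz by (intro ext) (auto simp: PiE_def extensional_def mem_Times_iff)
    show "(\<lambda>i\<in>I. (\<lambda>i\<in>I. g (snd z i) (fst z i)) i mod n, \<lambda>i\<in>I. (\<lambda>i\<in>I. g (snd z i) (fst z i)) i mod p) = z"
      using z1 z2 by (simp add: prod_eq_iff)
    show "(\<lambda>i\<in>I. g (snd z i) (fst z i)) \<in> ?tup (p * n)"
      using z gz dvd_iff[of "\<lambda>i. g (snd z i) (fst z i)"] by (auto simp: mem_Times_iff)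
  qed
  also have "\<dots> = (\<Sum>b\<in>?tup n. \<Sum>x\<in>?tup p. \<Prod>i\<in>I. F i (g (x i) (b i)))"
    by (simp add: sum.cartesian_product case_prod_unfold)
  also have "\<dots> \<le> (\<Sum>b\<in>?tup n. (\<Prod>i\<in>I. Z {} i (b i)) + (\<Sum>S\<in>?P. (\<Prod>i\<in>I. Z S i (b i)) / real p))"
  proof (rule sum_mono)
    fix b assume "b \<in> ?tup n"
    show "(\<Sum>x\<in>?tup p. \<Prod>i\<in>I. F i (g (x i) (b i))) \<le> (\<Prod>i\<in>I. Z {} i (b i)) + (\<Sum>S\<in>?P. (\<Prod>i\<in>I. Z S i (b i)) / real p)"
      unfolding Z_def using sum_prod_single_modulus_le[OF fin p0, of "\<lambda>i x. F i (g x (b i))"] nn by simp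
  qed
  also have "\<dots> = (\<Sum>b\<in>?tup n. \<Prod>i\<in>I. Z {} i (b i)) + (\<Sum>S\<in>?P. (\<Sum>b\<in>?tup n. \<Prod>i\<in>I. Z S i (b i)) / real p)"
  proof -
    have "(\<Sum>b\<in>?tup n. \<Sum>S\<in>?P. (\<Prod>i\<in>I. Z S i (b i)) / real p) = (\<Sum>S\<in>?P. \<Sum>b\<in>?tup n. (\<Prod>i\<in>I. Z S i (b i)) / real p)"
      by (rule sum.swap)
    then show ?thesis by (simp only: sum.distrib sum_divide_distrib)
  qed
  also have "\<dots> \<le> (\<Prod>i\<in>I. B' {} i) * Q + (\<Sum>S\<in>?P. ((\<Prod>i\<in>I. B' S i) * Q) / real p)"
  proof -
    have IH: "(\<Sum>b\<in>?tup n. \<Prod>i\<in>I. Z S i (b i)) \<le> (\<Prod>i\<in>I. B' S i) * Q" for S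
      unfolding Q_def K_def
    proof (rule mult.IH)
      show "0 \<le> Z S i a" for i a using nn by (auto simp: Z_def intro!: sum_nonneg mult_nonneg_nonneg)
      show "0 \<le> B' S i" for i using Bnn by (auto simp: B'_def)
      fix i d assume i: "i \<in> I" and d: "d dvd n"
      have d0: "d > 0" using d n0 by (auto intro!: gr0I)
      have nd: "\<not> p dvd d" using pn[OF d] .
      have b: "den (p * n) (g x b) = (if x = 0 then 1 else p) * den n b" if "x < p" "b < n" for x b
      proof -
        have "p dvd g x b \<longleftrightarrow> x = 0" using g[OF that] that by (auto simp: dvd_eq_mod_eq_0)
        then show ?thesis using den_mult_prime[OF mult(1,3), of "g x b"] g[OF that] by simp
      qed
      show "real d * (\<Sum>a | a < n \<and> den n a = d. (Z S i a)\<^sup>2) \<le> (real (c i) ^ card (prime_factors d) * B' S i)\<^sup>2"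
      proof (cases "i \<in> S")
        case True
        \<comment> \<open>Squaring \<open>Z\<close> releases the factor \<open>p\<close> under the
          root. It turns \<open>d\<close> into \<open>p * d\<close>, which is exactly the
          denominator modulo \<open>p * n\<close> of the residues involved, so the hypothesis on
          \<open>F\<close> applies with one more prime.\<close>
        have "(\<Sum>a | a < n \<and> den n a = d. (Z S i a)\<^sup>2) = (\<Sum>a | a < n \<and> den n a = d. real p * (\<Sum>x = 1..<p. (F i (g x a))\<^sup>2))"
          using True by (intro sum.cong) (auto simp: Z_def intro!: real_sqrt_pow2 mult_nonneg_nonneg sum_nonneg)
        also have "\<dots> = real p * (\<Sum>z\<in>{a. a < n \<and> den n a = d} \<times> {1..<p}. (F i (g (snd z) (fst z)))\<^sup>2)"
          by (simp add: sum_distrib_left[symmetric] sum.cartesian_product case_prod_unfold)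
        also have "(\<Sum>z\<in>{a. a < n \<and> den n a = d} \<times> {1..<p}. (F i (g (snd z) (fst z)))\<^sup>2)
            = (\<Sum>a | a < p * n \<and> den (p * n) a = p * d. (F i a)\<^sup>2)"
        proof (rule sum.reindex_bij_witness[where j = "\<lambda>z. g (snd z) (fst z)" and i = "\<lambda>a. (a mod n, a mod p)"])
          fix z assume "z \<in> {a. a < n \<and> den n a = d} \<times> {1..<p}"
          then show "(g (snd z) (fst z) mod n, g (snd z) (fst z) mod p) = z"
            "g (snd z) (fst z) \<in> {a. a < p * n \<and> den (p * n) a = p * d}"
            using g[of "snd z" "fst z"] b[of "snd z" "fst z"] by (auto simp: prod_eq_iff)
        next
          fix a assume a: "a \<in> {a. a < p * n \<and> den (p * n) a = p * d}"
          then show "g (snd (a mod n, a mod p)) (fst (a mod n, a mod p)) = a" using g' by simp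
          have *: "(if a mod p = 0 then 1 else p) * den n (a mod n) = p * d"
            using a b[of "a mod p" "a mod n"] p0 n0 g' by simp
          have "den n (a mod n) dvd n" using n0 by (simp add: den_def div_dvd_iff_mult) 
          then have "\<not> p dvd den n (a mod n)" by (rule pn)
          then have "a mod p \<noteq> 0" using * by (metis dvd_triv_left mult_1)
          then show "(a mod n, a mod p) \<in> {a. a < n \<and> den n a = d} \<times> {1..<p}"
            using * p0 n0 by auto
        qed simp
        finally have "real d * (\<Sum>a | a < n \<and> den n a = d. (Z S i a)\<^sup>2)
             = real (p * d) * (\<Sum>a | a < p * n \<and> den (p * n) a = p * d. (F i a)\<^sup>2)" by simp
        also have "\<dots> \<le> (real (c i) ^ card (prime_factors (p * d)) * B i)\<^sup>2"
          using hyp[OF i, of "p * d"] d by simp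
        also have "card (prime_factors (p * d)) = Suc (card (prime_factors d))"
        proof -
          have "prime_factors (p * d) = insert p (prime_factors d)"
            using p0 d0 mult(1) by (simp add: prime_factors_product prime_prime_factors)
          moreover have "p \<notin> prime_factors d" using nd by auto
          ultimately show ?thesis by simp
        qed
        finally show ?thesis using True by (simp add: B'_def ac_simps)
      next
        case False
        have "(\<Sum>a | a < n \<and> den n a = d. (Z S i a)\<^sup>2) = (\<Sum>a | a < n \<and> den n a = d. (F i (g 0 a))\<^sup>2)"
          using False by (simp add: Z_def)
        also have "\<dots> = (\<Sum>a | a < p * n \<and> den (p * n) a = d. (F i a)\<^sup>2)"
        proof (rule sum.reindex_bij_witness[where j = "\<lambda>b. g 0 b" and i = "\<lambda>a. a mod n"])
          fix z assume "z \<in> {a. a < n \<and> den n a = d}"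
          then show "g 0 z mod n = z" "g 0 z \<in> {a. a < p * n \<and> den (p * n) a = d}"
            using g[of 0 z] b[of 0 z] p0 by auto
        next
          fix a assume a: "a \<in> {a. a < p * n \<and> den (p * n) a = d}"
          have *: "(if a mod p = 0 then 1 else p) * den n (a mod n) = d"
            using a b[of "a mod p" "a mod n"] p0 n0 g' by simp
          then have "a mod p = 0" using nd by (metis dvd_triv_left)
          then show "g 0 (a mod n) = a" "a mod n \<in> {a. a < n \<and> den n a = d}"
            using * a g'[of a] n0 by auto
        qed simp
        finally show ?thesis
          using hyp[OF i, of d] d False by (simp add: B'_def)
      qed
    qed
    show ?thesis
      by (intro add_mono sum_mono divide_right_mono IH) auto
  qed
  also have "\<dots> = (\<Prod>i\<in>I. B i) * Q * (1 + (\<Sum>S\<in>?P. \<Prod>i\<in>S. real (c i)) / real p)"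
  proof -
    have "(\<Prod>i\<in>I. B' S i) = (\<Prod>i\<in>S. real (c i)) * (\<Prod>i\<in>I. B i)" if "S \<in> ?P" for S
    proof -
      have "(\<Prod>i\<in>I. B' S i) = (\<Prod>i\<in>I. (if i \<in> S then real (c i) else 1) * B i)"
        by (intro prod.cong) (auto simp: B'_def)
      also have "\<dots> = (\<Prod>i\<in>S. real (c i)) * (\<Prod>i\<in>I. B i)"
        using that fin by (simp add: prod.distrib prod.If_cases Int_absorb1)
      finally show ?thesis .
    qed
    then have "(\<Sum>S\<in>?P. ((\<Prod>i\<in>I. B' S i) * Q) / real p) = (\<Sum>S\<in>?P. (\<Prod>i\<in>S. real (c i)) * ((\<Prod>i\<in>I. B i) * Q / real p))"
      by (intro sum.cong) auto
    also have "\<dots> = (\<Sum>S\<in>?P. \<Prod>i\<in>S. real (c i)) * ((\<Prod>i\<in>I. B i) * Q / real p)"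
      by (rule sum_distrib_right[symmetric])
    finally show ?thesis
      unfolding B'_def by (simp add: algebra_simps)
  qed
  also have "\<dots> = (\<Prod>i\<in>I. B i) * (\<Prod>p\<in>prime_factors (p * n). 1 + real K / real p)"
  proof -
    have "prime_factors (p * n) = insert p (prime_factors n)"
      using p0 n0 mult(1) by (simp add: prime_factors_product prime_prime_factors)
    moreover have "p \<notin> prime_factors n" using pn[of n] by auto
    ultimately show ?thesis by (simp add: Q_def K_def mult.commute)
  qed
  finally show ?case by (simp add: K_def)
qed

section \<open>Weighted residues\<close>

definition rho :: "nat \<Rightarrow> real" where
  "rho q = real q / real (totient q)"

lemma squarefree_nat_gt_0: "squarefree (q :: nat) \<Longrightarrow> q > 0"
  by (cases q) auto

lemma squarefree_mult_imp_coprime: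
  fixes a b :: nat
  assumes "squarefree (a * b)"
  shows "coprime a b"
proof (rule coprimeI)
  fix c assume "c dvd a" "c dvd b"
  then have "c ^ 2 dvd a * b" by (simp add: power2_eq_square mult_dvd_mono)
  then show "is_unit c" using assms by (simp add: squarefree_def)
qed

lemma squarefree_dvd_intI:
  fixes x :: int
  assumes "squarefree q" and "\<And>p. \<lbrakk>prime p; p dvd q\<rbrakk> \<Longrightarrow> int p dvd x"
  shows "int q dvd x"
  using assms
proof (induction q rule: squarefree_induct)
  case (mult p n)
  have "coprime (int p) (int n)" using mult(3) by simp
  then show ?case using mult by (auto intro!: divides_mult)
qed simp

lemma squarefree_dvdI:
  fixes q x :: nat
  assumes "squarefree q" and "\<And>p. \<lbrakk>prime p; p dvd q\<rbrakk> \<Longrightarrow> p dvd x"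
  shows "q dvd x"
  using squarefree_dvd_intI[of q "int x"] assms by simp

lemma rho_mult_prime:
  assumes "prime p" "coprime p n"
  shows "rho (p * n) = rho n * (real p / (real p - 1))"
proof -
  have "totient (p * n) = (p - 1) * totient n"
    using assms by (simp add: totient_mult_coprime totient_prime)
  moreover have "real (p - 1) = real p - 1"
    using prime_gt_0_nat[OF assms(1)] by (simp add: of_nat_diff)
  ultimately show ?thesis by (simp add: rho_def mult.commute)
qed

lemma rho_ge_1: "q > 0 \<Longrightarrow> rho q \<ge> 1"
  using totient_le[of q] by (simp add: rho_def field_simps)

text \<open>Bernoulli's inequality gives \<open>1 + K / p \<le> (1 + 1 / (p - 1)) ^ K\<close>, and
  \<open>rho q\<close> is the product of \<open>p / (p - 1)\<close> over the primes of
  \<open>q\<close>.\<close>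

lemma prod_one_plus_le_rho:
  assumes "squarefree q"
  shows "(\<Prod>p\<in>prime_factors q. 1 + real K / real p) \<le> rho q ^ K"
  using assms
proof (induction q rule: squarefree_induct)
  case one
  then show ?case by (simp add: rho_def)
next
  case (mult p n)
  have p: "real p > 1" using mult(1) prime_gt_1_nat by auto
  have n0: "n > 0" using mult(2) squarefree_nat_gt_0 by auto
  have "prime_factors (p * n) = insert p (prime_factors n)"
    using n0 mult(1) p by (simp add: prime_factors_product prime_prime_factors)
  moreover have "p \<notin> prime_factors n"
    using mult(1,3) by (metis coprime_absorb_left in_prime_factors_imp_dvd not_prime_unit)
  ultimately have "(\<Prod>p\<in>prime_factors (p * n). 1 + real K / real p)
      = (1 + real K / real p) * (\<Prod>p\<in>prime_factors n. 1 + real K / real p)" by simp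
  also have "\<dots> \<le> (real p / (real p - 1)) ^ K * rho n ^ K"
  proof (intro mult_mono mult.IH)
    have "1 + real K / real p \<le> 1 + real K * (1 / (real p - 1))"
      using p by (simp add: divide_left_mono)
    also have "\<dots> \<le> (1 + 1 / (real p - 1)) ^ K"
      using p by (intro Bernoulli_inequality) (auto intro: order_trans[of _ 0])
    also have "1 + 1 / (real p - 1) = real p / (real p - 1)"
      using p by (simp add: field_simps)
    finally show "1 + real K / real p \<le> (real p / (real p - 1)) ^ K" .
  qed (use p in \<open>auto intro!: prod_nonneg\<close>)
  also have "\<dots> = rho (p * n) ^ K"
    using rho_mult_prime[OF mult(1,3)] by (simp add: power_mult_distrib power_divide mult.commute)
  finally show ?case .
qed

text \<open>Both sides factor over the primes of \<open>q\<close>, with local factors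
  \<open>1 + 1 / p\<close> and \<open>p / (p - 1)\<close>.\<close>

lemma sum_inverse_divisors_le_rho:
  assumes "squarefree q"
  shows "(\<Sum>t | t dvd q. 1 / real t) \<le> rho q"
  using assms
proof (induction q rule: squarefree_induct)
  case one
  then show ?case by (simp add: rho_def)
next
  case (mult p n)
  have p: "real p > 1" using mult(1) prime_gt_1_nat by auto
  have n0: "n > 0" using mult(2) squarefree_nat_gt_0 by auto
  have np: "\<not> p dvd n" using mult(1,3) by (metis coprime_absorb_left not_prime_unit)
  have div: "{t. t dvd p * n} = {t. t dvd n} \<union> (\<lambda>t. p * t) ` {t. t dvd n}"
  proof (intro equalityI subsetI)
    fix t assume t: "t \<in> {t. t dvd p * n}"
    show "t \<in> {t. t dvd n} \<union> (\<lambda>t. p * t) ` {t. t dvd n}"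
    proof (cases "p dvd t")
      case True
      then obtain s where "t = p * s" by auto
      then show ?thesis using t p by auto
    next
      case False
      then have "coprime t p" using mult(1) prime_imp_coprime coprime_commute by blast
      then show ?thesis using t by (simp add: coprime_dvd_mult_right_iff)
    qed
  qed auto
  have "(\<Sum>t | t dvd p * n. 1 / real t) = (\<Sum>t | t dvd n. 1 / real t) + (\<Sum>t\<in>(\<lambda>t. p * t) ` {t. t dvd n}. 1 / real t)"
    unfolding div using n0 np by (intro sum.union_disjoint) (auto dest: dvd_mult_left)
  also have "(\<Sum>t\<in>(\<lambda>t. p * t) ` {t. t dvd n}. 1 / real t) = (1 / real p) * (\<Sum>t | t dvd n. 1 / real t)"
    using p by (subst sum.reindex) (auto simp: inj_on_def sum_distrib_left)
  also have "(\<Sum>t | t dvd n. 1 / real t) + (1 / real p) * (\<Sum>t | t dvd n. 1 / real t)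
      = (\<Sum>t | t dvd n. 1 / real t) * (1 + 1 / real p)" by (simp add: algebra_simps)
  also have "\<dots> \<le> rho n * (real p / (real p - 1))"
  proof (rule mult_mono[OF mult.IH])
    have "1 + 1 / real p = (real p + 1) / real p" using p by (simp add: field_simps)
    also have "\<dots> \<le> real p / (real p - 1)" using p by (simp add: field_simps)
    finally show "1 + 1 / real p \<le> real p / (real p - 1)" .
  qed (use p in \<open>auto simp: rho_def\<close>)
  also have "\<dots> = rho (p * n)" using rho_mult_prime[OF mult(1,3)] by simp
  finally show ?case .
qed

lemma rho_mono_dvd:
  assumes "squarefree q" "d dvd q"
  shows "rho d \<le> rho q"
proof -
  obtain m where m: "q = d * m" using assms(2) by auto
  then have "squarefree d" "squarefree m" "coprime d m"
    using assms(1) by (auto dest: squarefree_multD simp: squarefree_mult_imp_coprime)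
  then have "rho q = rho d * rho m" using m by (simp add: rho_def totient_mult_coprime)
  moreover have "rho m \<ge> 1" using \<open>squarefree m\<close> squarefree_nat_gt_0 rho_ge_1 by auto
  moreover have "rho d \<ge> 0" by (simp add: rho_def)
  ultimately show ?thesis using mult_left_mono[of 1 "rho m" "rho d"] by simp
qed

lemma den_dvd: "q > 0 \<Longrightarrow> den q a dvd q"
  unfolding den_def by (metis dvd_div_mult_self dvd_triv_left gcd_dvd2)

lemma den_gt_0: "q > 0 \<Longrightarrow> den q a > 0"
  using den_dvd[of q a] by (auto intro!: gr0I)

lemma den_mod: "den q (a mod q) = den q a"
  unfolding den_def by (metis gcd.commute gcd_red_nat)

lemma dvd_den_mult: "q dvd den q a * a"
proof -
  have "den q a * a = q * (a div gcd a q)"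
    by (simp add: den_def dvd_div_mult div_mult_swap mult.commute)
  then show ?thesis by simp
qed

lemma den_eq_1_iff: "q > 0 \<Longrightarrow> den q a = 1 \<longleftrightarrow> q dvd a"
  using dvd_den_mult[of q a] by (auto simp: den_def gcd_nat.absorb2)

text \<open>For squarefree \<open>q\<close> a prime is either cancelled completely or kept.
  Divisibility between denominators can therefore be checked prime by prime on the numerators, which
  is how all later separation statements are proved.\<close>

lemma prime_dvd_den_iff:
  assumes "squarefree q" "prime p" "p dvd q"
  shows "p dvd den q a \<longleftrightarrow> \<not> p dvd a"
proof -
  obtain n where n: "q = p * n" using assms(3) by auto
  then have n': "squarefree n" "coprime p n"
    using assms(1) by (auto dest: squarefree_multD simp: squarefree_mult_imp_coprime)
  have "den n (a mod n) dvd n" using squarefree_nat_gt_0[OF n'(1)] by (rule den_dvd)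
  then have "\<not> p dvd den n (a mod n)"
    using n'(2) assms(2) by (metis coprime_absorb_left dvd_trans not_prime_unit)
  then show ?thesis using den_mult_prime[OF assms(2) n'(2), of a] n by auto
qed

section \<open>The weights attached to residues and their second moments\<close>

locale cyclic_weights =
  fixes q :: nat and h :: real
  assumes squarefree_q: "squarefree q" and h_ge_3: "h \<ge> 3"
begin

lemma q_gt_0: "q > 0"
  using squarefree_q squarefree_nat_gt_0 by auto

lemma ln_h_ge_1: "ln h \<ge> 1"
proof -
  have "exp 1 \<le> h" using exp_le h_ge_3 by linarith
  then show ?thesis using h_ge_3 by (simp add: ln_ge_iff)
qed

abbreviation dn :: "nat \<Rightarrow> nat" where
  "dn \<equiv> den q"

definition pk :: "nat \<Rightarrow> real" where
  "pk a = peak h (real a / real q)"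

text \<open>After the substitution that removes \<open>r\<close>, this majorizes, up to
  \<open>2 * rho q\<close>, the term \<open>\<mu>(d) / \<phi>(d)\<close> times the exponential sum
  at a fraction with denominator \<open>d\<close>. The value 0 at multiples of \<open>q\<close>
  encodes the condition that each \<open>q\<^sub>i\<close> exceeds 1.\<close>

definition wt :: "nat \<Rightarrow> real" where
  "wt a = (if q dvd a then 0 else pk a / real (dn a))"

definition tuples :: "nat set \<Rightarrow> (nat \<Rightarrow> nat) set" where
  "tuples I = {a. a \<in> PiE I (\<lambda>_. {..<q}) \<and> q dvd (\<Sum>i\<in>I. a i)}"

lemma pk_nonneg: "0 \<le> pk a"
  by (simp add: pk_def peak_nonneg)

lemma wt_nonneg: "0 \<le> wt a"
  by (simp add: wt_def pk_nonneg)

lemma pk_mod: "pk (a mod q) = pk a"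
proof -
  have "real a / real q = real (a mod q) / real q + of_int (int (a div q))"
  proof -
    have "real a = real (a mod q) + real (a div q) * real q"
      by (metis mod_div_mult_eq of_nat_add of_nat_mult)
    then show ?thesis using q_gt_0 by (simp add: field_simps)
  qed
  then show ?thesis unfolding pk_def by (metis peak_add_of_int)
qed

lemma pk_le_dn: "\<not> q dvd a \<Longrightarrow> pk a \<le> real (dn a)"
proof -
  assume a: "\<not> q dvd a"
  have "1 / real (dn a) \<le> dist_int (real_of_int (int a) / real q)"
    using a q_gt_0 den_gt_0[OF q_gt_0] dvd_den_mult[of q a]
    by (intro dist_int_ge_inverse) (auto simp flip: of_nat_mult)
  then have "peak h (real a / real q) \<le> 1 / (1 / real (dn a))"
    using den_gt_0[OF q_gt_0, of a] by (intro peak_le_inverse) auto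
  then show ?thesis by (simp add: pk_def)
qed

text \<open>A fraction with denominator \<open>dn a > 1\<close> stays \<open>1 / dn a\<close> away
  from the integers. The bound permits a variable to be discarded from a product in
  \<open>sum_coincident_le\<close>.\<close>

lemma wt_le_1: "wt a \<le> 1"
  using pk_le_dn[of a] den_gt_0[OF q_gt_0, of a] by (simp add: wt_def)

lemma finite_tuples: "finite I \<Longrightarrow> finite (tuples I)"
  unfolding tuples_def by (rule finite_subset[of _ "PiE I (\<lambda>_. {..<q})"]) (auto intro!: finite_PiE)

lemma sum_pk_den_le:
  assumes "d > 1"
  shows "(\<Sum>a | a < q \<and> dn a = d. pk a) \<le> 4 * real d * ln h"
    and "(\<Sum>a | a < q \<and> dn a = d. (pk a)\<^sup>2) \<le> 8 * h * real d"
    and "(\<Sum>a | a < q \<and> dn a = d. (pk a)\<^sup>2) \<le> 4 * (real d)\<^sup>2"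
proof -
  have mult: "int q dvd int d * int a" if "dn a = d" for a
    using dvd_den_mult[of q a] that by (simp flip: of_nat_mult)
  have sep: "\<not> int q dvd int x - int y \<and> (\<exists>n>0. real n \<le> real d \<and> int q dvd int n * (int x - int y))"
    if "x \<in> {a. a < q \<and> dn a = d}" "y \<in> {a. a < q \<and> dn a = d}" "x \<noteq> y" for x y
  proof
    show "\<not> int q dvd int x - int y"
    proof
      assume "int q dvd int x - int y"
      then have "[int x = int y] (mod int q)" by (simp add: cong_iff_dvd_diff)
      then have "[x = y] (mod q)" by (simp add: cong_int_iff)
      then show False using that by (simp add: cong_def)
    qed
    show "\<exists>n>0. real n \<le> real d \<and> int q dvd int n * (int x - int y)"
      using that assms mult by (intro exI[of _ d]) (auto simp: right_diff_distrib)
  qed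
  have low: "\<not> int q dvd int x \<and> (\<exists>n>0. real n \<le> real d \<and> int q dvd int n * int x)"
    if "x \<in> {a. a < q \<and> dn a = d}" for x
    using that assms mult den_eq_1_iff[OF q_gt_0, of x] by (auto intro!: exI[of _ d])
  have d: "real d > 0" using assms by simp
  have "finite {a. a < q \<and> dn a = d}" by simp
  note * = sum_peak_cyclic_nonzero_le[of h q "{a. a < q \<and> dn a = d}" "real d" int, OF h_ge_3 q_gt_0 this d sep low]
  show "(\<Sum>a | a < q \<and> dn a = d. pk a) \<le> 4 * real d * ln h"
    using *(1) by (simp add: pk_def)
  show "(\<Sum>a | a < q \<and> dn a = d. (pk a)\<^sup>2) \<le> 8 * h * real d"
    using *(2) by (simp add: pk_def)
  show "(\<Sum>a | a < q \<and> dn a = d. (pk a)\<^sup>2) \<le> 4 * (real d)\<^sup>2"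
    using *(3) by (simp add: pk_def)
qed

text \<open>The first bound is uniform in \<open>d\<close> and makes an index cost
  \<open>sqrt (8 * h)\<close>. The second is better for \<open>d < 2 * h\<close> and yields the
  saving when some denominator is small.\<close>

lemma sum_wt_square_den_le:
  assumes "d dvd q"
  shows "real d * (\<Sum>a | a < q \<and> dn a = d. (wt a)\<^sup>2) \<le> 8 * h"
    and "real d * (\<Sum>a | a < q \<and> dn a = d. (wt a)\<^sup>2) \<le> 4 * real d"
proof -
  have d0: "d > 0" using assms q_gt_0 by (auto intro!: gr0I)
  have "real d * (\<Sum>a | a < q \<and> dn a = d. (wt a)\<^sup>2) \<le> min (8 * h) (4 * real d)"
  proof (cases "d = 1")
    case True
    have "(\<Sum>a | a < q \<and> dn a = d. (wt a)\<^sup>2) = 0"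
      using True den_eq_1_iff[OF q_gt_0] by (intro sum.neutral) (auto simp: wt_def)
    then show ?thesis using h_ge_3 by simp
  next
    case False
    then have d1: "d > 1" using d0 by simp
    have "(\<Sum>a | a < q \<and> dn a = d. (wt a)\<^sup>2) = (\<Sum>a | a < q \<and> dn a = d. (pk a)\<^sup>2 / (real d)\<^sup>2)"
    proof (rule sum.cong[OF refl])
      fix a assume "a \<in> {a. a < q \<and> dn a = d}"
      then show "(wt a)\<^sup>2 = (pk a)\<^sup>2 / (real d)\<^sup>2"
        using d1 den_eq_1_iff[OF q_gt_0, of a] by (auto simp: wt_def power_divide)
    qed
    also have "\<dots> = (\<Sum>a | a < q \<and> dn a = d. (pk a)\<^sup>2) / (real d)\<^sup>2"
      by (simp add: sum_divide_distrib)
    finally have "real d * (\<Sum>a | a < q \<and> dn a = d. (wt a)\<^sup>2) = (\<Sum>a | a < q \<and> dn a = d. (pk a)\<^sup>2) / real d"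
      using d0 by (simp add: power2_eq_square)
    moreover have "(\<Sum>a | a < q \<and> dn a = d. (pk a)\<^sup>2) / real d \<le> 8 * h * real d / real d"
      using sum_pk_den_le(2)[OF d1] by (intro divide_right_mono) auto
    moreover have "(\<Sum>a | a < q \<and> dn a = d. (pk a)\<^sup>2) / real d \<le> 4 * (real d)\<^sup>2 / real d"
      using sum_pk_den_le(3)[OF d1] by (intro divide_right_mono) auto
    ultimately show ?thesis using d0 by (simp add: power2_eq_square)
  qed
  then show "real d * (\<Sum>a | a < q \<and> dn a = d. (wt a)\<^sup>2) \<le> 8 * h"
    "real d * (\<Sum>a | a < q \<and> dn a = d. (wt a)\<^sup>2) \<le> 4 * real d" by auto
qed

text \<open>The form in which the Montgomery--Vaughan inequality is applied. The multiplicity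
  \<open>c i\<close> is 1 for the plain weight and 3 for the merged one, and enters only through the
  exponent of \<open>rho q\<close>.\<close>

lemma sum_prod_tuples_le:
  fixes F :: "nat \<Rightarrow> nat \<Rightarrow> real" and B :: "nat \<Rightarrow> real" and c :: "nat \<Rightarrow> nat"
  assumes fin: "finite I" and nn: "\<And>i a. 0 \<le> F i a" and Bnn: "\<And>i. 0 \<le> B i"
    and hyp: "\<And>i d. \<lbrakk>i \<in> I; d dvd q\<rbrakk> \<Longrightarrow>
           real d * (\<Sum>a | a < q \<and> dn a = d. (F i a)\<^sup>2) \<le> (real (c i) ^ card (prime_factors d) * B i)\<^sup>2"
  shows "(\<Sum>a\<in>tuples I. \<Prod>i\<in>I. F i (a i)) \<le> (\<Prod>i\<in>I. B i) * rho q ^ (\<Sum>S | S \<subseteq> I \<and> 2 \<le> card S. \<Prod>i\<in>S. c i)"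
proof -
  have "(\<Sum>a\<in>tuples I. \<Prod>i\<in>I. F i (a i)) \<le> (\<Prod>i\<in>I. B i) *
     (\<Prod>p\<in>prime_factors q. 1 + real (\<Sum>S | S \<subseteq> I \<and> 2 \<le> card S. \<Prod>i\<in>S. c i) / real p)"
    unfolding tuples_def by (rule sum_prod_cyclic_le[OF squarefree_q fin nn Bnn hyp])
  also have "\<dots> \<le> (\<Prod>i\<in>I. B i) * rho q ^ (\<Sum>S | S \<subseteq> I \<and> 2 \<le> card S. \<Prod>i\<in>S. c i)"
    by (intro mult_left_mono prod_one_plus_le_rho squarefree_q prod_nonneg) (simp add: Bnn)
  finally show ?thesis .
qed

end

text \<open>The exponent of \<open>rho q\<close> in \<open>sum_prod_tuples_le\<close> when every
  \<open>c i\<close> is 1.\<close>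

lemma card_subsets_ge_2:
  assumes "finite I"
  shows "card {S. S \<subseteq> I \<and> 2 \<le> card S} = 2 ^ card I - card I - 1"
proof -
  have "Pow I = {S. S \<subseteq> I \<and> 2 \<le> card S} \<union> ({{}} \<union> (\<lambda>i. {i}) ` I)"
  proof (intro equalityI subsetI)
    fix S assume S: "S \<in> Pow I"
    then have "finite S" using assms finite_subset by auto
    then have "card S = 0 \<longleftrightarrow> S = {}" by simp
    moreover have "card S = 1 \<longleftrightarrow> (\<exists>i. S = {i})" by (simp add: card_1_singleton_iff)
    moreover have "card S = 0 \<or> card S = 1 \<or> 2 \<le> card S" by linarith
    ultimately show "S \<in> {S. S \<subseteq> I \<and> 2 \<le> card S} \<union> ({{}} \<union> (\<lambda>i. {i}) ` I)" using S by auto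
  qed auto
  moreover have "card ({S. S \<subseteq> I \<and> 2 \<le> card S} \<union> ({{}} \<union> (\<lambda>i. {i}) ` I))
      = card {S. S \<subseteq> I \<and> 2 \<le> card S} + card ({{}} \<union> (\<lambda>i. {i}) ` I)"
    using assms by (intro card_Un_disjoint) auto
  moreover have "card ({{}} \<union> (\<lambda>i. {i}) ` I) = 1 + card I"
    using assms by (subst card_Un_disjoint) (auto simp: card_image)
  ultimately show ?thesis using card_Pow[of I] assms by simp
qed

section \<open>Merging two fractions\<close>

context cyclic_weights
begin

text \<open>If \<open>a / q\<close> and \<open>b / q\<close> have denominators with gcd \<open>s t\<close>, where \<open>s\<close> is the part that survives in
  the denominator \<open>r1 r2 s\<close> of their sum, then the denominators are \<open>r1 s t\<close> and \<open>r2 s t\<close>.\<close>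

definition split_pairs :: "nat \<Rightarrow> nat \<Rightarrow> nat \<Rightarrow> nat \<Rightarrow> nat \<Rightarrow> (nat \<times> nat) set" where
  "split_pairs r1 r2 s t \<beta> = {(a, b). a < q \<and> b < q \<and> (a + b) mod q = \<beta> \<and> dn a = r1 * s * t \<and> dn b = r2 * s * t}"

lemma finite_split_pairs: "finite (split_pairs r1 r2 s t \<beta>)"
  by (rule finite_subset[of _ "{..<q} \<times> {..<q}"]) (auto simp: split_pairs_def)

lemma not_cong_of_lt:
  assumes "x < q" "y < q" "x \<noteq> y"
  shows "\<not> int q dvd int x - int y"
proof
  assume "int q dvd int x - int y"
  then have "[int x = int y] (mod int q)" by (simp add: cong_iff_dvd_diff)
  then have "[x = y] (mod q)" by (simp add: cong_int_iff)
  then show False using assms by (simp add: cong_def)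
qed

text \<open>At a prime \<open>p\<close> not dividing \<open>N\<close> the residue of
  \<open>a\<close> is dictated by \<beta>. If \<open>p\<close> divides \<open>r1\<close>, it does
  not divide the denominator of \<open>b\<close>, so \<open>b\<close> vanishes modulo
  \<open>p\<close> and \<open>a\<close> agrees with \<beta>; if not, \<open>a\<close> itself
  vanishes modulo \<open>p\<close>. Only the primes of \<open>N\<close> remain free.\<close>

lemma split_pairs_separated:
  assumes \<beta>: "dn \<beta> = r1 * r2 * s"
    and ab: "(a, b) \<in> split_pairs r1 r2 s t \<beta>" "(a', b') \<in> split_pairs r1 r2 s t' \<beta>"
    and N: "s * t dvd N" "s * t' dvd N"
  shows "int q dvd int N * (int a - int a')"
proof (rule squarefree_dvd_intI[OF squarefree_q])
  fix p assume p: "prime p" "p dvd q"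
  note pd = prime_dvd_den_iff[OF squarefree_q p]
  show "int p dvd int N * (int a - int a')"
  proof (cases "p dvd N")
    case False
    then have np: "\<not> p dvd s" "\<not> p dvd t" "\<not> p dvd t'"
      using N by (metis dvd_mult_left dvd_mult_right dvd_trans)+
    have "int p dvd int a - int a'"
    proof (cases "p dvd r1")
      case True
      have "squarefree (r1 * (r2 * s))" using \<beta> den_dvd[OF q_gt_0, of \<beta>] squarefree_q squarefree_mono
        by (metis mult.assoc)
      then have "coprime r1 r2" using squarefree_mult_imp_coprime by fastforce
      then have "\<not> p dvd r2" using True p(1) by (meson coprime_common_divisor not_prime_unit)
      then have "p dvd b" "p dvd b'"
        using pd[of b] pd[of b'] ab np p(1) by (auto simp: split_pairs_def prime_dvd_mult_iff)
      moreover have "int p dvd (int a + int b) - (int a' + int b')"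
      proof -
        have "[a + b = a' + b'] (mod q)" using ab by (auto simp: split_pairs_def cong_def)
        then have "[int (a + b) = int (a' + b')] (mod int q)" by (simp only: cong_int_iff)
        then have "int q dvd (int a + int b) - (int a' + int b')" by (simp add: cong_iff_dvd_diff)
        then show ?thesis using p(2) by (meson dvd_trans int_dvd_int_iff)
      qed
      moreover have "int a - int a' = (int a + int b) - (int a' + int b') - int b + int b'" by simp
      ultimately show ?thesis by (simp only: dvd_add dvd_diff int_dvd_int_iff)
    next
      case False
      then have "p dvd a" "p dvd a'"
        using pd[of a] pd[of a'] ab np p(1) by (auto simp: split_pairs_def prime_dvd_mult_iff)
      then show ?thesis by (simp add: dvd_diff)
    qed
    then show ?thesis by simp
  qed simp
qed

text \<open>The entry \<open>a\<close> alone identifies the summand: its denominator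
  \<open>r1 * s * t\<close> gives \<open>t\<close>, and \<beta> then gives \<open>b\<close>.
  Distinct summands thus have distinct \<open>a\<close>, with differences of denominator at most
  \<open>N\<close> by \<open>split_pairs_separated\<close>.\<close>

lemma sum_pk_split_pairs_le:
  fixes N :: real
  assumes \<beta>: "dn \<beta> = r1 * r2 * s" and Ts: "finite Ts" and N: "N > 0"
    and cover: "\<And>t t'. \<lbrakk>t \<in> Ts; t' \<in> Ts\<rbrakk> \<Longrightarrow> \<exists>n>0. real n \<le> N \<and> s * t dvd n \<and> s * t' dvd n"
  shows "(\<Sum>t\<in>Ts. \<Sum>(a, b)\<in>split_pairs r1 r2 s t \<beta>. pk a) \<le> 2 * h + 4 * N * ln h"
proof -
  let ?A = "Sigma Ts (\<lambda>t. split_pairs r1 r2 s t \<beta>)"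
  have pos: "r1 * s > 0" using \<beta> den_gt_0[OF q_gt_0, of \<beta>] by (auto intro!: gr0I)
  have "(\<Sum>x\<in>?A. peak h (real_of_int (int (fst (snd x))) / real q)) \<le> 2 * h + 4 * N * ln h"
  proof (rule sum_peak_cyclic_le[OF h_ge_3 q_gt_0 _ N])
    show "finite ?A" using Ts finite_split_pairs by auto
    fix x y assume x: "x \<in> ?A" and y: "y \<in> ?A" and ne: "x \<noteq> y"
    obtain t a b where x': "x = (t, a, b)" by (cases x) auto
    obtain t' a' b' where y': "y = (t', a', b')" by (cases y) auto
    have ab: "(a, b) \<in> split_pairs r1 r2 s t \<beta>" "(a', b') \<in> split_pairs r1 r2 s t' \<beta>" "t \<in> Ts" "t' \<in> Ts"
      using x y x' y' by auto
    have "a \<noteq> a'"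
    proof
      assume eq: "a = a'"
      then have "t = t'" using ab pos by (auto simp: split_pairs_def)
      moreover have "b = b'"
      proof -
        have "[a + b = a + b'] (mod q)" using ab eq by (auto simp: split_pairs_def cong_def)
        then have "[b = b'] (mod q)" by (simp add: cong_add_lcancel_nat)
        then show ?thesis using ab by (auto simp: split_pairs_def cong_def)
      qed
      ultimately show False using ne x' y' eq by simp
    qed
    then have "\<not> int q dvd int a - int a'"
      using ab by (intro not_cong_of_lt) (auto simp: split_pairs_def)
    moreover obtain n where "n > 0" "real n \<le> N" "s * t dvd n" "s * t' dvd n"
      using cover ab by blast
    moreover have "int q dvd int n * (int a - int a')"
      using split_pairs_separated[OF \<beta> ab(1,2)] calculation by blast
    ultimately show "\<not> int q dvd int (fst (snd x)) - int (fst (snd y)) \<and>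
        (\<exists>n>0. real n \<le> N \<and> int q dvd int n * (int (fst (snd x)) - int (fst (snd y))))"
      using x' y' by auto
  qed
  also have "(\<Sum>x\<in>?A. peak h (real_of_int (int (fst (snd x))) / real q))
      = (\<Sum>t\<in>Ts. \<Sum>z\<in>split_pairs r1 r2 s t \<beta>. pk (fst z))"
    using Ts finite_split_pairs by (subst sum.Sigma) (auto simp: pk_def case_prod_unfold)
  finally show ?thesis by (simp add: case_prod_unfold)
qed

text \<open>With \<open>a\<close> fixed, \<open>a + b\<close> is determined modulo every prime
  \<open>p\<close> outside \<open>r2 * s\<close>. If \<open>p\<close> divides \<open>r1\<close>, it
  does not divide \<open>t\<close>, hence not the denominator of \<open>b\<close>, and
  \<open>b\<close> vanishes modulo \<open>p\<close>; otherwise \<open>a + b\<close> does. So the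
  values \<open>a + b\<close> are spaced by \<open>1 / (r2 * s)\<close>.\<close>

lemma sum_pk_square_fibre_le:
  assumes a: "dn a = r1 * s * t" and pos: "r2 * s > 0"
  shows "(\<Sum>b | b < q \<and> dn b = r2 * s * t \<and> dn (a + b) = r1 * r2 * s. (pk (a + b))\<^sup>2)
     \<le> 2 * h\<^sup>2 + 8 * h * real (r2 * s)"
proof -
  let ?A = "{b. b < q \<and> dn b = r2 * s * t \<and> dn (a + b) = r1 * r2 * s}"
  have "(\<Sum>b\<in>?A. (peak h (real_of_int (int (a + b)) / real q))\<^sup>2) \<le> 2 * h\<^sup>2 + 8 * h * real (r2 * s)"
  proof (rule sum_peak_cyclic_le[OF h_ge_3 q_gt_0])
    show "finite ?A" by simp
    show "0 < real (r2 * s)" using pos by (simp only: of_nat_0_less_iff)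
    fix b b' assume b: "b \<in> ?A" and b': "b' \<in> ?A" and ne: "b \<noteq> b'"
    have "int q dvd int (r2 * s) * (int b - int b')"
    proof (rule squarefree_dvd_intI[OF squarefree_q])
      fix p assume p: "prime p" "p dvd q"
      note pd = prime_dvd_den_iff[OF squarefree_q p]
      show "int p dvd int (r2 * s) * (int b - int b')"
      proof (cases "p dvd r2 * s")
        case True
        then show ?thesis by (metis dvd_mult2 int_dvd_int_iff)
      next
        case False
        then have np: "\<not> p dvd r2" "\<not> p dvd s" by auto
        have "int p dvd int b - int b'"
        proof (cases "p dvd r1")
          case True
          have "\<not> p dvd t"
          proof
            assume "p dvd t"
            have "squarefree (r1 * (s * t))" using a den_dvd[OF q_gt_0, of a] squarefree_q squarefree_mono
              by (metis mult.assoc)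
            then have "coprime r1 (s * t)" by (rule squarefree_mult_imp_coprime)
            then show False using True \<open>p dvd t\<close> p(1) by (meson coprime_common_divisor dvd_mult not_prime_unit)
          qed
          then have "p dvd b" "p dvd b'"
            using pd[of b] pd[of b'] b b' np p by (auto simp: prime_dvd_mult_iff)
          then show ?thesis by (simp add: dvd_diff)
        next
          case False
          then have "p dvd a + b" "p dvd a + b'"
            using pd[of "a + b"] pd[of "a + b'"] b b' np p by (auto simp: prime_dvd_mult_iff)
          then have "int p dvd int (a + b) - int (a + b')" by (simp only: dvd_diff int_dvd_int_iff)
          then show ?thesis by simp
        qed
        then show ?thesis by simp
      qed
    qed
    moreover have "\<not> int q dvd int b - int b'" using b b' ne by (intro not_cong_of_lt) auto
    ultimately show "\<not> int q dvd int (a + b) - int (a + b') \<and>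
        (\<exists>n>0. real n \<le> real (r2 * s) \<and> int q dvd int n * (int (a + b) - int (a + b')))"
      using pos by (auto intro!: exI[of _ "r2 * s"])
  qed
  then show ?thesis by (simp add: pk_def)
qed

text \<open>The sum is reorganised by \<open>a\<close> instead of \<beta>: for each \<open>a\<close>
  the squares are summed over the fibre, and the remaining first moment runs over residues of
  denominator \<open>r1 * s * t\<close>. This being greater than 1 excludes \<open>a = 0\<close> and
  avoids an extra term of size \<open>h\<close>.\<close>

lemma sum_pk_square_split_pairs_le:
  assumes m: "m = r1 * r2 * s" "m dvd q" and gt: "r1 * s * t > 1"
  shows "(\<Sum>\<beta> | \<beta> < q \<and> dn \<beta> = m. (pk \<beta>)\<^sup>2 * (\<Sum>(a, b)\<in>split_pairs r1 r2 s t \<beta>. pk a))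
     \<le> 4 * real (r1 * s * t) * ln h * (2 * h\<^sup>2 + 8 * h * real (r2 * s))"
proof -
  have m0: "m > 0" using m(2) q_gt_0 by (auto intro!: gr0I)
  let ?M = "{\<beta>. \<beta> < q \<and> dn \<beta> = m}"
  let ?A = "{a. a < q \<and> dn a = r1 * s * t}"
  let ?B = "\<lambda>a. {b. b < q \<and> dn b = r2 * s * t \<and> dn (a + b) = r1 * r2 * s}"
  have "(\<Sum>\<beta>\<in>?M. (pk \<beta>)\<^sup>2 * (\<Sum>(a, b)\<in>split_pairs r1 r2 s t \<beta>. pk a))
     = (\<Sum>\<beta>\<in>?M. \<Sum>z\<in>split_pairs r1 r2 s t \<beta>. (pk \<beta>)\<^sup>2 * pk (fst z))"
    by (simp add: sum_distrib_left case_prod_unfold)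
  also have "\<dots> = (\<Sum>x\<in>Sigma ?M (split_pairs r1 r2 s t). (pk (fst x))\<^sup>2 * pk (fst (snd x)))"
    using finite_split_pairs by (subst sum.Sigma) (auto simp: case_prod_unfold)
  also have "\<dots> = (\<Sum>z\<in>Sigma ?A ?B. pk (fst z) * (pk (fst z + snd z))\<^sup>2)"
  proof (rule sum.reindex_bij_witness[where j = snd and i = "\<lambda>z. ((fst z + snd z) mod q, z)"])
    fix x assume x: "x \<in> Sigma ?M (split_pairs r1 r2 s t)"
    show "((fst (snd x) + snd (snd x)) mod q, snd x) = x"
      using x by (auto simp: split_pairs_def)
    show "snd x \<in> Sigma ?A ?B"
      using x m(1) by (auto simp: split_pairs_def den_mod)
    have "pk (fst (snd x) + snd (snd x)) = pk (fst x)"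
      using x pk_mod[of "fst (snd x) + snd (snd x)"] by (auto simp: split_pairs_def)
    then show "pk (fst (snd x)) * (pk (fst (snd x) + snd (snd x)))\<^sup>2 = (pk (fst x))\<^sup>2 * pk (fst (snd x))"
      by simp
  next
    fix z assume z: "z \<in> Sigma ?A ?B"
    show "((fst z + snd z) mod q, z) \<in> Sigma ?M (split_pairs r1 r2 s t)"
      using z m(1) q_gt_0 by (auto simp: split_pairs_def den_mod)
  qed simp
  also have "\<dots> = (\<Sum>a\<in>?A. pk a * (\<Sum>b\<in>?B a. (pk (a + b))\<^sup>2))"
    unfolding sum_distrib_left by (subst sum.Sigma) (auto simp: case_prod_unfold)
  also have "\<dots> \<le> (\<Sum>a\<in>?A. pk a * (2 * h\<^sup>2 + 8 * h * real (r2 * s)))"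
    using m m0 by (intro sum_mono mult_left_mono pk_nonneg sum_pk_square_fibre_le) auto
  also have "\<dots> = (\<Sum>a\<in>?A. pk a) * (2 * h\<^sup>2 + 8 * h * real (r2 * s))"
    by (rule sum_distrib_right[symmetric])
  also have "\<dots> \<le> 4 * real (r1 * s * t) * ln h * (2 * h\<^sup>2 + 8 * h * real (r2 * s))"
    using sum_pk_den_le(1)[OF gt] h_ge_3 by (intro mult_right_mono) auto
  finally show ?thesis .
qed

text \<open>On \<open>split_pairs\<close> the product of the two denominators is
  \<open>r1 * r2 * s * s\<close> times the square of \<open>t\<close>, and
  \<open>peak_mult_le\<close> has replaced \<open>pk b\<close> by \<open>pk \<beta>\<close>. Up to a
  factor 2 this is half of what the given \<open>r1\<close>, \<open>r2\<close>, \<open>s\<close> and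
  the range \<open>Ts\<close> contribute to a merged weight; the other half has \<open>r1\<close>
  and \<open>r2\<close> interchanged.\<close>

definition block :: "nat \<Rightarrow> nat \<Rightarrow> nat \<Rightarrow> nat set \<Rightarrow> nat \<Rightarrow> real" where
  "block r1 r2 s Ts \<beta> = pk \<beta> / real (r1 * r2 * s * s) *
     (\<Sum>t\<in>Ts. (1 / (real t)\<^sup>2) * (\<Sum>(a, b)\<in>split_pairs r1 r2 s t \<beta>. pk a))"

lemma block_nonneg: "0 \<le> block r1 r2 s Ts \<beta>"
  unfolding block_def
  by (intro mult_nonneg_nonneg divide_nonneg_nonneg sum_nonneg) (auto simp: pk_nonneg)

text \<open>The square of the sum over \<open>t\<close> is bounded by its supremum, controlled by the spacing of all
  fractions with \<open>T \<le> t < 2 T\<close> at once, times its first moment.\<close>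

lemma block_dyadic_le:
  assumes m: "m = r1 * r2 * s" "m dvd q"
    and T: "T > 0" "Ts \<subseteq> {T..<2 * T}" and gt: "\<And>t. t \<in> Ts \<Longrightarrow> r1 * s * t > 1"
  shows "real m * (\<Sum>\<beta> | \<beta> < q \<and> dn \<beta> = m. (block r1 r2 s Ts \<beta>)\<^sup>2)
    \<le> 1024 * (ln h)\<^sup>2 * h * (h + real s * (real T)\<^sup>2) * (h + real r2 * real s) / (real r2 * (real s)\<^sup>2 * (real T)\<^sup>2)"
proof -
  let ?M = "{\<beta>. \<beta> < q \<and> dn \<beta> = m}"
  let ?L = "ln h"
  have m0: "m > 0" using m(2) q_gt_0 by (auto intro!: gr0I)
  then have pos: "real r1 > 0" "real r2 > 0" "real s > 0" "real m > 0" "real T > 0" using m(1) T by (auto intro!: gr0I)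
  have fin: "finite Ts" using T finite_subset by blast
  define \<Theta> where "\<Theta> \<beta> = (\<Sum>t\<in>Ts. \<Sum>(a, b)\<in>split_pairs r1 r2 s t \<beta>. pk a)" for \<beta>
  have \<Theta>nn: "0 \<le> \<Theta> \<beta>" for \<beta> unfolding \<Theta>_def by (intro sum_nonneg) (auto simp: pk_nonneg)
  \<comment> \<open>Both \<open>s * t\<close> and \<open>s * t'\<close> divide
    \<open>s * t * t'\<close>, which is at most \<open>4 * s * T\<^sup>2\<close>. Taking this as
    \<open>N\<close> in \<open>sum_pk_split_pairs_le\<close> gives the factor 16.\<close>
  define S where "S = 16 * ?L * (h + real s * (real T)\<^sup>2)"
  have Snn: "S \<ge> 0" unfolding S_def using ln_h_ge_1 h_ge_3 by (intro mult_nonneg_nonneg) auto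
  have sup: "\<Theta> \<beta> \<le> S" if "\<beta> \<in> ?M" for \<beta>
  proof -
    have "\<Theta> \<beta> \<le> 2 * h + 4 * (4 * real s * (real T)\<^sup>2) * ?L"
      unfolding \<Theta>_def
    proof (rule sum_pk_split_pairs_le)
      show "dn \<beta> = r1 * r2 * s" using that m by simp
      show "finite Ts" by (rule fin)
      show "0 < 4 * real s * (real T)\<^sup>2" using pos by simp
      fix t t' assume t: "t \<in> Ts" "t' \<in> Ts"
      have tt: "0 < t" "0 < t'" "t \<le> 2 * T" "t' \<le> 2 * T" using t T by force+
      have "real (s * t * t') \<le> 4 * real s * (real T)\<^sup>2"
      proof -
        have "real t * real t' \<le> (2 * real T) * (2 * real T)"
          using tt by (intro mult_mono) auto
        then show ?thesis using pos by (simp add: power2_eq_square algebra_simps)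
      qed
      then show "\<exists>n>0. real n \<le> 4 * real s * (real T)\<^sup>2 \<and> s * t dvd n \<and> s * t' dvd n"
        using tt pos by (intro exI[of _ "s * t * t'"]) (auto simp: mult.assoc mult.left_commute)
    qed
    also have "\<dots> \<le> S"
    proof -
      have "h * 1 \<le> h * ?L" using ln_h_ge_1 h_ge_3 by (intro mult_left_mono) auto
      moreover have "0 \<le> h * ?L" using ln_h_ge_1 h_ge_3 by simp
      ultimately have "2 * h \<le> 16 * (h * ?L)" by linarith
      then show ?thesis by (simp add: S_def algebra_simps)
    qed
    finally show ?thesis .
  qed
  have L1: "(\<Sum>\<beta>\<in>?M. (pk \<beta>)\<^sup>2 * \<Theta> \<beta>) \<le> real T * (8 * real r1 * real s * real T * ?L * (8 * h * (h + real r2 * real s)))"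
  proof -
    have "(\<Sum>\<beta>\<in>?M. (pk \<beta>)\<^sup>2 * \<Theta> \<beta>) = (\<Sum>t\<in>Ts. \<Sum>\<beta>\<in>?M. (pk \<beta>)\<^sup>2 * (\<Sum>(a, b)\<in>split_pairs r1 r2 s t \<beta>. pk a))"
      unfolding \<Theta>_def sum_distrib_left by (rule sum.swap)
    also have "\<dots> \<le> (\<Sum>t\<in>Ts. 8 * real r1 * real s * real T * ?L * (8 * h * (h + real r2 * real s)))"
    proof (rule sum_mono)
      fix t assume t: "t \<in> Ts"
      have "(\<Sum>\<beta>\<in>?M. (pk \<beta>)\<^sup>2 * (\<Sum>(a, b)\<in>split_pairs r1 r2 s t \<beta>. pk a))
          \<le> 4 * real (r1 * s * t) * ?L * (2 * h\<^sup>2 + 8 * h * real (r2 * s))"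
        by (rule sum_pk_square_split_pairs_le[OF m gt[OF t]])
      also have "\<dots> \<le> 8 * real r1 * real s * real T * ?L * (8 * h * (h + real r2 * real s))"
      proof (rule mult_mono[OF mult_right_mono])
        have "real t \<le> 2 * real T" using t T by force
        then have "real r1 * real s * real t \<le> real r1 * real s * (2 * real T)"
          using pos by (intro mult_left_mono) auto
        then show "4 * real (r1 * s * t) \<le> 8 * real r1 * real s * real T" by (simp add: algebra_simps)
        show "2 * h\<^sup>2 + 8 * h * real (r2 * s) \<le> 8 * h * (h + real r2 * real s)"
          by (simp add: power2_eq_square algebra_simps)
      qed (use ln_h_ge_1 h_ge_3 pos in auto)
      finally show "(\<Sum>\<beta>\<in>?M. (pk \<beta>)\<^sup>2 * (\<Sum>(a, b)\<in>split_pairs r1 r2 s t \<beta>. pk a)) \<le> \<dots>" .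
    qed
    also have "\<dots> = real (card Ts) * (8 * real r1 * real s * real T * ?L * (8 * h * (h + real r2 * real s)))"
      by simp
    also have "\<dots> \<le> real T * (8 * real r1 * real s * real T * ?L * (8 * h * (h + real r2 * real s)))"
    proof (rule mult_right_mono)
      show "real (card Ts) \<le> real T" using card_mono[OF _ T(2)] by simp
      show "0 \<le> 8 * real r1 * real s * real T * ?L * (8 * h * (h + real r2 * real s))"
        using ln_h_ge_1 h_ge_3 by (intro mult_nonneg_nonneg add_nonneg_nonneg) auto
    qed
    finally show ?thesis .
  qed
  let ?k = "(real m * real s)\<^sup>2 * (real T)^4"
  have "(\<Sum>\<beta>\<in>?M. (block r1 r2 s Ts \<beta>)\<^sup>2) \<le> (\<Sum>\<beta>\<in>?M. (S / ?k) * ((pk \<beta>)\<^sup>2 * \<Theta> \<beta>))"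
  proof (rule sum_mono)
    fix \<beta> assume \<beta>: "\<beta> \<in> ?M"
    have "(\<Sum>t\<in>Ts. (1 / (real t)\<^sup>2) * (\<Sum>(a, b)\<in>split_pairs r1 r2 s t \<beta>. pk a))
        \<le> (\<Sum>t\<in>Ts. (1 / (real T)\<^sup>2) * (\<Sum>(a, b)\<in>split_pairs r1 r2 s t \<beta>. pk a))"
    proof (intro sum_mono mult_right_mono)
      fix t assume "t \<in> Ts"
      then have "real T \<le> real t" using T by force
      then show "1 / (real t)\<^sup>2 \<le> 1 / (real T)\<^sup>2"
        using pos by (intro frac_le power_mono) auto
    qed (auto intro!: sum_nonneg simp: pk_nonneg)
    also have "\<dots> = \<Theta> \<beta> / (real T)\<^sup>2" by (simp add: \<Theta>_def sum_divide_distrib)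
    finally have "block r1 r2 s Ts \<beta> \<le> pk \<beta> / (real m * real s) * (\<Theta> \<beta> / (real T)\<^sup>2)"
    proof -
      assume le: "(\<Sum>t\<in>Ts. (1 / (real t)\<^sup>2) * (\<Sum>(a, b)\<in>split_pairs r1 r2 s t \<beta>. pk a)) \<le> \<Theta> \<beta> / (real T)\<^sup>2"
      have "real (r1 * r2 * s * s) = real m * real s" using m(1) by simp
      then show ?thesis
        unfolding block_def using le by (simp only:) (intro mult_left_mono divide_nonneg_nonneg pk_nonneg, auto)
    qed
    then have "(block r1 r2 s Ts \<beta>)\<^sup>2 \<le> (pk \<beta> / (real m * real s) * (\<Theta> \<beta> / (real T)\<^sup>2))\<^sup>2"
      by (rule power_mono) (rule block_nonneg)
    also have "\<dots> = (pk \<beta>)\<^sup>2 * \<Theta> \<beta> / ?k * \<Theta> \<beta>"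
      by (simp add: power_mult_distrib power_divide power2_eq_square power4_eq_xxxx ac_simps)
    also have "\<dots> \<le> (pk \<beta>)\<^sup>2 * \<Theta> \<beta> / ?k * S"
      using sup[OF \<beta>] \<Theta>nn by (intro mult_left_mono) auto
    finally show "(block r1 r2 s Ts \<beta>)\<^sup>2 \<le> (S / ?k) * ((pk \<beta>)\<^sup>2 * \<Theta> \<beta>)" by (simp add: mult.commute)
  qed
  also have "\<dots> = (S / ?k) * (\<Sum>\<beta>\<in>?M. (pk \<beta>)\<^sup>2 * \<Theta> \<beta>)" by (rule sum_distrib_left[symmetric])
  also have "\<dots> \<le> (S / ?k) * (real T * (8 * real r1 * real s * real T * ?L * (8 * h * (h + real r2 * real s))))"
    using L1 Snn by (intro mult_left_mono) auto
  finally have "real m * (\<Sum>\<beta>\<in>?M. (block r1 r2 s Ts \<beta>)\<^sup>2)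
     \<le> real m * ((S / ?k) * (real T * (8 * real r1 * real s * real T * ?L * (8 * h * (h + real r2 * real s)))))"
    by (intro mult_left_mono) auto
  also have "\<dots> = 1024 * ?L\<^sup>2 * h * (h + real s * (real T)\<^sup>2) * (h + real r2 * real s) / (real r2 * (real s)\<^sup>2 * (real T)\<^sup>2)"
    using pos unfolding S_def m(1) by (simp add: divide_simps power2_eq_square power4_eq_xxxx)
  finally show ?thesis .
qed

text \<open>Each \<open>t\<close> is treated alone, with spacing \<open>1 / (s * t)\<close>.
  Dividing \<open>2 * h + 4 * s * t * ln h\<close> by the square of \<open>t\<close> leaves
  \<open>1 / t\<close> times a quantity bounded through \<open>T\<close>, and the sum of
  \<open>1 / t\<close> over divisors of \<open>q\<close> costs \<open>rho q\<close>. This is the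
  only power of \<open>rho q\<close> that merging itself produces.\<close>

lemma block_large_le:
  assumes m: "m = r1 * r2 * s" "m dvd q" "m > 1"
    and T: "T > 0" "\<And>t. t \<in> Ts \<Longrightarrow> t dvd q \<and> T \<le> real t"
  shows "real m * (\<Sum>\<beta> | \<beta> < q \<and> dn \<beta> = m. (block r1 r2 s Ts \<beta>)\<^sup>2)
    \<le> 8 * h * (rho q * (2 * h / (real s * T) + 4 * ln h))\<^sup>2"
proof -
  let ?M = "{\<beta>. \<beta> < q \<and> dn \<beta> = m}"
  let ?L = "ln h"
  have pos: "real r1 > 0" "real r2 > 0" "real s > 0" "real m > 0" using m(1,3) by (auto intro!: gr0I simp del: of_nat_mult)
  have fin: "finite Ts" using T q_gt_0 by (intro finite_subset[of Ts "{t. t dvd q}"]) auto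
  let ?S = "rho q * (2 * h / T + 4 * real s * ?L)"
  have sup: "(\<Sum>t\<in>Ts. (1 / (real t)\<^sup>2) * (\<Sum>(a, b)\<in>split_pairs r1 r2 s t \<beta>. pk a)) \<le> ?S" if "\<beta> \<in> ?M" for \<beta>
  proof -
    have "(\<Sum>t\<in>Ts. (1 / (real t)\<^sup>2) * (\<Sum>(a, b)\<in>split_pairs r1 r2 s t \<beta>. pk a))
        \<le> (\<Sum>t\<in>Ts. (1 / real t) * (2 * h / T + 4 * real s * ?L))"
    proof (rule sum_mono)
      fix t assume t: "t \<in> Ts"
      have t0: "real t > 0" "T \<le> real t" using T t by force+
      have "(\<Sum>t\<in>{t}. \<Sum>(a, b)\<in>split_pairs r1 r2 s t \<beta>. pk a) \<le> 2 * h + 4 * (real s * real t) * ?L"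
        using that m(1) pos t0
        by (intro sum_pk_split_pairs_le) (auto intro!: exI[of _ "s * t"])
      then have "(1 / (real t)\<^sup>2) * (\<Sum>(a, b)\<in>split_pairs r1 r2 s t \<beta>. pk a)
          \<le> (1 / (real t)\<^sup>2) * (2 * h + 4 * (real s * real t) * ?L)"
        by (intro mult_left_mono) auto
      also have "\<dots> = (1 / real t) * (2 * h / real t + 4 * real s * ?L)"
        using t0 by (simp add: field_simps power2_eq_square)
      also have "\<dots> \<le> (1 / real t) * (2 * h / T + 4 * real s * ?L)"
        using t0 T h_ge_3 by (intro mult_left_mono add_mono divide_left_mono) auto
      finally show "(1 / (real t)\<^sup>2) * (\<Sum>(a, b)\<in>split_pairs r1 r2 s t \<beta>. pk a) \<le> \<dots>" .
    qed
    also have "\<dots> = (\<Sum>t\<in>Ts. 1 / real t) * (2 * h / T + 4 * real s * ?L)"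
      by (rule sum_distrib_right[symmetric])
    also have "\<dots> \<le> ?S"
    proof (rule mult_right_mono)
      have "(\<Sum>t\<in>Ts. 1 / real t) \<le> (\<Sum>t | t dvd q. 1 / real t)"
        using T q_gt_0 by (intro sum_mono2) auto
      also have "\<dots> \<le> rho q" using squarefree_q by (rule sum_inverse_divisors_le_rho)
      finally show "(\<Sum>t\<in>Ts. 1 / real t) \<le> rho q" .
    qed (use h_ge_3 ln_h_ge_1 T in auto)
    finally show ?thesis .
  qed
  let ?U = "rho q * (2 * h / (real s * T) + 4 * ?L)"
  have "(\<Sum>\<beta>\<in>?M. (block r1 r2 s Ts \<beta>)\<^sup>2) \<le> (\<Sum>\<beta>\<in>?M. (pk \<beta>)\<^sup>2 * (?U / real m)\<^sup>2)"
  proof (rule sum_mono)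
    fix \<beta> assume \<beta>: "\<beta> \<in> ?M"
    have "block r1 r2 s Ts \<beta> \<le> pk \<beta> / (real m * real s) * ?S"
      unfolding block_def using m(1) pk_nonneg sup[OF \<beta>] by (simp add: divide_right_mono mult_left_mono)
    also have "\<dots> = pk \<beta> * (?U / real m)"
      using pos T(1) by (simp add: divide_simps)
    finally have "(block r1 r2 s Ts \<beta>)\<^sup>2 \<le> (pk \<beta> * (?U / real m))\<^sup>2"
      by (rule power_mono) (rule block_nonneg)
    then show "(block r1 r2 s Ts \<beta>)\<^sup>2 \<le> (pk \<beta>)\<^sup>2 * (?U / real m)\<^sup>2" by (simp only: power_mult_distrib)
  qed
  also have "\<dots> = (\<Sum>\<beta>\<in>?M. (pk \<beta>)\<^sup>2) * (?U / real m)\<^sup>2" by (rule sum_distrib_right[symmetric])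
  also have "\<dots> \<le> (8 * h * real m) * (?U / real m)\<^sup>2"
    using sum_pk_den_le(2)[OF m(3)] by (intro mult_right_mono) auto
  finally have "real m * (\<Sum>\<beta>\<in>?M. (block r1 r2 s Ts \<beta>)\<^sup>2) \<le> real m * ((8 * h * real m) * (?U / real m)\<^sup>2)"
    by (intro mult_left_mono) auto
  also have "\<dots> = 8 * h * ?U\<^sup>2" using pos by (simp add: power_divide power2_eq_square)
  finally show ?thesis .
qed

end

text \<open>A factorization of a squarefree number is the choice, for each prime, of the factor that
  receives it; \<phi> records this choice. Here the multiplicity 3 of a merged index
  originates.\<close>

lemma card_factorizations3_le:
  assumes "squarefree (m :: nat)"
  shows "finite {(r1, r2, s). r1 * r2 * s = m}"
    and "card {(r1, r2, s). r1 * r2 * s = m} \<le> 3 ^ card (prime_factors m)"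
proof -
  let ?K = "{(r1, r2, s). r1 * r2 * s = m}"
  have m0: "m > 0" using assms squarefree_nat_gt_0 by auto
  show fin: "finite ?K"
    by (rule finite_subset[of _ "{d. d dvd m} \<times> {d. d dvd m} \<times> {d. d dvd m}"])
      (use m0 in \<open>auto simp: mult.assoc\<close>)
  define \<phi> where "\<phi> = (\<lambda>(r1, r2, s :: nat). \<lambda>p\<in>prime_factors m. if p dvd r1 then 0 else if p dvd r2 then 1 else (2 :: nat))"
  have "inj_on \<phi> ?K"
  proof (rule inj_onI)
    fix x y assume x: "x \<in> ?K" and y: "y \<in> ?K" and eq: "\<phi> x = \<phi> y"
    obtain r1 r2 s where x': "x = (r1, r2, s)" by (cases x) auto
    obtain r1' r2' s' where y': "y = (r1', r2', s')" by (cases y) auto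
    have xm: "r1 * r2 * s = m" and ym: "r1' * r2' * s' = m" using x y x' y' by auto
    have cop: "coprime a b \<and> squarefree a \<and> squarefree b \<and> a dvd m \<and> b dvd m" if "a * b * c = m" for a b c :: nat
    proof -
      have "squarefree (a * b)" using assms that squarefree_multD by blast
      then show ?thesis using squarefree_mult_imp_coprime squarefree_multD that by (metis dvd_mult_left dvd_mult_right dvd_triv_left)
    qed
    have ev: "(if p dvd r1 then 0 else if p dvd r2 then 1 else 2) = (if p dvd r1' then 0 else if p dvd r2' then 1 else (2::nat))"
      if "prime p" "p dvd m" for p
    proof -
      have "p \<in> prime_factors m" using that m0 by (simp add: prime_factors_dvd)
      then show ?thesis using fun_cong[OF eq, of p] x' y' by (simp add: \<phi>_def)
    qed
    have nb: "\<not> (p dvd a \<and> p dvd b)" if "prime p" "coprime a b" for p a b :: nat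
      using that by (meson coprime_common_divisor not_prime_unit)
    have e1: "p dvd r1 \<longleftrightarrow> p dvd r1'" if "prime p" "p dvd m" for p
      using ev[OF that] by (auto split: if_splits)
    have e2: "p dvd r2 \<longleftrightarrow> p dvd r2'" if "prime p" "p dvd m" for p
    proof -
      have "\<not> (p dvd r1 \<and> p dvd r2)" "\<not> (p dvd r1' \<and> p dvd r2')"
        using nb[OF that(1)] cop[OF xm] cop[OF ym] by blast+
      then show ?thesis using ev[OF that] by (auto split: if_splits)
    qed
    have eqI: "x = y" if "squarefree x" "squarefree y" "x dvd m" "y dvd m"
      "\<And>p. \<lbrakk>prime p; p dvd m\<rbrakk> \<Longrightarrow> p dvd x \<longleftrightarrow> p dvd y" for x y :: nat
    proof (rule dvd_antisym)
      show "x dvd y"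
        by (rule squarefree_dvdI[OF that(1)]) (use that(3,5) dvd_trans in blast)
      show "y dvd x"
        by (rule squarefree_dvdI[OF that(2)]) (use that(4,5) dvd_trans in blast)
    qed
    have "r1 = r1'" using cop[OF xm] cop[OF ym] e1 by (intro eqI) simp_all
    moreover have "r2 = r2'" using cop[OF xm] cop[OF ym] e2 by (intro eqI) simp_all
    ultimately have "r1 = r1' \<and> r2 = r2' \<and> s = s'" using xm ym m0 by auto
    then show "x = y" using x' y' by simp
  qed
  moreover have "\<phi> ` ?K \<subseteq> PiE (prime_factors m) (\<lambda>_. {0, 1, 2})"
    by (auto simp: \<phi>_def PiE_iff split: if_splits)
  ultimately have "card ?K \<le> card (PiE (prime_factors m) (\<lambda>_. {0, 1, 2 :: nat}))"
    by (intro card_inj_on_le finite_PiE) auto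
  then show "card ?K \<le> 3 ^ card (prime_factors m)"
    by (simp add: card_PiE numeral_3_eq_3)
qed

section \<open>Decomposition of the merged weight into blocks\<close>

context cyclic_weights
begin

text \<open>Let \<open>d\<close> be the gcd of the two denominators; \<open>s\<close> is the part of
  \<open>d\<close> that remains in the denominator of the sum, \<open>t\<close> the part that
  cancels. A prime dividing exactly one of the denominators cannot cancel in the sum, so the
  cofactors \<open>r1\<close>, \<open>r2\<close> survive in full.\<close>

lemma split_pair_exists:
  assumes ab: "a < q" "b < q"
  obtains r1 r2 s t where "r1 * r2 * s = dn (a + b)" "dn a = r1 * s * t" "dn b = r2 * s * t"
    "s * t = gcd (dn a) (dn b)" "t dvd q"
proof -
  define m where "m = dn (a + b)"
  define d where "d = gcd (dn a) (dn b)"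
  define r1 r2 where "r1 = dn a div d" and "r2 = dn b div d"
  define s where "s = gcd d m"
  define t where "t = d div s"
  have d0: "d > 0" using den_gt_0[OF q_gt_0, of a] by (simp add: d_def)
  have da: "dn a = r1 * d" and db: "dn b = r2 * d" by (simp_all add: r1_def r2_def d_def)
  have dst: "d = s * t" by (simp add: t_def s_def)
  have sqf: "squarefree x" if "x dvd q" for x using that squarefree_q squarefree_mono by blast
  have dq: "dn x dvd q" for x by (rule den_dvd[OF q_gt_0])
  have c12: "coprime r1 r2" unfolding r1_def r2_def d_def using den_gt_0[OF q_gt_0, of a] by (intro div_gcd_coprime) simp
  have c1: "coprime r1 d" using sqf[OF dq[of a]] da squarefree_mult_imp_coprime by simp
  have c2: "coprime r2 d" using sqf[OF dq[of b]] db squarefree_mult_imp_coprime by simp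
  have sd: "s dvd d" "s dvd m" by (simp_all add: s_def)
  have nb: "\<not> (p dvd x \<and> p dvd y)" if "prime p" "coprime x y" for p x y :: nat
    using that by (meson coprime_common_divisor not_prime_unit)
  have r1m: "r1 dvd m"
  proof (rule squarefree_dvdI)
    show "squarefree r1" using sqf[of r1] dq[of a] da by (metis dvd_mult_left)
    fix p assume p: "prime p" "p dvd r1"
    have pq: "p dvd q" using p da dq[of a] by (metis dvd_mult2 dvd_trans)
    note pd = prime_dvd_den_iff[OF squarefree_q p(1) pq]
    have "p dvd dn a" using p da by simp
    moreover have "\<not> p dvd dn b"
      using nb[OF p(1) c12] nb[OF p(1) c1] p db by (auto simp: prime_dvd_mult_iff)
    ultimately have "\<not> p dvd a" "p dvd b" using pd by auto
    then have "\<not> p dvd a + b" using dvd_add_left_iff by blast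
    then show "p dvd m" using pd m_def by simp
  qed
  have r2m: "r2 dvd m"
  proof (rule squarefree_dvdI)
    show "squarefree r2" using sqf[of r2] dq[of b] db by (metis dvd_mult_left)
    fix p assume p: "prime p" "p dvd r2"
    have pq: "p dvd q" using p db dq[of b] by (metis dvd_mult2 dvd_trans)
    note pd = prime_dvd_den_iff[OF squarefree_q p(1) pq]
    have "p dvd dn b" using p db by simp
    moreover have "\<not> p dvd dn a"
      using nb[OF p(1) c12] nb[OF p(1) c2] p da by (auto simp: prime_dvd_mult_iff)
    ultimately have "\<not> p dvd b" "p dvd a" using pd by auto
    then have "\<not> p dvd a + b" using dvd_add_right_iff by blast
    then show "p dvd m" using pd m_def by simp
  qed
  have "r1 * r2 * s = m"
  proof (rule dvd_antisym)
    have "coprime (r1 * r2) s" using c1 c2 sd by (meson coprime_divisors coprime_mult_left_iff dvd_refl)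
    then show "r1 * r2 * s dvd m" using r1m r2m sd c12 by (intro divides_mult) auto
    show "m dvd r1 * r2 * s"
    proof (rule squarefree_dvdI)
      show "squarefree m" using sqf dq m_def by simp
      fix p assume p: "prime p" "p dvd m"
      have pq: "p dvd q" using p dq[of "a + b"] m_def by (metis dvd_trans)
      note pd = prime_dvd_den_iff[OF squarefree_q p(1) pq]
      have "\<not> p dvd a + b" using p pd m_def by simp
      then have "p dvd dn a \<or> p dvd dn b" using pd[of a] pd[of b] dvd_add by blast
      then have "p dvd r1 * d \<or> p dvd r2 * d" using da db by argo
      then have "p dvd d \<or> p dvd r1 \<or> p dvd r2" using p(1) prime_dvd_mult_iff by blast
      moreover have "p dvd s" if "p dvd d" using that p(2) by (simp add: s_def)
      ultimately show "p dvd r1 * r2 * s" by fastforce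
    qed
  qed
  moreover have "t dvd q"
  proof -
    have "t dvd d" using dst by simp
    moreover have "d dvd dn a" by (simp add: d_def)
    ultimately show ?thesis using dq[of a] dvd_trans by blast
  qed
  moreover have "dn a = r1 * s * t" "dn b = r2 * s * t"
    unfolding mult.assoc dst[symmetric] by (fact da, fact db)
  moreover have "s * t = gcd (dn a) (dn b)"
    using dst unfolding d_def by (rule sym)
  ultimately show thesis
    by (intro that[of r1 r2 s t]) (simp_all only: m_def)
qed

definition merge_pairs :: "real \<Rightarrow> real \<Rightarrow> nat \<Rightarrow> (nat \<times> nat) set" where
  "merge_pairs H D \<beta> = {(a, b). a < q \<and> b < q \<and> (a + b) mod q = \<beta> \<and>
     H \<le> real (dn a) \<and> H \<le> real (dn b) \<and> D \<le> real (gcd (dn a) (dn b))}"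

text \<open>The value at 0 belongs to cancelling pairs, for which no saving is available; it is set
  to 0 so that the second moment over each denominator can be small.\<close>

definition merged_wt :: "real \<Rightarrow> real \<Rightarrow> nat \<Rightarrow> real" where
  "merged_wt H D \<beta> = (if \<beta> = 0 then 0 else \<Sum>(a, b)\<in>merge_pairs H D \<beta>. wt a * wt b)"

text \<open>The index \<open>j = J + 1\<close> collects all large \<open>t\<close>; the others are dyadic.\<close>

definition scales :: "real \<Rightarrow> real \<Rightarrow> nat \<Rightarrow> nat \<Rightarrow> nat \<Rightarrow> nat \<Rightarrow> nat \<Rightarrow> nat set" where
  "scales H D J r1 r2 s j = {t. t dvd q \<and> D \<le> real (s * t) \<and> H \<le> real (r1 * s * t) \<and> H \<le> real (r2 * s * t) \<and>
     (if j = Suc J then h powr (4 / 3) \<le> real s * (real t)\<^sup>2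
      else real s * (real t)\<^sup>2 < h powr (4 / 3) \<and> 2 ^ j \<le> t \<and> t < 2 * 2 ^ j)}"

lemma finite_scales: "finite (scales H D J r1 r2 s j)"
  by (rule finite_subset[of _ "{t. t dvd q}"]) (use q_gt_0 in \<open>auto simp: scales_def\<close>)

lemma scales_commute: "scales H D J r2 r1 s j = scales H D J r1 r2 s j"
  by (auto simp: scales_def)

text \<open>The exponent 4/3 in \<open>scales\<close> is a balance. With a threshold
  \<open>h\<close> to the power \<theta>, large \<open>t\<close> cost about \<open>h\<close> to the
  power 3 - \<theta>, while the dyadic ranges cost up to \<open>h\<close> to the power 2 +
  \<theta>/2, divided by \<open>H\<close>. For \<open>H\<close> close to \<open>h\<close> the two
  agree at \<theta> = 4/3.\<close>

lemma block_scales_le: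
  assumes m: "m = r1 * r2 * s" "m dvd q" "m > 1" and H: "1 < H" "H \<le> h" and D: "1 \<le> D"
  shows "real m * (\<Sum>\<beta> | \<beta> < q \<and> dn \<beta> = m. (block r1 r2 s (scales H D J r1 r2 s j) \<beta>)\<^sup>2)
    \<le> 6144 * (rho q)\<^sup>2 * (ln h)\<^sup>2 * h\<^sup>2 * (h / (H * D) + h powr (2 / 3) / H)"
proof -
  let ?M = "{\<beta>. \<beta> < q \<and> dn \<beta> = m}" and ?T = "scales H D J r1 r2 s j" and ?L = "ln h"
  have pos: "real r1 > 0" "real r2 > 0" "real s > 0" "h > 0" using m(1,3) h_ge_3 by (auto intro!: gr0I)
  have rho1: "rho q \<ge> 1" using rho_ge_1 q_gt_0 by auto
  have \<Lambda>: "0 \<le> h / (H * D)" "0 \<le> h powr (2 / 3) / H" using H D pos by auto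
  show ?thesis
  proof (cases "j = Suc J")
    case True
    let ?x = "h powr (2 / 3) / sqrt (real s)"
    have x0: "?x > 0" using pos by simp
    have "?x \<le> real t" if "t \<in> ?T" for t
    proof -
      have "h powr (4 / 3) \<le> real s * (real t)\<^sup>2" using that True by (simp add: scales_def)
      moreover have "h powr (4 / 3) = (h powr (2 / 3))\<^sup>2"
        using pos by (simp add: power2_eq_square powr_add[symmetric])
      moreover have "real s * (real t)\<^sup>2 = (sqrt (real s) * real t)\<^sup>2"
        using pos by (simp add: power_mult_distrib)
      ultimately have "h powr (2 / 3) \<le> sqrt (real s) * real t"
        using power2_le_imp_le[of "h powr (2 / 3)" "sqrt (real s) * real t"] by simp
      then show ?thesis using pos by (simp add: field_simps)
    qed
    then have "real m * (\<Sum>\<beta>\<in>?M. (block r1 r2 s ?T \<beta>)\<^sup>2) \<le> 8 * h * (rho q * (2 * h / (real s * ?x) + 4 * ?L))\<^sup>2"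
      using x0 by (intro block_large_le m) (auto simp: scales_def)
    also have "\<dots> \<le> 8 * h * (rho q * (6 * ?L * h powr (1 / 3)))\<^sup>2"
    proof -
      have "real s * ?x = sqrt (real s) * h powr (2 / 3)"
        using pos by (simp add: field_simps)
      then have "2 * h / (real s * ?x) \<le> 2 * h / h powr (2 / 3)"
        using pos by (auto intro!: divide_left_mono mult_pos_pos)
      also have "\<dots> = 2 * h powr (1 / 3)"
        using pos powr_diff[of h 1 "2/3"] by simp
      also have "\<dots> \<le> 2 * (?L * h powr (1 / 3))"
        using mult_right_mono[OF ln_h_ge_1, of "h powr (1 / 3)"] by simp
      finally have 1: "2 * h / (real s * ?x) \<le> 2 * (?L * h powr (1 / 3))" .
      have "?L * 1 \<le> ?L * h powr (1 / 3)"
        using ln_h_ge_1 h_ge_3 by (intro mult_left_mono ge_one_powr_ge_zero) auto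
      then have "2 * h / (real s * ?x) + 4 * ?L \<le> 6 * ?L * h powr (1 / 3)" using 1 by simp
      moreover have "0 \<le> 2 * h / (real s * ?x) + 4 * ?L"
        using pos ln_h_ge_1 x0 by (intro add_nonneg_nonneg divide_nonneg_nonneg mult_nonneg_nonneg) (use h_ge_3 in simp_all)
      ultimately show ?thesis
        using rho1 pos by (intro mult_left_mono power_mono) auto
    qed
    also have "\<dots> = 288 * (rho q)\<^sup>2 * ?L\<^sup>2 * (h * (h powr (1 / 3))\<^sup>2)"
      by (simp add: power_mult_distrib)
    also have "h * (h powr (1 / 3))\<^sup>2 = h * h powr (2 / 3)"
      using pos by (simp add: power2_eq_square powr_add[symmetric])
    also have "288 * (rho q)\<^sup>2 * ?L\<^sup>2 * (h * h powr (2 / 3)) \<le> 6144 * (rho q)\<^sup>2 * ?L\<^sup>2 * (h\<^sup>2 * (h / (H * D) + h powr (2 / 3) / H))"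
    proof (rule mult_mono)
      have "h * h powr (2 / 3) = h\<^sup>2 * (h powr (2 / 3) / h)" using pos by (simp add: power2_eq_square)
      also have "\<dots> \<le> h\<^sup>2 * (h / (H * D) + h powr (2 / 3) / H)"
      proof (rule mult_left_mono)
        have "h powr (2 / 3) / h \<le> h powr (2 / 3) / H" using H pos by (intro divide_left_mono) auto
        then show "h powr (2 / 3) / h \<le> h / (H * D) + h powr (2 / 3) / H" using \<Lambda> by linarith
      qed simp
      finally show "h * h powr (2 / 3) \<le> h\<^sup>2 * (h / (H * D) + h powr (2 / 3) / H)" .
    qed (use pos in auto)
    finally show ?thesis by (simp add: mult.assoc)
  next
    case False
    show ?thesis
    proof (cases "?T = {}")
      case True
      then have "block r1 r2 s ?T \<beta> = 0" for \<beta> by (simp add: block_def)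
      then show ?thesis using \<Lambda> by simp
    next
      case nonempty: False
      then obtain t where "t \<in> ?T" by auto
      then have t: "D \<le> real s * real t" "H \<le> real r2 * real s * real t"
        "real s * (real t)\<^sup>2 < h powr (4 / 3)" "2 ^ j \<le> t" "t < 2 * 2 ^ j"
        using False by (auto simp: scales_def)
      define T where "T = (2 ^ j :: nat)"
      have T1: "1 \<le> real T" "real T \<le> real t" "real t \<le> 2 * real T"
      proof -
        have "1 \<le> T" "T \<le> t" "t \<le> 2 * T" using t(4,5) by (auto simp: T_def)
        then show "1 \<le> real T" "real T \<le> real t" "real t \<le> 2 * real T" by linarith+
      qed
      have y: "D / 2 \<le> real s * real T"
      proof -
        have "real s * real t \<le> real s * (2 * real T)" using T1 by (intro mult_left_mono) auto
        then show ?thesis using t(1) by simp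
      qed
      have x: "H / 2 \<le> real r2 * real s * real T"
      proof -
        have "real r2 * real s * real t \<le> real r2 * real s * (2 * real T)" using T1 by (intro mult_left_mono) auto
        then show ?thesis using t(2) by simp
      qed
      have Th: "real T \<le> h powr (2 / 3)"
      proof (rule power2_le_imp_le)
        have "(real T)\<^sup>2 \<le> (real t)\<^sup>2" using T1 by (intro power_mono) auto
        also have "\<dots> \<le> real s * (real t)\<^sup>2"
          using mult_right_mono[of 1 "real s" "(real t)\<^sup>2"] pos(3) by simp
        also have "\<dots> \<le> h powr (4 / 3)" using t by simp
        also have "h powr (4 / 3) = (h powr (2 / 3))\<^sup>2"
          using pos by (simp add: power2_eq_square powr_add[symmetric])
        finally show "(real T)\<^sup>2 \<le> (h powr (2 / 3))\<^sup>2" .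
      qed simp
      have "real m * (\<Sum>\<beta>\<in>?M. (block r1 r2 s ?T \<beta>)\<^sup>2)
        \<le> 1024 * ?L\<^sup>2 * h * (h + real s * (real T)\<^sup>2) * (h + real r2 * real s) / (real r2 * (real s)\<^sup>2 * (real T)\<^sup>2)"
      proof (rule block_dyadic_le[OF m(1,2)])
        show "T > 0" by (simp add: T_def)
        show "?T \<subseteq> {T..<2 * T}" using False by (auto simp: scales_def T_def)
        fix t' assume "t' \<in> ?T"
        then have "1 < real (r1 * s * t')" using H(1) unfolding scales_def by force
        then show "1 < r1 * s * t'" by linarith
      qed
      \<comment> \<open>Expanding both brackets gives four terms, arranged so that they involve only
        \<open>r2 * s * T \<ge> H / 2\<close>, \<open>s * T \<ge> D / 2\<close> and \<open>T\<close>
        itself. The third term is where the upper limit \<open>h powr (2 / 3)\<close> for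
        \<open>T\<close> is used.\<close>
      also have "\<dots> = 1024 * ?L\<^sup>2 * (h * (h\<^sup>2 / ((real r2 * real s * real T) * (real s * real T)) + h / (real s * real T) / real T
           + h * real T / (real r2 * real s * real T) + 1))"
        using pos T1 by (simp add: divide_simps power2_eq_square) (simp add: algebra_simps)
      also have "\<dots> \<le> 1024 * ?L\<^sup>2 * (h * (6 * (h * (h / (H * D) + h powr (2 / 3) / H))))"
      proof -
        have hH: "1 \<le> h / H" using H by simp
        have "h\<^sup>2 / ((real r2 * real s * real T) * (real s * real T)) \<le> h\<^sup>2 / ((H / 2) * (D / 2))"
          using x y H D pos T1 by (intro divide_left_mono mult_mono mult_pos_pos) auto
        then have 1: "h\<^sup>2 / ((real r2 * real s * real T) * (real s * real T)) \<le> 4 * (h * (h / (H * D)))"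
          by (simp add: power2_eq_square mult.commute)
        have "h / (real s * real T) / real T \<le> h / (real s * real T) / 1"
          using T1 pos by (intro divide_left_mono) auto
        also have "\<dots> \<le> h / (D / 2)" unfolding div_by_1 using y D pos T1 by (intro divide_left_mono mult_pos_pos) auto
        also have "\<dots> = 2 * (h / D) * 1" by simp
        also have "\<dots> \<le> 2 * (h / D) * (h / H)" using hH D pos by (intro mult_left_mono) auto
        finally have 2: "h / (real s * real T) / real T \<le> 2 * (h * (h / (H * D)))" by (simp add: mult.commute)
        have "h * real T / (real r2 * real s * real T) \<le> h * h powr (2 / 3) / (H / 2)"
          using x Th H pos T1 by (intro frac_le mult_left_mono) auto
        also have "h * h powr (2 / 3) / (H / 2) = 2 * (h * (h powr (2 / 3) / H))" by simp
        finally have 3: "h * real T / (real r2 * real s * real T) \<le> 2 * (h * (h powr (2 / 3) / H))" .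
        have "1 * 1 \<le> h powr (2 / 3) * (h / H)"
          using hH h_ge_3 by (intro mult_mono ge_one_powr_ge_zero) auto
        then have 4: "1 \<le> h * (h powr (2 / 3) / H)" by (simp add: mult.commute)
        have "h\<^sup>2 / ((real r2 * real s * real T) * (real s * real T)) + h / (real s * real T) / real T
           + h * real T / (real r2 * real s * real T) + 1 \<le> 6 * (h * (h / (H * D))) + 6 * (h * (h powr (2 / 3) / H))"
        proof -
          have "a + b + c + 1 \<le> 6 * x + 6 * y" if "a \<le> 4 * x" "b \<le> 2 * x" "c \<le> 2 * y" "1 \<le> y"
            for a b c x y :: real using that by linarith
          from this[OF 1 2 3 4] show ?thesis .
        qed
        also have "\<dots> = 6 * (h * (h / (H * D) + h powr (2 / 3) / H))" by (simp add: algebra_simps)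
        finally show ?thesis using pos by (intro mult_left_mono) auto
      qed
      also have "\<dots> = 1 * (6144 * ?L\<^sup>2 * h\<^sup>2 * (h / (H * D) + h powr (2 / 3) / H))"
        by (simp add: power2_eq_square)
      also have "\<dots> \<le> (rho q)\<^sup>2 * (6144 * ?L\<^sup>2 * h\<^sup>2 * (h / (H * D) + h powr (2 / 3) / H))"
        using rho1 \<Lambda> by (intro mult_right_mono) (auto intro!: mult_nonneg_nonneg)
      finally show ?thesis by (simp add: mult.commute mult.left_commute)
    qed
  qed
qed

definition top_scale :: nat where
  "top_scale = nat \<lfloor>log 2 h\<rfloor>"

text \<open>The number of scales: the dyadic ones from 0 to \<open>top_scale\<close>, and the index
  of the large range.\<close>

lemma top_scale_le: "real top_scale + 2 \<le> 4 * ln h"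
proof -
  have "real top_scale \<le> log 2 h" unfolding top_scale_def using h_ge_3 by (intro of_nat_floor) simp
  also have "\<dots> = ln h / ln 2" by (simp add: log_def)
  also have "\<dots> \<le> ln h / (2 / 3)"
    using ln2_ge_two_thirds ln_h_ge_1 by (intro divide_left_mono) auto
  finally show ?thesis using ln_h_ge_1 by simp
qed

lemma scale_exists:
  assumes "t dvd q" "D \<le> real (s * t)" "H \<le> real (r1 * s * t)" "H \<le> real (r2 * s * t)" "s > 0"
  shows "\<exists>j\<le>Suc top_scale. t \<in> scales H D top_scale r1 r2 s j"
proof (cases "h powr (4 / 3) \<le> real s * (real t)\<^sup>2")
  case True
  then show ?thesis using assms by (intro exI[of _ "Suc top_scale"]) (simp add: scales_def)
next
  case False
  have t0: "t > 0" using assms(1) q_gt_0 by (auto intro!: gr0I)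
  have th: "real t \<le> h"
  proof (rule power2_le_imp_le)
    have "(real t)\<^sup>2 \<le> real s * (real t)\<^sup>2"
      using mult_right_mono[of 1 "real s" "(real t)\<^sup>2"] assms(5) by simp
    also have "\<dots> \<le> h powr (4 / 3)" using False by simp
    also have "\<dots> \<le> h powr 2" using h_ge_3 by (intro powr_mono) auto
    finally show "(real t)\<^sup>2 \<le> h\<^sup>2" using h_ge_3 by (simp add: powr_numeral)
  qed (use h_ge_3 in simp)
  obtain j where j: "2 ^ j \<le> t" "t < 2 ^ (j + 1)"
    using ex_power_ivl1[of 2 t] t0 by auto
  have "real (2 ^ j) \<le> h" using j(1) th by (meson of_nat_mono order_trans)
  then have "2 powr real j \<le> h" by (simp add: powr_realpow)
  then have "real j \<le> log 2 h" using h_ge_3 by (simp add: le_log_iff)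
  then have "j \<le> top_scale" by (simp add: top_scale_def le_nat_floor)
  then show ?thesis using assms False j by (intro exI[of _ j]) (auto simp: scales_def)
qed

lemma sum_snd_split_pairs:
  "(\<Sum>(a, b)\<in>split_pairs r1 r2 s t \<beta>. pk b) = (\<Sum>(a, b)\<in>split_pairs r2 r1 s t \<beta>. pk a)"
  by (rule sum.reindex_bij_witness[where i = prod.swap and j = prod.swap])
    (auto simp: split_pairs_def add.commute)

text \<open>Every pair lies in a cell given by \<open>r1\<close>, \<open>r2\<close>,
  \<open>s\<close>, a scale \<open>j\<close> and some \<open>t\<close>; as all terms are
  nonnegative, a covering by cells suffices. In each cell \<open>peak_mult_le\<close> produces two
  summands, and exchanging the entries of the pair turns the second into a block with
  \<open>r1\<close> and \<open>r2\<close> swapped.\<close>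

lemma merged_wt_le_blocks:
  assumes \<beta>: "\<beta> < q" "\<beta> \<noteq> 0"
  shows "merged_wt H D \<beta> \<le> (\<Sum>x\<in>{(r1, r2, s). r1 * r2 * s = dn \<beta>} \<times> {..Suc top_scale}.
     case x of ((r1, r2, s), j) \<Rightarrow> 2 * (block r1 r2 s (scales H D top_scale r1 r2 s j) \<beta> +
        block r2 r1 s (scales H D top_scale r2 r1 s j) \<beta>))"
proof -
  let ?K = "{(r1, r2, s). r1 * r2 * s = dn \<beta>}"
  let ?T = "\<lambda>r1 r2 s j. scales H D top_scale r1 r2 s j"
  define Tx where "Tx x = (case x of ((r1, r2, s), j) \<Rightarrow> ?T r1 r2 s j)" for x
  define Px where "Px x t = (case x of ((r1, r2, s), j) \<Rightarrow> split_pairs r1 r2 s t \<beta>)" for x :: "(nat \<times> nat \<times> nat) \<times> nat" and t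
  define w where "w x t a b = (case x of ((r1, r2, s), j) \<Rightarrow>
     2 * (pk \<beta> / real (r1 * r2 * s * s)) * ((1 / (real t)\<^sup>2) * pk a + (1 / (real t)\<^sup>2) * pk b))" for x :: "(nat \<times> nat \<times> nat) \<times> nat" and t a b
  let ?X = "?K \<times> {..Suc top_scale}"
  have "squarefree (dn \<beta>)" using den_dvd[OF q_gt_0] squarefree_q squarefree_mono by blast
  then have finX: "finite ?X" using card_factorizations3_le(1) by auto
  have finT: "finite (Tx x)" for x by (cases x) (auto simp: Tx_def finite_scales)
  have finP: "finite (Px x t)" for x t by (cases x) (auto simp: Px_def finite_split_pairs)
  have wnn: "0 \<le> w x t a b" for x t a b
    by (cases x) (auto simp: w_def intro!: mult_nonneg_nonneg divide_nonneg_nonneg add_nonneg_nonneg pk_nonneg)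
  have "merged_wt H D \<beta> = (\<Sum>z\<in>merge_pairs H D \<beta>. wt (fst z) * wt (snd z))"
    using \<beta> by (simp add: merged_wt_def case_prod_unfold)
  also have "\<dots> \<le> (\<Sum>y\<in>Sigma ?X (\<lambda>x. Sigma (Tx x) (Px x)). w (fst y) (fst (snd y)) (fst (snd (snd y))) (snd (snd (snd y))))"
  proof (rule sum_le_included[where i = "\<lambda>y. snd (snd y)"])
    show "finite (merge_pairs H D \<beta>)"
      by (rule finite_subset[of _ "{..<q} \<times> {..<q}"]) (auto simp: merge_pairs_def)
    show "finite (Sigma ?X (\<lambda>x. Sigma (Tx x) (Px x)))"
      by (intro finite_SigmaI finX finT finP)
    show "\<forall>y\<in>Sigma ?X (\<lambda>x. Sigma (Tx x) (Px x)). 0 \<le> w (fst y) (fst (snd y)) (fst (snd (snd y))) (snd (snd (snd y)))"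
      using wnn by auto
    show "\<forall>z\<in>merge_pairs H D \<beta>. \<exists>y\<in>Sigma ?X (\<lambda>x. Sigma (Tx x) (Px x)). snd (snd y) = z \<and>
        wt (fst z) * wt (snd z) \<le> w (fst y) (fst (snd y)) (fst (snd (snd y))) (snd (snd (snd y)))"
    proof
      fix z assume z: "z \<in> merge_pairs H D \<beta>"
      obtain a b where z': "z = (a, b)" by (cases z)
      have ab: "a < q" "b < q" "(a + b) mod q = \<beta>" "H \<le> real (dn a)" "H \<le> real (dn b)" "D \<le> real (gcd (dn a) (dn b))"
        using z z' by (auto simp: merge_pairs_def)
      obtain r1 r2 s t where r: "r1 * r2 * s = dn (a + b)" "dn a = r1 * s * t" "dn b = r2 * s * t"
        "s * t = gcd (dn a) (dn b)" "t dvd q" by (rule split_pair_exists[OF ab(1,2)])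
      have dnb: "dn (a + b) = dn \<beta>" using ab(3) den_mod[of q "a + b"] by simp
      have pos: "r1 > 0" "r2 > 0" "s > 0" "t > 0"
        using r(2,3) den_gt_0[OF q_gt_0, of a] den_gt_0[OF q_gt_0, of b] by (auto intro!: gr0I)
      have "\<exists>j\<le>Suc top_scale. t \<in> ?T r1 r2 s j"
        using r(5) ab(4-6) pos(3) by (intro scale_exists) (simp_all only: r(2,3,4)[symmetric])
      then obtain j where j: "j \<le> Suc top_scale" "t \<in> ?T r1 r2 s j" by auto
      let ?x = "((r1, r2, s), j)"
      have mem: "(?x, t, a, b) \<in> Sigma ?X (\<lambda>x. Sigma (Tx x) (Px x))"
        using r dnb j ab by (auto simp: Tx_def Px_def split_pairs_def)
      have "wt a * wt b \<le> (pk a / real (dn a)) * (pk b / real (dn b))"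
        by (intro mult_mono wt_nonneg) (auto simp: wt_def pk_nonneg)
      also have "\<dots> = (pk a * pk b) / (real (r1 * r2 * s * s) * (real t)\<^sup>2)"
        unfolding r(2,3) by (simp add: power2_eq_square ac_simps)
      also have "\<dots> \<le> (2 * pk (a + b) * (pk a + pk b)) / (real (r1 * r2 * s * s) * (real t)\<^sup>2)"
        using peak_mult_le[of h "real a / real q" "real b / real q"] h_ge_3
        by (intro divide_right_mono) (auto simp: pk_def add_divide_distrib)
      also have "pk (a + b) = pk \<beta>" using pk_mod[of "a + b"] ab(3) by simp
      also have "(2 * pk \<beta> * (pk a + pk b)) / (real (r1 * r2 * s * s) * (real t)\<^sup>2) = w ?x t a b"
        using pos by (simp add: w_def field_simps)
      finally have "wt a * wt b \<le> w ?x t a b" .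
      then show "\<exists>y\<in>Sigma ?X (\<lambda>x. Sigma (Tx x) (Px x)). snd (snd y) = z \<and>
        wt (fst z) * wt (snd z) \<le> w (fst y) (fst (snd y)) (fst (snd (snd y))) (snd (snd (snd y)))"
        using mem z' by (intro bexI[of _ "(?x, t, a, b)"]) auto
    qed
  qed
  also have "\<dots> = (\<Sum>x\<in>?X. \<Sum>t\<in>Tx x. \<Sum>z\<in>Px x t. w x t (fst z) (snd z))"
    using finX finT finP by (simp add: sum.Sigma case_prod_unfold)
  also have "\<dots> = (\<Sum>x\<in>?X. case x of ((r1, r2, s), j) \<Rightarrow> 2 * (block r1 r2 s (?T r1 r2 s j) \<beta> + block r2 r1 s (?T r2 r1 s j) \<beta>))"
  proof (rule sum.cong[OF refl])
    fix x assume "x \<in> ?X"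
    obtain r1 r2 s j where x: "x = ((r1, r2, s), j)" by (metis surj_pair)
    let ?c = "pk \<beta> / real (r1 * r2 * s * s)"
    have "(\<Sum>t\<in>Tx x. \<Sum>z\<in>Px x t. w x t (fst z) (snd z))
      = (\<Sum>t\<in>?T r1 r2 s j. \<Sum>z\<in>split_pairs r1 r2 s t \<beta>. 2 * ?c * ((1 / (real t)\<^sup>2) * pk (fst z) + (1 / (real t)\<^sup>2) * pk (snd z)))"
      by (simp add: x Tx_def Px_def w_def)
    also have "\<dots> = 2 * (?c * (\<Sum>t\<in>?T r1 r2 s j. (1 / (real t)\<^sup>2) * (\<Sum>z\<in>split_pairs r1 r2 s t \<beta>. pk (fst z)))
         + ?c * (\<Sum>t\<in>?T r1 r2 s j. (1 / (real t)\<^sup>2) * (\<Sum>z\<in>split_pairs r1 r2 s t \<beta>. pk (snd z))))"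
      by (simp only: sum_distrib_left sum.distrib distrib_left mult.assoc)
    also have "(\<lambda>t. \<Sum>z\<in>split_pairs r1 r2 s t \<beta>. pk (snd z)) = (\<lambda>t. \<Sum>z\<in>split_pairs r2 r1 s t \<beta>. pk (fst z))"
      using sum_snd_split_pairs[of r1 r2 s _ \<beta>] by (simp add: case_prod_unfold)
    finally show "(\<Sum>t\<in>Tx x. \<Sum>z\<in>Px x t. w x t (fst z) (snd z)) =
       (case x of ((r1, r2, s), j) \<Rightarrow> 2 * (block r1 r2 s (?T r1 r2 s j) \<beta> + block r2 r1 s (?T r2 r1 s j) \<beta>))"
      by (simp only: x prod.case block_def case_prod_unfold fst_conv snd_conv scales_commute[of H D top_scale r2 r1] mult.commute[of r2 r1])
  qed
  finally show ?thesis .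
qed

lemma merged_wt_nonneg: "0 \<le> merged_wt H D \<beta>"
  by (auto simp: merged_wt_def intro!: sum_nonneg mult_nonneg_nonneg wt_nonneg)

lemma sum_merged_wt_square_le:
  assumes d: "d dvd q" and H: "1 < H" "H \<le> h" and D: "1 \<le> D"
  defines "\<Lambda> \<equiv> h / (H * D) + h powr (2 / 3) / H"
  shows "real d * (\<Sum>\<beta> | \<beta> < q \<and> dn \<beta> = d. (merged_wt H D \<beta>)\<^sup>2)
    \<le> (real 3 ^ card (prime_factors d) * (sqrt (1572864 * \<Lambda>) * (rho q * (ln h)\<^sup>2 * h)))\<^sup>2"
proof (cases "d = 1")
  case True
  have "\<beta> = 0" if "\<beta> < q" "dn \<beta> = d" for \<beta>
    using that True den_eq_1_iff[OF q_gt_0, of \<beta>] by (auto dest: dvd_imp_le)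
  then have "merged_wt H D \<beta> = 0" if "\<beta> < q" "dn \<beta> = d" for \<beta>
    using that by (simp add: merged_wt_def)
  then show ?thesis by simp
next
  case False
  have d0: "d > 0" using d q_gt_0 by (auto intro!: gr0I)
  then have d1: "d > 1" using False by simp
  have sqd: "squarefree d" using d squarefree_q squarefree_mono by blast
  have \<Lambda>nn: "\<Lambda> \<ge> 0" using H D h_ge_3 by (simp add: \<Lambda>_def)
  let ?L = "ln h"
  let ?M = "{\<beta>. \<beta> < q \<and> dn \<beta> = d}"
  let ?K = "{(r1, r2, s). r1 * r2 * s = d}"
  let ?X = "?K \<times> {..Suc top_scale}"
  define b1 where "b1 x \<beta> = (case x of ((r1, r2, s), j) \<Rightarrow> block r1 r2 s (scales H D top_scale r1 r2 s j) \<beta>)" for x \<beta>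
  define b2 where "b2 x \<beta> = (case x of ((r1, r2, s), j) \<Rightarrow> block r2 r1 s (scales H D top_scale r2 r1 s j) \<beta>)" for x \<beta>
  define Bd where "Bd = 6144 * (rho q)\<^sup>2 * ?L\<^sup>2 * h\<^sup>2 * \<Lambda>"
  have Bdnn: "Bd \<ge> 0" using \<Lambda>nn by (simp add: Bd_def)
  have finX: "finite ?X" using card_factorizations3_le(1)[OF sqd] by auto
  have cardX: "real (card ?X) \<le> 3 ^ card (prime_factors d) * (4 * ?L)"
  proof -
    have "real (card ?X) = real (card ?K) * real (top_scale + 2)" by (simp add: card_cartesian_product algebra_simps)
    also have "\<dots> \<le> real (3 ^ card (prime_factors d)) * (4 * ?L)"
      using card_factorizations3_le(2)[OF sqd] top_scale_le by (intro mult_mono of_nat_mono) auto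
    finally show ?thesis by simp
  qed
  have le1: "real d * (\<Sum>\<beta>\<in>?M. (b1 x \<beta>)\<^sup>2) \<le> Bd" if "x \<in> ?X" for x
  proof -
    obtain r1 r2 s j where x: "x = ((r1, r2, s), j)" by (metis surj_pair)
    then have "d = r1 * r2 * s" using that by auto
    from block_scales_le[OF this d d1 H D, of top_scale j] show ?thesis
      by (simp add: x b1_def Bd_def \<Lambda>_def)
  qed
  have le2: "real d * (\<Sum>\<beta>\<in>?M. (b2 x \<beta>)\<^sup>2) \<le> Bd" if "x \<in> ?X" for x
  proof -
    obtain r1 r2 s j where x: "x = ((r1, r2, s), j)" by (metis surj_pair)
    then have "d = r2 * r1 * s" using that by auto
    from block_scales_le[OF this d d1 H D, of top_scale j] show ?thesis
      by (simp add: x b2_def Bd_def \<Lambda>_def)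
  qed
  have "(merged_wt H D \<beta>)\<^sup>2 \<le> (8 * real (card ?X)) * (\<Sum>x\<in>?X. (b1 x \<beta>)\<^sup>2 + (b2 x \<beta>)\<^sup>2)" if "\<beta> \<in> ?M" for \<beta>
  proof -
    have "\<beta> \<noteq> 0"
    proof
      assume "\<beta> = 0"
      then have "dn \<beta> = 1" using den_eq_1_iff[OF q_gt_0, of 0] by simp
      then show False using that d1 by simp
    qed
    then have "merged_wt H D \<beta> \<le> (\<Sum>x\<in>?X. 2 * (b1 x \<beta> + b2 x \<beta>))"
      using merged_wt_le_blocks[of \<beta> H D] that by (simp add: b1_def b2_def case_prod_unfold)
    then have "(merged_wt H D \<beta>)\<^sup>2 \<le> (\<Sum>x\<in>?X. 2 * (b1 x \<beta> + b2 x \<beta>))\<^sup>2"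
      by (intro power_mono merged_wt_nonneg)
    also have "\<dots> \<le> (\<Sum>x\<in>?X. (2 * (b1 x \<beta> + b2 x \<beta>))\<^sup>2) * (\<Sum>x\<in>?X. 1\<^sup>2)"
      using Cauchy_Schwarz_ineq_sum[of "\<lambda>x. 2 * (b1 x \<beta> + b2 x \<beta>)" "\<lambda>_. 1" ?X] by simp
    also have "\<dots> \<le> (\<Sum>x\<in>?X. 8 * ((b1 x \<beta>)\<^sup>2 + (b2 x \<beta>)\<^sup>2)) * (\<Sum>x\<in>?X. 1\<^sup>2)"
    proof (intro mult_right_mono sum_mono)
      fix x
      have "0 \<le> (b1 x \<beta> - b2 x \<beta>)\<^sup>2" by simp
      then show "(2 * (b1 x \<beta> + b2 x \<beta>))\<^sup>2 \<le> 8 * ((b1 x \<beta>)\<^sup>2 + (b2 x \<beta>)\<^sup>2)"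
        by (simp add: power2_eq_square algebra_simps)
    qed simp
    also have "\<dots> = (8 * real (card ?X)) * (\<Sum>x\<in>?X. (b1 x \<beta>)\<^sup>2 + (b2 x \<beta>)\<^sup>2)"
      unfolding sum_distrib_left[symmetric] by simp
    finally show ?thesis .
  qed
  then have "(\<Sum>\<beta>\<in>?M. (merged_wt H D \<beta>)\<^sup>2) \<le> (\<Sum>\<beta>\<in>?M. (8 * real (card ?X)) * (\<Sum>x\<in>?X. (b1 x \<beta>)\<^sup>2 + (b2 x \<beta>)\<^sup>2))"
    by (rule sum_mono)
  also have "\<dots> = (8 * real (card ?X)) * (\<Sum>\<beta>\<in>?M. \<Sum>x\<in>?X. (b1 x \<beta>)\<^sup>2 + (b2 x \<beta>)\<^sup>2)"
    by (rule sum_distrib_left[symmetric])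
  also have "(\<Sum>\<beta>\<in>?M. \<Sum>x\<in>?X. (b1 x \<beta>)\<^sup>2 + (b2 x \<beta>)\<^sup>2) = (\<Sum>x\<in>?X. \<Sum>\<beta>\<in>?M. (b1 x \<beta>)\<^sup>2 + (b2 x \<beta>)\<^sup>2)"
    by (rule sum.swap)
  finally have "real d * (\<Sum>\<beta>\<in>?M. (merged_wt H D \<beta>)\<^sup>2)
      \<le> real d * ((8 * real (card ?X)) * (\<Sum>x\<in>?X. \<Sum>\<beta>\<in>?M. (b1 x \<beta>)\<^sup>2 + (b2 x \<beta>)\<^sup>2))"
    by (intro mult_left_mono) auto
  also have "\<dots> = (8 * real (card ?X)) * (\<Sum>x\<in>?X. real d * (\<Sum>\<beta>\<in>?M. (b1 x \<beta>)\<^sup>2) + real d * (\<Sum>\<beta>\<in>?M. (b2 x \<beta>)\<^sup>2))"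
    by (simp only: sum.distrib distrib_left sum_distrib_left[symmetric] mult.left_commute)
  also have "\<dots> \<le> (8 * real (card ?X)) * (\<Sum>x\<in>?X. Bd + Bd)"
    using le1 le2 by (intro mult_left_mono sum_mono add_mono) auto
  also have "\<dots> = 16 * Bd * (real (card ?X))\<^sup>2"
    by (simp only: sum_constant) (simp add: power2_eq_square)
  also have "\<dots> \<le> 16 * Bd * (3 ^ card (prime_factors d) * (4 * ?L))\<^sup>2"
    using cardX Bdnn by (intro mult_left_mono power_mono) auto
  \<comment> \<open>The constant is 16 * 6144 * 16: from the two halves with Cauchy--Schwarz, from
    \<open>block_scales_le\<close>, and from the squared 4 in the number of scales.\<close>
  also have "\<dots> = (real 3 ^ card (prime_factors d))\<^sup>2 * (1572864 * \<Lambda>) * (rho q * ?L\<^sup>2 * h)\<^sup>2"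
    by (simp add: Bd_def power_mult_distrib power2_eq_square)
  also have "\<dots> = (real 3 ^ card (prime_factors d) * (sqrt (1572864 * \<Lambda>) * (rho q * ?L\<^sup>2 * h)))\<^sup>2"
    using \<Lambda>nn by (simp add: power_mult_distrib)
  finally show ?thesis .
qed

end

section \<open>Tuples without cancelling pairs\<close>

lemma sum_le_sum_cover:
  fixes f :: "'a \<Rightarrow> real"
  assumes "finite A" "finite X" "\<And>x. x \<in> X \<Longrightarrow> finite (B x)" "\<And>a. 0 \<le> f a"
    and "\<And>a. \<lbrakk>a \<in> A; f a \<noteq> 0\<rbrakk> \<Longrightarrow> \<exists>x\<in>X. a \<in> B x"
  shows "sum f A \<le> (\<Sum>x\<in>X. sum f (B x))"
proof -
  have "sum f A = sum f {a\<in>A. f a \<noteq> 0}"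
    using assms(1) by (intro sum.mono_neutral_right) auto
  also have "\<dots> \<le> (\<Sum>z\<in>Sigma X B. f (snd z))"
  proof (rule sum_le_included[where i = snd])
    show "\<forall>a\<in>{a\<in>A. f a \<noteq> 0}. \<exists>z\<in>Sigma X B. snd z = a \<and> f a \<le> f (snd z)"
      using assms(5) by fastforce
  qed (use assms in auto)
  also have "\<dots> = (\<Sum>x\<in>X. sum f (B x))"
    using assms(2,3) by (subst sum.Sigma) (auto simp: case_prod_unfold)
  finally show ?thesis .
qed

text \<open>The exponent of \<open>rho q\<close> for \<open>k - 1\<close> indices of which one has
  multiplicity 3. It is one less than the exponent \<open>2 ^ k - k - 1\<close> for \<open>k\<close>
  plain indices, leaving room for the factor \<open>rho q\<close> in the bound of the merged
  weight.\<close>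

lemma sum_weights_subsets_ge_2:
  assumes "finite I" "i \<in> I" "j \<in> I" "i \<noteq> j" and k: "card I = k"
  shows "(\<Sum>S | S \<subseteq> I - {j} \<and> 2 \<le> card S. \<Prod>l\<in>S. if l = i then 3 else 1) = 2 ^ k - k - (2 :: nat)"
proof -
  let ?P = "{S. S \<subseteq> I - {j} \<and> 2 \<le> card S}"
  have finP: "finite ?P" using assms by auto
  have k2: "k \<ge> 2"
  proof -
    have "card {i, j} \<le> card I" using assms by (intro card_mono) auto
    then show ?thesis using assms by simp
  qed
  have ck1: "card (I - {j}) = k - 1" and ck2: "card (I - {i, j}) = k - 2"
    using assms by (auto simp: card_Diff_subset)
  have pr: "(\<Prod>l\<in>S. if l = i then 3 else 1) = (if i \<in> S then 1 + 2 else (1::nat))" if "S \<in> ?P" for S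
  proof -
    have "finite S" using that assms finite_subset by blast
    then show ?thesis by (simp add: prod.delta)
  qed
  have cI: "card {S\<in>?P. i \<in> S} = 2 ^ (k - 2) - 1"
  proof -
    have "bij_betw (insert i) (Pow (I - {i, j}) - {{}}) {S\<in>?P. i \<in> S}"
    proof (rule bij_betwI[where g = "\<lambda>S. S - {i}"])
      show "insert i \<in> Pow (I - {i, j}) - {{}} \<rightarrow> {S\<in>?P. i \<in> S}"
      proof
        fix S assume S: "S \<in> Pow (I - {i, j}) - {{}}"
        then have "finite S" "i \<notin> S" using assms finite_subset by blast+
        moreover have "1 \<le> card S" using S \<open>finite S\<close> by (simp add: Suc_le_eq card_gt_0_iff)
        ultimately show "insert i S \<in> {S\<in>?P. i \<in> S}" using S assms by auto
      qed
      show "(\<lambda>S. S - {i}) \<in> {S\<in>?P. i \<in> S} \<rightarrow> Pow (I - {i, j}) - {{}}"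
      proof
        fix S assume S: "S \<in> {S\<in>?P. i \<in> S}"
        have "S - {i} \<noteq> {}"
        proof
          assume "S - {i} = {}"
          then have "S = {i}" using S by auto
          then show False using S by auto
        qed
        then show "S - {i} \<in> Pow (I - {i, j}) - {{}}" using S by auto
      qed
    qed (use assms in auto)
    then have "card {S\<in>?P. i \<in> S} = card (Pow (I - {i, j}) - {{}})" by (rule bij_betw_same_card[symmetric])
    also have "\<dots> = 2 ^ (k - 2) - 1" using assms ck2 by (simp add: card_Pow card_Diff_subset)
    finally show ?thesis .
  qed
  have "(\<Sum>S\<in>?P. \<Prod>l\<in>S. if l = i then 3 else 1) = (\<Sum>S\<in>?P. 1 + (if i \<in> S then 2 else (0::nat)))"
    using pr by (intro sum.cong) auto
  also have "\<dots> = card ?P + 2 * card {S\<in>?P. i \<in> S}"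
    using finP by (simp only: sum.distrib) (simp add: sum.If_cases Int_def)
  also have "card ?P = 2 ^ (k - 1) - (k - 1) - 1"
    using card_subsets_ge_2[of "I - {j}"] assms ck1 by simp
  also have "2 ^ (k - 1) - (k - 1) - 1 + 2 * card {S\<in>?P. i \<in> S} = 2 ^ k - k - 2"
  proof -
    obtain n where n: "k = Suc (Suc n)" using k2 by (metis add_2_eq_Suc le_Suc_ex)
    have "n < 2 ^ n" by (rule less_exp)
    moreover have "2 * x - (n + 2) + 2 * (x - 1) = 4 * x - (n + 4)" if "n < x" for x :: nat
      using that by arith
    ultimately have "2 * 2 ^ n - (n + 2) + 2 * (2 ^ n - 1) = 4 * 2 ^ n - (n + (4 :: nat))" by blast
    then show ?thesis unfolding cI n by simp
  qed
  finally show ?thesis .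
qed

text \<open>The first summand covers the \<open>k\<close> choices of an index with small
  denominator, the second the fewer than \<open>k\<close> partners of the merged index. The factor
  \<open>28 * k\<close> comes from bounding \<open>ln h\<close> by a small power of
  \<open>h\<close>.\<close>

definition no_cancel_const :: "nat \<Rightarrow> real" where
  "no_cancel_const k = real k * (2 * sqrt 8 ^ (k - 1)) +
     real k * (sqrt (2 * 1572864) * (28 * real k)\<^sup>2 * sqrt 8 ^ (k - 2))"

section \<open>The inequality with one improved index\<close>

context cyclic_weights
begin

definition total :: "nat set \<Rightarrow> real" where
  "total I = (\<Sum>a\<in>tuples I. \<Prod>i\<in>I. wt (a i))"

lemma prod_wt_nonneg: "0 \<le> (\<Prod>i\<in>I. wt (a i))"
  by (intro prod_nonneg) (simp add: wt_nonneg)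

lemma total_le:
  assumes "finite I"
  shows "total I \<le> sqrt (8 * h) ^ card I * rho q ^ (2 ^ card I - card I - 1)"
proof -
  have "total I \<le> (\<Prod>i\<in>I. sqrt (8 * h)) * rho q ^ (\<Sum>S | S \<subseteq> I \<and> 2 \<le> card S. \<Prod>i\<in>S. 1)"
    unfolding total_def
    using assms sum_wt_square_den_le(1) h_ge_3 wt_nonneg by (intro sum_prod_tuples_le) auto
  then show ?thesis using card_subsets_ge_2[OF assms] by simp
qed

text \<open>Truncating the weight at index \<open>i\<close> to denominators below \<open>H\<close>
  improves its bound from \<open>8 * h\<close> to \<open>4 * H\<close>: smaller \<open>d\<close>
  satisfy the bound \<open>4 * d\<close>, and larger ones contribute 0.\<close>

lemma sum_small_den_le:
  assumes "finite I" "i \<in> I" "H > 0"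
  shows "(\<Sum>a | a \<in> tuples I \<and> real (dn (a i)) < H. \<Prod>l\<in>I. wt (a l))
    \<le> sqrt (4 * H) * sqrt (8 * h) ^ (card I - 1) * rho q ^ (2 ^ card I - card I - 1)"
proof -
  define F where "F l a = (if l = i \<and> \<not> real (dn a) < H then 0 else wt a)" for l a
  define B where "B l = (if l = i then sqrt (4 * H) else sqrt (8 * h))" for l
  have "(\<Sum>a | a \<in> tuples I \<and> real (dn (a i)) < H. \<Prod>l\<in>I. wt (a l)) = (\<Sum>a | a \<in> tuples I \<and> real (dn (a i)) < H. \<Prod>l\<in>I. F l (a l))"
    by (intro sum.cong prod.cong) (auto simp: F_def)
  also have "\<dots> \<le> (\<Sum>a\<in>tuples I. \<Prod>l\<in>I. F l (a l))"
    using finite_tuples[OF assms(1)] by (intro sum_mono2) (auto intro!: prod_nonneg simp: F_def wt_nonneg)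
  also have "\<dots> \<le> (\<Prod>l\<in>I. B l) * rho q ^ (\<Sum>S | S \<subseteq> I \<and> 2 \<le> card S. \<Prod>l\<in>S. 1)"
  proof (rule sum_prod_tuples_le[OF assms(1)])
    show "0 \<le> F l a" for l a by (simp add: F_def wt_nonneg)
    show "0 \<le> B l" for l using h_ge_3 assms(3) by (simp add: B_def)
    fix l d assume d: "d dvd q"
    show "real d * (\<Sum>a | a < q \<and> dn a = d. (F l a)\<^sup>2) \<le> (real 1 ^ card (prime_factors d) * B l)\<^sup>2"
    proof (cases "l = i")
      case True
      have "real d * (\<Sum>a | a < q \<and> dn a = d. (F l a)\<^sup>2) \<le> 4 * H"
      proof (cases "real d < H")
        case True
        have "real d * (\<Sum>a | a < q \<and> dn a = d. (F l a)\<^sup>2) = real d * (\<Sum>a | a < q \<and> dn a = d. (wt a)\<^sup>2)"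
          using True by (simp add: F_def)
        also have "\<dots> \<le> 4 * real d" using sum_wt_square_den_le(2)[OF d] .
        finally show ?thesis using True by simp
      next
        case False
        then have "(\<Sum>a | a < q \<and> dn a = d. (F l a)\<^sup>2) = 0"
          using \<open>l = i\<close> by (intro sum.neutral) (auto simp: F_def)
        then show ?thesis using assms(3) by simp
      qed
      then show ?thesis using True assms(3) by (simp add: B_def)
    next
      case False
      then show ?thesis using sum_wt_square_den_le(1)[OF d] h_ge_3 by (simp add: B_def F_def)
    qed
  qed
  also have "(\<Prod>l\<in>I. B l) = sqrt (4 * H) * sqrt (8 * h) ^ (card I - 1)"
    using assms(1,2) by (subst prod.remove[of I i]) (auto simp: B_def)
  finally show ?thesis using card_subsets_ge_2[OF assms(1)] by simp
qed

text \<open>A tuple is encoded by the shorter tuple carrying \<open>a i + a j\<close> modulo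
  \<open>q\<close> at place \<open>i\<close>, together with the pair \<open>(a i, a j)\<close>. For
  a fixed shorter tuple the sum over pairs is at most the merged weight, so the inequality applies
  to \<open>k - 1\<close> indices with multiplicity 3 at \<open>i\<close>.\<close>

lemma sum_merged_le:
  assumes I: "finite I" "i \<in> I" "j \<in> I" "i \<noteq> j" and H: "1 < H" "H \<le> h" and D: "1 \<le> D"
  defines "\<Lambda> \<equiv> h / (H * D) + h powr (2 / 3) / H"
  shows "(\<Sum>a | a \<in> tuples I \<and> H \<le> real (dn (a i)) \<and> H \<le> real (dn (a j)) \<and>
        D \<le> real (gcd (dn (a i)) (dn (a j))) \<and> \<not> q dvd a i + a j. \<Prod>l\<in>I. wt (a l))
    \<le> (sqrt (1572864 * \<Lambda>) * (rho q * (ln h)\<^sup>2 * h)) * sqrt (8 * h) ^ (card I - 2) * rho q ^ (2 ^ card I - card I - 2)"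
proof -
  let ?A = "{a. a \<in> tuples I \<and> H \<le> real (dn (a i)) \<and> H \<le> real (dn (a j)) \<and>
        D \<le> real (gcd (dn (a i)) (dn (a j))) \<and> \<not> q dvd a i + a j}"
  let ?I = "I - {j}"
  let ?R = "I - {i, j}"
  have finA: "finite ?A" using finite_tuples[OF I(1)] by simp
  have \<Lambda>nn: "\<Lambda> \<ge> 0" using H D h_ge_3 by (simp add: \<Lambda>_def)
  have rho0: "rho q \<ge> 0" by (simp add: rho_def)
  define F where "F l a = (if l = i then merged_wt H D a else wt a)" for l a
  define B where "B l = (if l = i then sqrt (1572864 * \<Lambda>) * (rho q * (ln h)\<^sup>2 * h) else sqrt (8 * h))" for l
  have Fnn: "0 \<le> F l a" for l a by (simp add: F_def wt_nonneg merged_wt_nonneg)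
  have finI: "finite ?I" using I by simp
  define \<psi> where "\<psi> a = ((\<lambda>l\<in>?I. if l = i then (a i + a j) mod q else a l), (a i, a j))" for a :: "nat \<Rightarrow> nat"
  have inj: "inj_on \<psi> ?A"
  proof (rule inj_onI)
    fix a b assume a: "a \<in> ?A" and b: "b \<in> ?A" and eq: "\<psi> a = \<psi> b"
    show "a = b"
    proof
      fix l
      consider "l \<notin> I" | "l = i" | "l = j" | "l \<in> ?R" using I by auto
      then show "a l = b l"
      proof cases
        case 1
        then show ?thesis using a b by (auto simp: tuples_def PiE_def extensional_def)
      next
        case 4
        have "fst (\<psi> a) l = fst (\<psi> b) l" using eq by simp
        then show ?thesis using 4 by (simp add: \<psi>_def)
      qed (use eq in \<open>auto simp: \<psi>_def\<close>)
    qed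
  qed
  define G where "G z = (wt (fst (snd z)) * wt (snd (snd z))) * (\<Prod>l\<in>?R. wt (fst z l))" for z
  have prodI: "(\<Prod>l\<in>I. f l) = f i * f j * (\<Prod>l\<in>?R. f l)" for f :: "nat \<Rightarrow> real"
  proof -
    have "(\<Prod>l\<in>I. f l) = f i * (\<Prod>l\<in>I - {i}. f l)" using I by (intro prod.remove) auto
    also have "(\<Prod>l\<in>I - {i}. f l) = f j * (\<Prod>l\<in>I - {i} - {j}. f l)" using I by (intro prod.remove) auto
    also have "I - {i} - {j} = ?R" by auto
    finally show ?thesis by simp
  qed
  have sumI: "(\<Sum>l\<in>I. f l) = f i + f j + (\<Sum>l\<in>?R. f l)" for f :: "nat \<Rightarrow> nat"
  proof -
    have "(\<Sum>l\<in>I. f l) = f i + (\<Sum>l\<in>I - {i}. f l)" using I by (intro sum.remove) auto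
    also have "(\<Sum>l\<in>I - {i}. f l) = f j + (\<Sum>l\<in>I - {i} - {j}. f l)" using I by (intro sum.remove) auto
    also have "I - {i} - {j} = ?R" by auto
    finally show ?thesis by simp
  qed
  have "(\<Sum>a\<in>?A. \<Prod>l\<in>I. wt (a l)) = (\<Sum>a\<in>?A. G (\<psi> a))"
  proof (rule sum.cong[OF refl])
    fix a
    have "(\<Prod>l\<in>?R. wt (fst (\<psi> a) l)) = (\<Prod>l\<in>?R. wt (a l))"
      by (intro prod.cong) (auto simp: \<psi>_def)
    then show "(\<Prod>l\<in>I. wt (a l)) = G (\<psi> a)" unfolding G_def prodI by (simp add: \<psi>_def)
  qed
  also have "\<dots> = (\<Sum>z\<in>\<psi> ` ?A. G z)" using inj by (simp add: sum.reindex)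
  also have "\<dots> \<le> (\<Sum>z\<in>Sigma {b\<in>tuples ?I. b i \<noteq> 0} (\<lambda>b. merge_pairs H D (b i)). G z)"
  proof (rule sum_mono2)
    have "finite (merge_pairs H D \<beta>)" for \<beta>
      by (rule finite_subset[of _ "{..<q} \<times> {..<q}"]) (auto simp: merge_pairs_def)
    then show "finite (Sigma {b\<in>tuples ?I. b i \<noteq> 0} (\<lambda>b. merge_pairs H D (b i)))"
      using finite_tuples[OF finI] by auto
    show "0 \<le> G z" for z unfolding G_def by (intro mult_nonneg_nonneg wt_nonneg prod_wt_nonneg)
    show "\<psi> ` ?A \<subseteq> Sigma {b\<in>tuples ?I. b i \<noteq> 0} (\<lambda>b. merge_pairs H D (b i))"
    proof
      fix z assume "z \<in> \<psi> ` ?A"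
      then obtain a where a: "a \<in> ?A" and z: "z = \<psi> a" by auto
      have lt: "a l < q" if "l \<in> I" for l using a that by (auto simp: tuples_def PiE_def Pi_def)
      let ?b = "\<lambda>l\<in>?I. if l = i then (a i + a j) mod q else a l"
      have bi: "?b i = (a i + a j) mod q" using I by simp
      have "(\<Sum>l\<in>?I. ?b l) = (a i + a j) mod q + (\<Sum>l\<in>?R. a l)"
      proof -
        have "(\<Sum>l\<in>?I. ?b l) = ?b i + (\<Sum>l\<in>?I - {i}. ?b l)" using I by (intro sum.remove) auto
        also have "?I - {i} = ?R" by auto
        also have "(\<Sum>l\<in>?R. ?b l) = (\<Sum>l\<in>?R. a l)" by (intro sum.cong) auto
        finally show ?thesis using bi by simp
      qed
      moreover have "q dvd (a i + a j) mod q + (\<Sum>l\<in>?R. a l)"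
      proof -
        have "q dvd a i + a j + (\<Sum>l\<in>?R. a l)" using a sumI[of a] by (simp add: tuples_def)
        then show ?thesis by (metis mod_add_left_eq dvd_eq_mod_eq_0)
      qed
      ultimately have "?b \<in> tuples ?I"
        using lt q_gt_0 by (auto simp: tuples_def)
      moreover have "?b i \<noteq> 0" using a bi by (simp add: dvd_eq_mod_eq_0)
      moreover have "(a i, a j) \<in> merge_pairs H D (?b i)"
        using a bi lt I by (simp add: merge_pairs_def)
      ultimately show "z \<in> Sigma {b\<in>tuples ?I. b i \<noteq> 0} (\<lambda>b. merge_pairs H D (b i))"
        unfolding z \<psi>_def by blast
    qed
  qed
  also have "\<dots> = (\<Sum>b\<in>{b\<in>tuples ?I. b i \<noteq> 0}. \<Prod>l\<in>?I. F l (b l))"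
  proof -
    have finm: "finite (merge_pairs H D \<beta>)" for \<beta>
      by (rule finite_subset[of _ "{..<q} \<times> {..<q}"]) (auto simp: merge_pairs_def)
    have "(\<Sum>z\<in>Sigma {b\<in>tuples ?I. b i \<noteq> 0} (\<lambda>b. merge_pairs H D (b i)). G z)
        = (\<Sum>b\<in>{b\<in>tuples ?I. b i \<noteq> 0}. \<Sum>p\<in>merge_pairs H D (b i). G (b, p))"
      using finite_tuples[OF finI] finm by (subst sum.Sigma) auto
    also have "\<dots> = (\<Sum>b\<in>{b\<in>tuples ?I. b i \<noteq> 0}. \<Prod>l\<in>?I. F l (b l))"
    proof (rule sum.cong[OF refl])
      fix b assume b: "b \<in> {b\<in>tuples ?I. b i \<noteq> 0}"
      have "(\<Prod>l\<in>?I. F l (b l)) = F i (b i) * (\<Prod>l\<in>?I - {i}. F l (b l))" using I by (intro prod.remove) auto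
      also have "?I - {i} = ?R" by auto
      also have "(\<Prod>l\<in>?R. F l (b l)) = (\<Prod>l\<in>?R. wt (b l))" by (intro prod.cong) (auto simp: F_def)
      also have "F i (b i) = (\<Sum>p\<in>merge_pairs H D (b i). wt (fst p) * wt (snd p))"
        using b by (simp add: F_def merged_wt_def case_prod_unfold)
      finally show "(\<Sum>p\<in>merge_pairs H D (b i). G (b, p)) = (\<Prod>l\<in>?I. F l (b l))"
        by (simp add: G_def sum_distrib_right)
    qed
    finally show ?thesis .
  qed
  also have "\<dots> \<le> (\<Sum>b\<in>tuples ?I. \<Prod>l\<in>?I. F l (b l))"
    using finite_tuples[OF finI]
    by (intro sum_mono2) (auto intro!: prod_nonneg Fnn)
  also have "\<dots> \<le> (\<Prod>l\<in>?I. B l) * rho q ^ (\<Sum>S | S \<subseteq> ?I \<and> 2 \<le> card S. \<Prod>l\<in>S. if l = i then 3 else 1)"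
  proof (rule sum_prod_tuples_le[OF finI])
    show "0 \<le> F l a" for l a by (rule Fnn)
    show "0 \<le> B l" for l using h_ge_3 \<Lambda>nn rho0 by (auto simp: B_def intro!: mult_nonneg_nonneg)
    fix l d assume d: "d dvd q"
    show "real d * (\<Sum>a | a < q \<and> dn a = d. (F l a)\<^sup>2) \<le> (real (if l = i then 3 else 1) ^ card (prime_factors d) * B l)\<^sup>2"
    proof (cases "l = i")
      case True
      then show ?thesis using sum_merged_wt_square_le[OF d H D] by (simp add: F_def B_def \<Lambda>_def)
    next
      case False
      then show ?thesis using sum_wt_square_den_le(1)[OF d] h_ge_3 by (simp add: B_def F_def)
    qed
  qed
  also have "(\<Prod>l\<in>?I. B l) = (sqrt (1572864 * \<Lambda>) * (rho q * (ln h)\<^sup>2 * h)) * sqrt (8 * h) ^ (card I - 2)"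
  proof -
    have "(\<Prod>l\<in>?I. B l) = B i * (\<Prod>l\<in>?I - {i}. B l)" using I by (intro prod.remove) auto
    also have "?I - {i} = ?R" by auto
    also have "(\<Prod>l\<in>?R. B l) = (\<Prod>l\<in>?R. sqrt (8 * h))" by (intro prod.cong) (auto simp: B_def)
    also have "\<dots> = sqrt (8 * h) ^ (card I - 2)"
      using I by (simp add: card_Diff_subset numeral_2_eq_2)
    finally show ?thesis by (simp add: B_def)
  qed
  also have "(\<Sum>S | S \<subseteq> ?I \<and> 2 \<le> card S. \<Prod>l\<in>S. if l = i then 3 else 1) = 2 ^ card I - card I - (2 :: nat)"
    using I by (intro sum_weights_subsets_ge_2) auto
  finally show ?thesis .
qed

definition no_cancel :: "nat set \<Rightarrow> (nat \<Rightarrow> nat) set" where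
  "no_cancel I = {a\<in>tuples I. \<forall>x\<in>I. \<forall>y\<in>I. x \<noteq> y \<longrightarrow> \<not> q dvd a x + a y}"

text \<open>A prime of the denominator of \<open>a i\<close> must occur in another denominator: if
  it divided all other residues, it would divide \<open>a i\<close> too, because the total is 0
  modulo \<open>q\<close>. By squarefreeness the denominator then divides the product of the gcds,
  which would be too small if all were below \<open>D\<close>.\<close>

lemma large_gcd_exists:
  assumes I: "finite I" "i \<in> I" and a: "a \<in> tuples I" and D: "D > 0"
    and big: "D ^ (card I - 1) \<le> real (dn (a i))" and k: "card I \<ge> 2"
  shows "\<exists>j\<in>I - {i}. D \<le> real (gcd (dn (a i)) (dn (a j)))"
proof (rule ccontr)
  assume "\<not> ?thesis"
  then have lt: "real (gcd (dn (a i)) (dn (a j))) < D" if "j \<in> I - {i}" for j using that by force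
  have "dn (a i) dvd (\<Prod>j\<in>I - {i}. gcd (dn (a i)) (dn (a j)))"
  proof (rule squarefree_dvdI)
    show "squarefree (dn (a i))" using den_dvd[OF q_gt_0] squarefree_q squarefree_mono by blast
    fix p assume p: "prime p" "p dvd dn (a i)"
    have pq: "p dvd q" using p(2) den_dvd[OF q_gt_0] dvd_trans by blast
    note pd = prime_dvd_den_iff[OF squarefree_q p(1) pq]
    have "\<exists>j\<in>I - {i}. \<not> p dvd a j"
    proof (rule ccontr)
      assume "\<not> ?thesis"
      then have "p dvd (\<Sum>j\<in>I - {i}. a j)" by (intro dvd_sum) auto
      moreover have "p dvd a i + (\<Sum>j\<in>I - {i}. a j)"
        using a pq I sum.remove[of I i a] by (auto simp: tuples_def intro: dvd_trans)
      ultimately have "p dvd a i" using dvd_add_left_iff by blast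
      then show False using pd p(2) by blast
    qed
    then obtain j where j: "j \<in> I - {i}" "\<not> p dvd a j" by auto
    then have "p dvd gcd (dn (a i)) (dn (a j))" using p(2) pd by simp
    then show "p dvd (\<Prod>j\<in>I - {i}. gcd (dn (a i)) (dn (a j)))"
      using j I by (meson dvd_prodI dvd_trans finite_Diff)
  qed
  moreover have "(\<Prod>j\<in>I - {i}. gcd (dn (a i)) (dn (a j))) > 0"
    using den_gt_0[OF q_gt_0] by (intro prod_pos) auto
  ultimately have "dn (a i) \<le> (\<Prod>j\<in>I - {i}. gcd (dn (a i)) (dn (a j)))" by (rule dvd_imp_le)
  then have "real (dn (a i)) \<le> (\<Prod>j\<in>I - {i}. real (gcd (dn (a i)) (dn (a j))))"
    by (simp flip: of_nat_prod)
  also have "\<dots> < (\<Prod>j\<in>I - {i}. D)"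
  proof -
    have "I - {i} \<noteq> {}"
    proof
      assume "I - {i} = {}"
      then have "I = {i}" using I by auto
      then show False using k by simp
    qed
    then obtain j where "j \<in> I - {i}" by blast
    then show ?thesis using I lt D by (intro prod_mono_strict[of j]) (auto intro: less_imp_le)
  qed
  also have "\<dots> = D ^ (card I - 1)" using I by simp
  finally show False using big by simp
qed

lemma sqrt_h_power: "sqrt (8 * h) ^ n = sqrt 8 ^ n * h powr (real n / 2)"
proof -
  have "sqrt h ^ n = (h powr (1 / 2)) ^ n" using h_ge_3 by (simp add: powr_half_sqrt)
  also have "\<dots> = h powr (real n / 2)" using h_ge_3 by (simp add: powr_power)
  finally show ?thesis by (simp add: real_sqrt_mult power_mult_distrib)
qed

lemma sum_no_cancel_le:
  assumes I: "finite I" "card I = k" and k: "k \<ge> 3"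
  shows "(\<Sum>a\<in>no_cancel I. \<Prod>l\<in>I. wt (a l))
     \<le> no_cancel_const k * (h powr (real k / 2 - 1 / (7 * real k)) * rho q ^ (2 ^ k - k - 1))"
proof -
  \<comment> \<open>With this \<eta> the factor \<open>sqrt H\<close> falls short of
    \<open>sqrt h\<close> by exactly \<open>h powr (1 / (7 * k))\<close>, the saving claimed. The
    choice of \<open>D\<close> makes \<open>D ^ (k - 1) = H\<close>, as
    \<open>large_gcd_exists\<close> requires.\<close>
  define \<eta> where "\<eta> = 2 / (7 * real k)"
  define H where "H = h powr (1 - \<eta>)"
  define D where "D = H powr (1 / (real k - 1))"
  define \<Lambda> where "\<Lambda> = h / (H * D) + h powr (2 / 3) / H"
  let ?R = "rho q ^ (2 ^ k - k - 1)"
  let ?E = "h powr (real k / 2 - 1 / (7 * real k))"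
  have h1: "h > 1" "h > 0" using h_ge_3 by auto
  have kr: "real k \<ge> 3" using k by simp
  have \<eta>: "0 < \<eta>" "\<eta> < 1" using kr by (auto simp: \<eta>_def field_simps)
  have H: "1 < H" "H \<le> h"
  proof -
    have "h powr 0 < h powr (1 - \<eta>)" using h1 \<eta> by (intro powr_less_mono) auto
    then show "1 < H" using h1 by (simp add: H_def)
    have "h powr (1 - \<eta>) \<le> h powr 1" using h1 \<eta> by (intro powr_mono) auto
    then show "H \<le> h" using h1 by (simp add: H_def)
  qed
  have D1: "1 \<le> D" using H kr by (auto simp: D_def intro!: ge_one_powr_ge_zero)
  have DH: "D ^ (k - 1) = H"
  proof -
    have "D ^ (k - 1) = D powr real (k - 1)" using D1 by (simp add: powr_realpow)
    also have "real (k - 1) = real k - 1" using k by (simp add: of_nat_diff)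
    also have "D powr (real k - 1) = H powr 1" using kr H by (simp add: D_def powr_powr)
    finally show ?thesis using H by simp
  qed
  \<comment> \<open>The two exponents are -5/(7(k - 1)) and -1/3 + 2/(7k); the second is at most
    -3/(7k) because \<open>k \<ge> 3\<close>. After the square root, -3/(14k) remains, which exceeds
    the required saving and leaves room for the logarithms.\<close>
  have \<Lambda>le: "\<Lambda> \<le> 2 * h powr (- 3 / (7 * real k))"
  proof -
    have "h / (H * D) = h powr (1 - ((1 - \<eta>) + (1 - \<eta>) * (1 / (real k - 1))))"
    proof -
      have "h powr ((1 - \<eta>) * (1 / (real k - 1))) = D" unfolding D_def H_def by (rule powr_powr[symmetric])
      then show ?thesis
        using h1 by (simp only: powr_diff[of h 1 "(1 - \<eta>) + (1 - \<eta>) * (1 / (real k - 1))"] powr_add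
            H_def[symmetric] powr_one less_imp_le)
    qed
    also have "\<dots> \<le> h powr (- 3 / (7 * real k))"
    proof (rule powr_mono)
      have "1 - ((1 - \<eta>) + (1 - \<eta>) * (1 / (real k - 1))) = - 5 / (7 * (real k - 1))"
        using kr by (simp add: \<eta>_def field_simps)
      also have "\<dots> \<le> - 3 / (7 * real k)" using kr by (simp add: field_simps)
      finally show "1 - ((1 - \<eta>) + (1 - \<eta>) * (1 / (real k - 1))) \<le> - 3 / (7 * real k)" .
    qed (use h1 in simp)
    finally have 1: "h / (H * D) \<le> h powr (- 3 / (7 * real k))" .
    have "h powr (2 / 3) / H = h powr (2 / 3 - (1 - \<eta>))"
      unfolding H_def by (rule powr_diff[symmetric])
    also have "\<dots> \<le> h powr (- 3 / (7 * real k))"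
      using kr h1 by (intro powr_mono) (auto simp: \<eta>_def field_simps)
    finally show ?thesis using 1 by (simp add: \<Lambda>_def)
  qed
  have \<Lambda>nn: "\<Lambda> \<ge> 0" using H D1 h1 by (simp add: \<Lambda>_def)
  have finT: "finite (tuples I)" using I finite_tuples by auto
  have rho0: "rho q \<ge> 0" by (simp add: rho_def)
  obtain i where i: "i \<in> I" using I k by (metis card.empty equals0I not_numeral_le_zero)
  let ?f = "\<lambda>a. \<Prod>l\<in>I. wt (a l)"
  let ?S = "\<lambda>l. {a. a \<in> tuples I \<and> real (dn (a l)) < H}"
  let ?M = "\<lambda>j. {a. a \<in> tuples I \<and> H \<le> real (dn (a i)) \<and> H \<le> real (dn (a j)) \<and>
        D \<le> real (gcd (dn (a i)) (dn (a j))) \<and> \<not> q dvd a i + a j}"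
  define X where "X = (Inl ` I \<union> Inr ` (I - {i}) :: (nat + nat) set)"
  define Bx where "Bx x = (case x of Inl l \<Rightarrow> ?S l | Inr j \<Rightarrow> ?M j)" for x :: "nat + nat"
  have "sum ?f (no_cancel I) \<le> (\<Sum>x\<in>X. sum ?f (Bx x))"
  proof (rule sum_le_sum_cover)
    show "finite (no_cancel I)" using finT by (simp add: no_cancel_def)
    show "finite X" using I by (simp add: X_def)
    show "finite (Bx x)" for x using finT by (cases x) (auto simp: Bx_def)
    show "0 \<le> ?f a" for a by (rule prod_wt_nonneg)
    fix a assume a: "a \<in> no_cancel I"
    show "\<exists>x\<in>X. a \<in> Bx x"
    proof (cases "\<exists>l\<in>I. real (dn (a l)) < H")
      case True
      then obtain l where "l \<in> I" "real (dn (a l)) < H" by auto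
      then show ?thesis using a by (intro bexI[of _ "Inl l"]) (auto simp: X_def Bx_def no_cancel_def)
    next
      case False
      then have ge: "H \<le> real (dn (a l))" if "l \<in> I" for l using that by force
      have "\<exists>j\<in>I - {i}. D \<le> real (gcd (dn (a i)) (dn (a j)))"
        using a I i ge[OF i] D1 DH k by (intro large_gcd_exists) (auto simp: no_cancel_def)
      then obtain j where j: "j \<in> I - {i}" "D \<le> real (gcd (dn (a i)) (dn (a j)))" by auto
      then have "a \<in> ?M j" using a i ge by (auto simp: no_cancel_def)
      then show ?thesis using j by (intro bexI[of _ "Inr j"]) (auto simp: X_def Bx_def)
    qed
  qed
  also have "\<dots> = (\<Sum>l\<in>I. sum ?f (?S l)) + (\<Sum>j\<in>I - {i}. sum ?f (?M j))"
    unfolding X_def using I by (subst sum.union_disjoint) (auto simp: sum.reindex Bx_def)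
  also have "(\<Sum>l\<in>I. sum ?f (?S l)) \<le> (\<Sum>l\<in>I. 2 * sqrt 8 ^ (k - 1) * (?E * ?R))"
  proof (rule sum_mono)
    fix l assume l: "l \<in> I"
    have "sum ?f (?S l) \<le> sqrt (4 * H) * sqrt (8 * h) ^ (k - 1) * ?R"
      using sum_small_den_le[OF I(1) l, of H] H I(2) by simp
    also have "sqrt (4 * H) * sqrt (8 * h) ^ (k - 1) = 2 * sqrt 8 ^ (k - 1) * ?E"
    proof -
      have "sqrt (4 * H) = 2 * h powr ((1 - \<eta>) / 2)"
        using h1 by (simp add: real_sqrt_mult H_def powr_half_sqrt[symmetric] powr_powr)
      moreover have "h powr ((1 - \<eta>) / 2) * h powr (real (k - 1) / 2) = ?E"
        using k by (simp add: powr_add[symmetric] \<eta>_def of_nat_diff field_simps)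
      ultimately show ?thesis unfolding sqrt_h_power by simp
    qed
    finally show "sum ?f (?S l) \<le> 2 * sqrt 8 ^ (k - 1) * (?E * ?R)" by (simp add: mult.assoc)
  qed
  also have "(\<Sum>j\<in>I - {i}. sum ?f (?M j)) \<le> (\<Sum>j\<in>I - {i}. sqrt (2 * 1572864) * (28 * real k)\<^sup>2 * sqrt 8 ^ (k - 2) * (?E * ?R))"
  proof (rule sum_mono)
    fix j assume j: "j \<in> I - {i}"
    have "sum ?f (?M j) \<le> (sqrt (1572864 * \<Lambda>) * (rho q * (ln h)\<^sup>2 * h)) * sqrt (8 * h) ^ (k - 2) * rho q ^ (2 ^ k - k - 2)"
      using sum_merged_le[OF I(1) i _ _ H D1, of j] j I(2) by (auto simp: \<Lambda>_def)
    also have "\<dots> = (sqrt (1572864 * \<Lambda>) * (ln h)\<^sup>2) * (h * sqrt (8 * h) ^ (k - 2)) * (rho q * rho q ^ (2 ^ k - k - 2))"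
      by (simp add: ac_simps)
    also have "rho q * rho q ^ (2 ^ k - k - 2) = ?R"
    proof -
      have "k + 2 \<le> 2 ^ k"
        using k by (induction k rule: dec_induct) auto
      then have "2 ^ k - k - 1 = Suc (2 ^ k - k - 2)" by simp
      then show ?thesis by (simp only: power_Suc)
    qed
    also have "h * sqrt (8 * h) ^ (k - 2) = sqrt 8 ^ (k - 2) * h powr (real k / 2)"
    proof -
      have "h * h powr (real (k - 2) / 2) = h powr (1 + real (k - 2) / 2)" using h1 by (simp add: powr_add)
      also have "1 + real (k - 2) / 2 = real k / 2" using k by (simp add: of_nat_diff field_simps)
      finally show ?thesis unfolding sqrt_h_power by (simp add: mult.left_commute)
    qed
    also have "(sqrt (1572864 * \<Lambda>) * (ln h)\<^sup>2) * (sqrt 8 ^ (k - 2) * h powr (real k / 2)) * ?R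
      \<le> (sqrt (2 * 1572864) * (28 * real k)\<^sup>2 * h powr (- 1 / (7 * real k))) * (sqrt 8 ^ (k - 2) * h powr (real k / 2)) * ?R"
    proof (intro mult_right_mono)
      have "sqrt (1572864 * \<Lambda>) \<le> sqrt (1572864 * (2 * h powr (- 3 / (7 * real k))))"
        using \<Lambda>le by simp
      also have "\<dots> = sqrt (2 * 1572864) * h powr (- 3 / (14 * real k))"
      proof -
        have "sqrt (h powr (- 3 / (7 * real k))) = h powr (- 3 / (14 * real k))"
          using h1 by (simp add: powr_half_sqrt[symmetric] powr_powr)
        then show ?thesis by (simp only: real_sqrt_mult) simp
      qed
      finally have s1: "sqrt (1572864 * \<Lambda>) \<le> sqrt (2 * 1572864) * h powr (- 3 / (14 * real k))" .
      \<comment> \<open>The exponent 1/(28k) lets the square of the logarithm cost \<open>h\<close>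
        to the power 1/(14k), so 3/(14k) - 1/(14k) = 1/(7k) is still saved.\<close>
      have "ln h \<le> h powr (1 / (28 * real k)) / (1 / (28 * real k))"
        using h1 kr by (intro ln_powr_bound) auto
      then have "ln h \<le> (28 * real k) * h powr (1 / (28 * real k))" by (simp add: mult.commute)
      then have "(ln h)\<^sup>2 \<le> ((28 * real k) * h powr (1 / (28 * real k)))\<^sup>2"
        using ln_h_ge_1 by (intro power_mono) auto
      also have "\<dots> = (28 * real k)\<^sup>2 * h powr (1 / (14 * real k))"
        using h1 by (simp add: power_mult_distrib power2_eq_square powr_add[symmetric])
      finally have s2: "(ln h)\<^sup>2 \<le> (28 * real k)\<^sup>2 * h powr (1 / (14 * real k))" .
      have "sqrt (1572864 * \<Lambda>) * (ln h)\<^sup>2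
         \<le> (sqrt (2 * 1572864) * h powr (- 3 / (14 * real k))) * ((28 * real k)\<^sup>2 * h powr (1 / (14 * real k)))"
        using s1 s2 by (intro mult_mono) auto
      also have "\<dots> = sqrt (2 * 1572864) * (28 * real k)\<^sup>2 * (h powr (- 3 / (14 * real k)) * h powr (1 / (14 * real k)))"
        by (simp only: ac_simps)
      also have "h powr (- 3 / (14 * real k)) * h powr (1 / (14 * real k)) = h powr (- 1 / (7 * real k))"
        using kr by (simp add: powr_add[symmetric] field_simps)
      finally show "sqrt (1572864 * \<Lambda>) * (ln h)\<^sup>2 \<le> sqrt (2 * 1572864) * (28 * real k)\<^sup>2 * h powr (- 1 / (7 * real k))" .
    qed (use rho0 in auto)
    also have "\<dots> = sqrt (2 * 1572864) * (28 * real k)\<^sup>2 * sqrt 8 ^ (k - 2) * ((h powr (real k / 2) * h powr (- 1 / (7 * real k))) * ?R)"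
      by (simp only: ac_simps)
    also have "h powr (real k / 2) * h powr (- 1 / (7 * real k)) = ?E"
      by (simp add: powr_add[symmetric])
    finally show "sum ?f (?M j) \<le> sqrt (2 * 1572864) * (28 * real k)\<^sup>2 * sqrt 8 ^ (k - 2) * (?E * ?R)" .
  qed
  also have "(\<Sum>l\<in>I. 2 * sqrt 8 ^ (k - 1) * (?E * ?R)) + (\<Sum>j\<in>I - {i}. sqrt (2 * 1572864) * (28 * real k)\<^sup>2 * sqrt 8 ^ (k - 2) * (?E * ?R))
      \<le> no_cancel_const k * (?E * ?R)"
  proof -
    have "real (card (I - {i})) \<le> real k" using I i by simp
    then have "real (card (I - {i})) * (sqrt (2 * 1572864) * (28 * real k)\<^sup>2 * sqrt 8 ^ (k - 2) * (?E * ?R))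
       \<le> real k * (sqrt (2 * 1572864) * (28 * real k)\<^sup>2 * sqrt 8 ^ (k - 2) * (?E * ?R))"
      using rho0 by (intro mult_right_mono) auto
    then show ?thesis using I(2) by (simp add: no_cancel_const_def algebra_simps)
  qed
  finally show ?thesis by simp
qed

end

section \<open>Matchings\<close>

lemma perfect_matchingsD:
  assumes "\<sigma> \<in> perfect_matchings I"
  shows "p \<in> \<sigma> \<Longrightarrow> fst p \<in> I \<and> snd p \<in> I \<and> fst p < snd p"
    and "x \<in> I \<Longrightarrow> \<exists>p\<in>\<sigma>. x = fst p \<or> x = snd p"
    and "\<lbrakk>x \<in> I; p \<in> \<sigma>; p' \<in> \<sigma>; x = fst p \<or> x = snd p; x = fst p' \<or> x = snd p'\<rbrakk> \<Longrightarrow> p = p'"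
proof -
  show "p \<in> \<sigma> \<Longrightarrow> fst p \<in> I \<and> snd p \<in> I \<and> fst p < snd p"
    using assms unfolding perfect_matchings_def by force
  show "x \<in> I \<Longrightarrow> \<exists>p\<in>\<sigma>. x = fst p \<or> x = snd p"
    using assms unfolding perfect_matchings_def by blast
  show "\<lbrakk>x \<in> I; p \<in> \<sigma>; p' \<in> \<sigma>; x = fst p \<or> x = snd p; x = fst p' \<or> x = snd p'\<rbrakk> \<Longrightarrow> p = p'"
    using assms unfolding perfect_matchings_def by blast
qed

text \<open>The extension step behind the induction on unmatched tuples: a matching of the remaining
  indices would extend by the removed pair.\<close>

lemma perfect_matchings_insert:
  assumes \<sigma>: "\<sigma> \<in> perfect_matchings (I - {x, y})" and xy: "x \<in> I" "y \<in> I" "x < y"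
  shows "insert (x, y) \<sigma> \<in> perfect_matchings I"
  unfolding perfect_matchings_def
proof (intro CollectI conjI ballI)
  note D = perfect_matchingsD[OF \<sigma>]
  show "insert (x, y) \<sigma> \<subseteq> {(i, j). i \<in> I \<and> j \<in> I \<and> i < j}"
    using D(1) xy by force
  fix z assume z: "z \<in> I"
  show "\<exists>!p. p \<in> insert (x, y) \<sigma> \<and> (z = fst p \<or> z = snd p)"
  proof (cases "z = x \<or> z = y")
    case True
    show ?thesis
    proof (rule ex1I[of _ "(x, y)"])
      fix p assume p: "p \<in> insert (x, y) \<sigma> \<and> (z = fst p \<or> z = snd p)"
      then show "p = (x, y)" using D(1)[of p] True by auto
    qed (use True in auto)
  next
    case False
    then obtain p where p: "p \<in> \<sigma>" "z = fst p \<or> z = snd p" using D(2)[of z] z by auto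
    show ?thesis
    proof (rule ex1I[of _ p])
      fix p' assume p': "p' \<in> insert (x, y) \<sigma> \<and> (z = fst p' \<or> z = snd p')"
      then have "p' \<in> \<sigma>" using False by auto
      then show "p' = p" using D(3)[of z p' p] p p' z False by blast
    qed (use p in auto)
  qed
qed

lemma finite_perfect_matchings: "finite I \<Longrightarrow> finite (perfect_matchings I)"
proof -
  assume "finite I"
  then have "finite (Pow (I \<times> I))" by simp
  moreover have "perfect_matchings I \<subseteq> Pow (I \<times> I)" by (auto simp: perfect_matchings_def)
  ultimately show ?thesis by (rule finite_subset[rotated])
qed

text \<open>No perfect matching properly contains another. A pair of one that is missing from the
  other has its first element covered there by a different pair.\<close>

lemma distinct_matchings_cross:
  assumes \<sigma>: "\<sigma> \<in> perfect_matchings I" and \<tau>: "\<tau> \<in> perfect_matchings I" and ne: "\<sigma> \<noteq> \<tau>"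
  obtains \<sigma>' \<tau>' p p' x where "{\<sigma>', \<tau>'} = {\<sigma>, \<tau>}" "p \<in> \<sigma>'" "p' \<in> \<tau>'" "p \<noteq> p'" "x = fst p" "x = fst p' \<or> x = snd p'"
proof -
  have sub: "\<sigma> = \<tau>" if st: "\<sigma> \<subseteq> \<tau>" "\<sigma> \<in> perfect_matchings I" "\<tau> \<in> perfect_matchings I" for \<sigma> \<tau>
  proof (rule equalityI[OF st(1)], rule subsetI)
    fix p assume p: "p \<in> \<tau>"
    have "fst p \<in> I" using perfect_matchingsD(1)[OF st(3) p] by blast
    then obtain p' where "p' \<in> \<sigma>" "fst p = fst p' \<or> fst p = snd p'" using perfect_matchingsD(2)[OF st(2)] by blast
    then show "p \<in> \<sigma>" using perfect_matchingsD(3)[OF st(3) \<open>fst p \<in> I\<close>, of p p'] st(1) p by auto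
  qed
  have "\<not> \<sigma> \<subseteq> \<tau>" using sub \<sigma> \<tau> ne by blast
  then obtain p where p: "p \<in> \<sigma>" "p \<notin> \<tau>" by blast
  have "fst p \<in> I" using perfect_matchingsD(1)[OF \<sigma> p(1)] by blast
  then obtain p' where "p' \<in> \<tau>" "fst p = fst p' \<or> fst p = snd p'" using perfect_matchingsD(2)[OF \<tau>] by blast
  then show thesis using p that[of \<sigma> \<tau> p p' "fst p"] by auto
qed

lemma no_cancel_const_nonneg: "0 \<le> no_cancel_const k"
  by (simp add: no_cancel_const_def)

text \<open>The recursion reflects the removal of one cancelling pair: at most
  \<open>k\<^sup>2\<close> choices, each costing \<open>8 * h * rho q\<close> by
  \<open>total_le\<close>. The initial values are 0 because the empty tuple has the empty matching,
  and a single residue that is 0 modulo \<open>q\<close> has weight 0.\<close>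

fun unmatched_const :: "nat \<Rightarrow> real" where
  "unmatched_const 0 = 0"
| "unmatched_const (Suc 0) = 0"
| "unmatched_const (Suc (Suc n)) = no_cancel_const (n + 2) + (real (n + 2))\<^sup>2 * (8 * unmatched_const n)"

lemma unmatched_const_nonneg: "0 \<le> unmatched_const k"
  by (induction k rule: unmatched_const.induct) (auto simp: no_cancel_const_nonneg)

section \<open>Tuples without a matching\<close>

context cyclic_weights
begin

definition matched :: "(nat \<times> nat) set \<Rightarrow> (nat \<Rightarrow> nat) \<Rightarrow> bool" where
  "matched \<sigma> a \<longleftrightarrow> (\<forall>p\<in>\<sigma>. q dvd a (fst p) + a (snd p))"

definition unmatched :: "nat set \<Rightarrow> (nat \<Rightarrow> nat) set" where
  "unmatched I = {a\<in>tuples I. \<not> (\<exists>\<sigma>\<in>perfect_matchings I. matched \<sigma> a)}"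

text \<open>For two indices the condition that the sum vanishes modulo \<open>q\<close> already is a
  cancellation, so the set is empty.\<close>

lemma sum_no_cancel_le':
  assumes I: "finite I" "card I = k" and k: "k \<ge> 2"
  shows "(\<Sum>a\<in>no_cancel I. \<Prod>l\<in>I. wt (a l))
     \<le> no_cancel_const k * (h powr (real k / 2 - 1 / (7 * real k)) * rho q ^ (2 ^ k - k - 1))"
proof (cases "k = 2")
  case True
  obtain x y where xy: "I = {x, y}" "x \<noteq> y" using I True by (metis card_2_iff)
  have "no_cancel I = {}"
    using xy by (auto simp: no_cancel_def tuples_def)
  then show ?thesis using no_cancel_const_nonneg by (simp add: rho_def)
next
  case False
  then show ?thesis using sum_no_cancel_le I k by simp
qed

text \<open>A cancelling pair is itself a tuple on \<open>{x, y}\<close>, and the weight is a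
  product, so restricting to the pair and to the rest embeds the set into a Cartesian
  product.\<close>

lemma sum_pair_removed_le:
  assumes I: "finite I" "x \<in> I" "y \<in> I" "x \<noteq> y" and U: "U \<subseteq> tuples (I - {x, y})"
  shows "(\<Sum>a | a \<in> tuples I \<and> q dvd a x + a y \<and> restrict a (I - {x, y}) \<in> U. \<Prod>l\<in>I. wt (a l))
    \<le> total {x, y} * (\<Sum>b\<in>U. \<Prod>l\<in>I - {x, y}. wt (b l))"
proof -
  let ?J = "I - {x, y}"
  let ?A = "{a. a \<in> tuples I \<and> q dvd a x + a y \<and> restrict a ?J \<in> U}"
  define \<psi> where "\<psi> a = (restrict a {x, y}, restrict a ?J)" for a :: "nat \<Rightarrow> nat"
  define G where "G z = (\<Prod>l\<in>{x, y}. wt (fst z l)) * (\<Prod>l\<in>?J. wt (snd z l))" for z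
  have finU: "finite U" using U I finite_tuples[of ?J] finite_subset by blast
  have inj: "inj_on \<psi> ?A"
  proof (rule inj_onI)
    fix a b assume a: "a \<in> ?A" and b: "b \<in> ?A" and eq: "\<psi> a = \<psi> b"
    show "a = b"
    proof
      fix l
      have "fst (\<psi> a) l = fst (\<psi> b) l" "snd (\<psi> a) l = snd (\<psi> b) l" using eq by simp_all
      then show "a l = b l"
        using a b by (cases "l \<in> I") (auto simp: \<psi>_def tuples_def PiE_def extensional_def restrict_def split: if_splits)
    qed
  qed
  have "(\<Sum>a\<in>?A. \<Prod>l\<in>I. wt (a l)) = (\<Sum>a\<in>?A. G (\<psi> a))"
  proof (rule sum.cong[OF refl])
    fix a
    have "(\<Prod>l\<in>I. wt (a l)) = (\<Prod>l\<in>?J. wt (a l)) * (\<Prod>l\<in>{x, y}. wt (a l))"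
      using I by (intro prod.subset_diff) auto
    moreover have "(\<Prod>l\<in>?J. wt (snd (\<psi> a) l)) = (\<Prod>l\<in>?J. wt (a l))" "(\<Prod>l\<in>{x, y}. wt (fst (\<psi> a) l)) = (\<Prod>l\<in>{x, y}. wt (a l))"
      by (intro prod.cong; simp add: \<psi>_def)+
    ultimately show "(\<Prod>l\<in>I. wt (a l)) = G (\<psi> a)" by (simp add: G_def)
  qed
  also have "\<dots> = (\<Sum>z\<in>\<psi> ` ?A. G z)" using inj by (simp add: sum.reindex)
  also have "\<dots> \<le> (\<Sum>z\<in>tuples {x, y} \<times> U. G z)"
  proof (rule sum_mono2)
    show "finite (tuples {x, y} \<times> U)" using finU finite_tuples by simp
    show "0 \<le> G z" for z unfolding G_def by (intro mult_nonneg_nonneg prod_wt_nonneg)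
    show "\<psi> ` ?A \<subseteq> tuples {x, y} \<times> U"
      using I by (auto simp: \<psi>_def tuples_def PiE_def Pi_def)
  qed
  also have "\<dots> = total {x, y} * (\<Sum>b\<in>U. \<Prod>l\<in>?J. wt (b l))"
    unfolding total_def sum_product sum.cartesian_product by (simp add: G_def case_prod_unfold)
  finally show ?thesis .
qed

text \<open>An unmatched tuple with a cancelling pair stays unmatched when the pair is removed. The
  removed pair costs a full factor \<open>h\<close>, so the saving must come from the remaining
  \<open>n\<close> indices; it is larger for smaller \<open>n\<close>, hence the induction loses
  nothing in the exponent.\<close>

lemma sum_unmatched_le:
  assumes "finite I" "card I = k"
  shows "(\<Sum>a\<in>unmatched I. \<Prod>l\<in>I. wt (a l))
     \<le> unmatched_const k * (h powr (real k / 2 - 1 / (7 * real k)) * rho q ^ (2 ^ k - k - 1))"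
  using assms
proof (induction k arbitrary: I rule: less_induct)
  case (less k)
  consider "k = 0" | "k = 1" | n where "k = Suc (Suc n)"
    by (metis One_nat_def nat.exhaust)
  then show ?case
  proof cases
    case 1
    then have "I = {}" using less.prems by simp
    then have "{} \<in> perfect_matchings I" by (simp add: perfect_matchings_def)
    then have "unmatched I = {}" by (auto simp: unmatched_def matched_def)
    then show ?thesis using 1 by simp
  next
    case 2
    then obtain x where x: "I = {x}" using less.prems by (auto simp: card_1_singleton_iff)
    have "(\<Sum>a\<in>unmatched I. \<Prod>l\<in>I. wt (a l)) = 0"
      using x by (intro sum.neutral) (auto simp: unmatched_def tuples_def wt_def)
    then show ?thesis using 2 by simp
  next
    case (3 n)
    let ?f = "\<lambda>a. \<Prod>l\<in>I. wt (a l)"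
    let ?B = "\<lambda>k. h powr (real k / 2 - 1 / (7 * real k)) * rho q ^ (2 ^ k - k - 1)"
    define P where "P z = {a. a \<in> tuples I \<and> q dvd a (fst z) + a (snd z) \<and> restrict a (I - {fst z, snd z}) \<in> unmatched (I - {fst z, snd z})}"
      for z :: "nat \<times> nat"
    let ?X = "{z \<in> I \<times> I. fst z < snd z}"
    define Bx where "Bx w = (case w of None \<Rightarrow> no_cancel I | Some z \<Rightarrow> P z)" for w
    have finT: "finite (tuples I)" using finite_tuples less.prems by simp
    have rho1: "rho q \<ge> 1" using rho_ge_1 q_gt_0 by simp
    have "sum ?f (unmatched I) \<le> (\<Sum>w\<in>insert None (Some ` ?X). sum ?f (Bx w))"
    proof (rule sum_le_sum_cover)
      show "finite (unmatched I)" using finT by (simp add: unmatched_def)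
      show "finite (insert None (Some ` ?X))" using less.prems by simp
      show "finite (Bx w)" for w using finT by (cases w) (auto simp: Bx_def no_cancel_def P_def)
      show "0 \<le> ?f a" for a by (rule prod_wt_nonneg)
      fix a assume a: "a \<in> unmatched I"
      show "\<exists>w\<in>insert None (Some ` ?X). a \<in> Bx w"
      proof (cases "a \<in> no_cancel I")
        case True
        then show ?thesis by (intro bexI[of _ None]) (auto simp: Bx_def)
      next
        case False
        then obtain x y where "x \<in> I" "y \<in> I" "x \<noteq> y" "q dvd a x + a y"
          using a by (auto simp: no_cancel_def unmatched_def)
        then have "\<exists>x y. x \<in> I \<and> y \<in> I \<and> x < y \<and> q dvd a x + a y"
          by (metis add.commute linorder_neqE_nat)
        then obtain x y where xy: "x \<in> I" "y \<in> I" "x < y" "q dvd a x + a y" by blast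
        let ?J = "I - {x, y}"
        have aT: "a \<in> tuples I" using a by (simp add: unmatched_def)
        have "restrict a ?J \<in> tuples ?J"
        proof -
          have "(\<Sum>l\<in>I. a l) = (\<Sum>l\<in>?J. a l) + (\<Sum>l\<in>{x, y}. a l)"
            using less.prems xy by (intro sum.subset_diff) auto
          then have "(\<Sum>l\<in>I. a l) = (\<Sum>l\<in>?J. a l) + (a x + a y)" using xy(3) by simp
          then have "q dvd (\<Sum>l\<in>?J. a l)" using aT xy(4) dvd_add_left_iff[of q "a x + a y"]
            by (simp add: tuples_def)
          then show ?thesis using aT by (auto simp: tuples_def PiE_def Pi_def)
        qed
        moreover have "\<not> (\<exists>\<sigma>\<in>perfect_matchings ?J. matched \<sigma> (restrict a ?J))"
        proof
          assume "\<exists>\<sigma>\<in>perfect_matchings ?J. matched \<sigma> (restrict a ?J)"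
          then obtain \<sigma> where \<sigma>: "\<sigma> \<in> perfect_matchings ?J" "matched \<sigma> (restrict a ?J)" by blast
          have "matched (insert (x, y) \<sigma>) a"
            unfolding matched_def
          proof
            fix p assume p: "p \<in> insert (x, y) \<sigma>"
            show "q dvd a (fst p) + a (snd p)"
            proof (cases "p = (x, y)")
              case False
              then have "p \<in> \<sigma>" using p by simp
              then show ?thesis using perfect_matchingsD(1)[OF \<sigma>(1) \<open>p \<in> \<sigma>\<close>] \<sigma>(2) by (auto simp: matched_def)
            qed (use xy in simp)
          qed
          moreover have "insert (x, y) \<sigma> \<in> perfect_matchings I"
            by (rule perfect_matchings_insert[OF \<sigma>(1) xy(1-3)])
          ultimately show False using a by (auto simp: unmatched_def)
        qed
        ultimately have "a \<in> P (x, y)" using aT xy by (simp add: P_def unmatched_def)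
        then show ?thesis using xy by (intro bexI[of _ "Some (x, y)"]) (auto simp: Bx_def)
      qed
    qed
    also have "\<dots> = sum ?f (no_cancel I) + (\<Sum>z\<in>?X. sum ?f (P z))"
      using less.prems by (subst sum.insert) (auto simp: sum.reindex Bx_def)
    also have "sum ?f (no_cancel I) \<le> no_cancel_const k * ?B k"
      using less.prems 3 by (intro sum_no_cancel_le') auto
    also have "(\<Sum>z\<in>?X. sum ?f (P z)) \<le> (\<Sum>z\<in>?X. 8 * unmatched_const n * ?B k)"
    proof (rule sum_mono)
      fix z assume z: "z \<in> ?X"
      obtain x y where z': "z = (x, y)" by (cases z)
      have xy: "x \<in> I" "y \<in> I" "x < y" using z z' by auto
      let ?J = "I - {x, y}"
      have cJ: "card ?J = n" "finite ?J" using less.prems 3 xy by (auto simp: card_Diff_subset)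
      have "sum ?f (P z) \<le> total {x, y} * (\<Sum>b\<in>unmatched ?J. \<Prod>l\<in>?J. wt (b l))"
        using sum_pair_removed_le[OF less.prems(1) xy(1,2), of "unmatched ?J"] xy(3)
        by (simp add: P_def z' unmatched_def)
      also have "\<dots> \<le> (8 * h * rho q) * (unmatched_const n * ?B n)"
      proof (rule mult_mono)
        have "total {x, y} \<le> sqrt (8 * h) ^ card {x, y} * rho q ^ (2 ^ card {x, y} - card {x, y} - 1)"
          by (rule total_le) simp
        then show "total {x, y} \<le> 8 * h * rho q" using xy(3) h_ge_3 by simp
        show "(\<Sum>b\<in>unmatched ?J. \<Prod>l\<in>?J. wt (b l)) \<le> unmatched_const n * ?B n"
          using less.IH[of n ?J] cJ 3 by simp
        show "0 \<le> 8 * h * rho q" using h_ge_3 rho1 by simp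
        show "0 \<le> (\<Sum>b\<in>unmatched ?J. \<Prod>l\<in>?J. wt (b l))" by (intro sum_nonneg prod_wt_nonneg)
      qed
      \<comment> \<open>For \<open>n = 0\<close> the constant vanishes, so the exponent with
        \<open>1 / (7 * 0)\<close> is harmless. Otherwise the pair's factor \<open>rho q\<close>
        raises the exponent by one, which stays below the exponent for
        \<open>k = n + 2\<close>.\<close>
      also have "\<dots> \<le> 8 * unmatched_const n * ?B k"
      proof (cases "n = 0")
        case True
        then show ?thesis by simp
      next
        case False
        have "h * h powr (real n / 2 - 1 / (7 * real n)) = h powr (1 + (real n / 2 - 1 / (7 * real n)))"
          using h_ge_3 by (simp only: powr_add) simp
        also have "\<dots> \<le> h powr (real k / 2 - 1 / (7 * real k))"
        proof (rule powr_mono)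
          have "1 / (7 * real k) \<le> 1 / (7 * real n)" using False 3 by (intro divide_left_mono) auto
          moreover have "real k / 2 = real n / 2 + 1" using 3 by (simp add: field_simps)
          ultimately show "1 + (real n / 2 - 1 / (7 * real n)) \<le> real k / 2 - 1 / (7 * real k)" by linarith
        qed (use h_ge_3 in simp)
        finally have 1: "h * h powr (real n / 2 - 1 / (7 * real n)) \<le> h powr (real k / 2 - 1 / (7 * real k))" .
        have "rho q * rho q ^ (2 ^ n - n - 1) = rho q ^ Suc (2 ^ n - n - 1)" by simp
        also have "\<dots> \<le> rho q ^ (2 ^ k - k - 1)"
        proof (rule power_increasing[OF _ rho1])
          have "n < 2 ^ n" by (rule less_exp)
          then have "Suc (x - n - 1) \<le> 4 * x - Suc (Suc n) - 1" if "x = 2 ^ n" for x using that by arith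
          then show "Suc (2 ^ n - n - 1) \<le> 2 ^ k - k - 1" using 3 by simp
        qed
        finally have 2: "rho q * rho q ^ (2 ^ n - n - 1) \<le> rho q ^ (2 ^ k - k - 1)" .
        have "(8 * h * rho q) * (unmatched_const n * ?B n)
           = 8 * unmatched_const n * ((h * h powr (real n / 2 - 1 / (7 * real n))) * (rho q * rho q ^ (2 ^ n - n - 1)))"
          by (simp only: ac_simps)
        also have "\<dots> \<le> 8 * unmatched_const n * ?B k"
          using 1 2 rho1 h_ge_3 unmatched_const_nonneg[of n] by (intro mult_left_mono mult_mono) auto
        finally show ?thesis .
      qed
      finally show "sum ?f (P z) \<le> 8 * unmatched_const n * ?B k" .
    qed
    also have "\<dots> = real (card ?X) * (8 * unmatched_const n * ?B k)" by simp
    also have "\<dots> \<le> (real k)\<^sup>2 * (8 * unmatched_const n * ?B k)"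
    proof (rule mult_right_mono)
      have "card ?X \<le> card (I \<times> I)" using less.prems by (intro card_mono) auto
      also have "\<dots> = k * k" using less.prems by (simp add: card_cartesian_product)
      finally show "real (card ?X) \<le> (real k)\<^sup>2" by (simp add: power2_eq_square flip: of_nat_mult)
      show "0 \<le> 8 * unmatched_const n * ?B k" using unmatched_const_nonneg[of n] rho1 by simp
    qed
    finally have "sum ?f (unmatched I) \<le> no_cancel_const k * ?B k + (real k)\<^sup>2 * (8 * unmatched_const n * ?B k)"
      by linarith
    also have "\<dots> = unmatched_const k * ?B k" using 3 by (simp add: algebra_simps)
    finally show ?thesis .
  qed
qed

section \<open>Tuples satisfying several matchings\<close>

definition coincident :: "nat set \<Rightarrow> (nat \<Rightarrow> nat) set" where
  "coincident I = {a\<in>tuples I. \<exists>x\<in>I. \<exists>y\<in>I. \<exists>z\<in>I. x \<noteq> y \<and> y \<noteq> z \<and> x \<noteq> z \<and> q dvd a x + a y \<and> a z = a y}"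

lemma cong_partner_unique:
  assumes "x < q" "x' < q" "q dvd x + y" "q dvd x' + y"
  shows "x = x'"
proof -
  have "[x + y = x' + y] (mod q)" using assms by (simp add: cong_def)
  then have "[x = x'] (mod q)" by (simp add: cong_add_rcancel_nat)
  then show ?thesis using assms by (simp add: cong_def)
qed

text \<open>The entries at \<open>x\<close> and \<open>y\<close> can be recovered from the rest:
  \<open>a y\<close> equals \<open>a z\<close>, and \<open>a x\<close> is its negative modulo
  \<open>q\<close>. Bounding their weights by 1 leaves a tuple on \<open>k - 2\<close> indices,
  whose sum is still 0 modulo \<open>q\<close>, and so saves a full factor \<open>h\<close>.\<close>

lemma sum_coincident_le:
  assumes I: "finite I" "card I = k"
  shows "(\<Sum>a\<in>coincident I. \<Prod>l\<in>I. wt (a l))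
    \<le> real k ^ 3 * sqrt 8 ^ (k - 2) * (h powr (real k / 2 - 1 / (7 * real k)) * rho q ^ (2 ^ k - k - 1))"
proof -
  let ?f = "\<lambda>a. \<Prod>l\<in>I. wt (a l)"
  let ?B = "h powr (real k / 2 - 1 / (7 * real k)) * rho q ^ (2 ^ k - k - 1)"
  define X where "X = {w \<in> I \<times> I \<times> I. fst w \<noteq> fst (snd w) \<and> fst (snd w) \<noteq> snd (snd w) \<and> fst w \<noteq> snd (snd w)}"
  define P where "P w = {a\<in>tuples I. q dvd a (fst w) + a (fst (snd w)) \<and> a (snd (snd w)) = a (fst (snd w))}" for w :: "nat \<times> nat \<times> nat"
  have finT: "finite (tuples I)" using finite_tuples I by simp
  have rho1: "rho q \<ge> 1" using rho_ge_1 q_gt_0 by simp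
  have finX: "finite X" using I by (simp add: X_def)
  have Bnn: "0 \<le> ?B" using rho1 by simp
  have "sum ?f (coincident I) \<le> (\<Sum>w\<in>X. sum ?f (P w))"
  proof (rule sum_le_sum_cover)
    show "finite (coincident I)" using finT by (simp add: coincident_def)
    show "finite (P w)" for w using finT by (simp add: P_def)
    show "0 \<le> ?f a" for a by (rule prod_wt_nonneg)
    fix a assume "a \<in> coincident I"
    then obtain x y z where "x \<in> I" "y \<in> I" "z \<in> I" "x \<noteq> y" "y \<noteq> z" "x \<noteq> z" "q dvd a x + a y" "a z = a y" "a \<in> tuples I"
      unfolding coincident_def by blast
    then show "\<exists>w\<in>X. a \<in> P w" by (intro bexI[of _ "(x, y, z)"]) (auto simp: X_def P_def)
  qed (rule finX)
  also have "\<dots> \<le> (\<Sum>w\<in>X. sqrt 8 ^ (k - 2) * ?B)"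
  proof (rule sum_mono)
    fix w assume w: "w \<in> X"
    obtain x y z where w': "w = (x, y, z)" by (metis surj_pair)
    have xyz: "x \<in> I" "y \<in> I" "z \<in> I" "x \<noteq> y" "y \<noteq> z" "x \<noteq> z" using w w' by (auto simp: X_def)
    let ?J = "I - {x, y}"
    have k3: "k \<ge> 3"
    proof -
      have "card {x, y, z} \<le> card I" using I xyz by (intro card_mono) auto
      then show ?thesis using xyz I by simp
    qed
    have cJ: "card ?J = k - 2" "finite ?J" using I xyz by (auto simp: card_Diff_subset numeral_2_eq_2)
    have lt: "a l < q" if "a \<in> tuples I" "l \<in> I" for a l using that by (auto simp: tuples_def PiE_def Pi_def)
    let ?r = "\<lambda>a. restrict a ?J"
    have inj: "inj_on ?r (P w)"
    proof (rule inj_onI)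
      fix a b assume a: "a \<in> P w" and b: "b \<in> P w" and eq: "?r a = ?r b"
      have J: "a l = b l" if "l \<in> ?J" for l using fun_cong[OF eq, of l] that by simp
      have aT: "a \<in> tuples I" "b \<in> tuples I" using a b by (auto simp: P_def)
      have yy: "a y = b y" using J[of z] a b xyz w' by (auto simp: P_def)
      have xx: "a x = b x"
        using a b yy w' lt[OF aT(1) xyz(1)] lt[OF aT(2) xyz(1)]
        by (intro cong_partner_unique[of _ _ "a y"]) (auto simp: P_def)
      show "a = b"
      proof
        fix l
        show "a l = b l"
        proof (cases "l \<in> I")
          case True
          then show ?thesis using J[of l] xx yy by (cases "l = x \<or> l = y") auto
        next
          case False
          then show ?thesis using aT by (auto simp: tuples_def PiE_def extensional_def)
        qed
      qed
    qed
    have "sum ?f (P w) \<le> (\<Sum>a\<in>P w. \<Prod>l\<in>?J. wt (?r a l))"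
    proof (rule sum_mono)
      fix a
      have "?f a = (\<Prod>l\<in>?J. wt (a l)) * (\<Prod>l\<in>{x, y}. wt (a l))"
        using I xyz by (intro prod.subset_diff) auto
      also have "\<dots> \<le> (\<Prod>l\<in>?J. wt (a l)) * 1"
        by (intro mult_left_mono prod_le_1 prod_wt_nonneg) (auto simp: wt_nonneg wt_le_1)
      also have "\<dots> = (\<Prod>l\<in>?J. wt (?r a l))" by simp
      finally show "?f a \<le> (\<Prod>l\<in>?J. wt (?r a l))" .
    qed
    also have "\<dots> = (\<Sum>b\<in>?r ` P w. \<Prod>l\<in>?J. wt (b l))" using inj by (simp add: sum.reindex)
    also have "\<dots> \<le> total ?J"
      unfolding total_def
    proof (rule sum_mono2)
      show "finite (tuples ?J)" using cJ finite_tuples by simp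
      show "?r ` P w \<subseteq> tuples ?J"
      proof
        fix b assume "b \<in> ?r ` P w"
        then obtain a where a: "a \<in> P w" "b = ?r a" by auto
        then have aT: "a \<in> tuples I" "q dvd a x + a y" using w' by (auto simp: P_def)
        have "(\<Sum>l\<in>I. a l) = (\<Sum>l\<in>?J. a l) + (\<Sum>l\<in>{x, y}. a l)"
          using I xyz by (intro sum.subset_diff) auto
        then have "(\<Sum>l\<in>I. a l) = (\<Sum>l\<in>?J. a l) + (a x + a y)" using xyz by simp
        then have "q dvd (\<Sum>l\<in>?J. a l)" using aT dvd_add_left_iff[of q "a x + a y"]
          by (simp add: tuples_def)
        then show "b \<in> tuples ?J" using aT a by (auto simp: tuples_def PiE_def Pi_def)
      qed
    qed (rule prod_wt_nonneg)
    also have "\<dots> \<le> sqrt (8 * h) ^ (k - 2) * rho q ^ (2 ^ (k - 2) - (k - 2) - 1)"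
      using total_le[OF cJ(2)] cJ(1) by simp
    also have "\<dots> = sqrt 8 ^ (k - 2) * (h powr (real (k - 2) / 2) * rho q ^ (2 ^ (k - 2) - (k - 2) - 1))"
      unfolding sqrt_h_power by simp
    also have "\<dots> \<le> sqrt 8 ^ (k - 2) * ?B"
    proof (intro mult_left_mono mult_mono)
      show "h powr (real (k - 2) / 2) \<le> h powr (real k / 2 - 1 / (7 * real k))"
      proof (rule powr_mono)
        have "1 / (7 * real k) \<le> 1" using k3 by simp
        moreover have "real (k - 2) / 2 = real k / 2 - 1" using k3 by (simp add: of_nat_diff field_simps)
        ultimately show "real (k - 2) / 2 \<le> real k / 2 - 1 / (7 * real k)" by linarith
      qed (use h_ge_3 in simp)
      show "rho q ^ (2 ^ (k - 2) - (k - 2) - 1) \<le> rho q ^ (2 ^ k - k - 1)"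
      proof (rule power_increasing[OF _ rho1])
        obtain n where n: "k = Suc (Suc n)" using k3 by (metis add_2_eq_Suc le_Suc_ex numeral_3_eq_3 Suc_le_D Suc_le_mono)
        have "n < 2 ^ n" by (rule less_exp)
        then have "x - n - 1 \<le> 4 * x - Suc (Suc n) - 1" if "x = 2 ^ n" for x using that by arith
        then show "2 ^ (k - 2) - (k - 2) - 1 \<le> 2 ^ k - k - 1" using n by simp
      qed
    qed (use rho1 in auto)
    finally show "sum ?f (P w) \<le> sqrt 8 ^ (k - 2) * ?B" .
  qed
  also have "\<dots> = real (card X) * (sqrt 8 ^ (k - 2) * ?B)" by simp
  also have "\<dots> \<le> real k ^ 3 * (sqrt 8 ^ (k - 2) * ?B)"
  proof (rule mult_right_mono)
    have "card X \<le> card (I \<times> I \<times> I)" unfolding X_def using I by (intro card_mono) auto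
    also have "\<dots> = k ^ 3" using I by (simp add: card_cartesian_product power3_eq_cube)
    finally show "real (card X) \<le> real k ^ 3" by (simp flip: of_nat_power)
  qed (use Bnn in simp)
  finally show ?thesis by (simp add: mult.assoc)
qed

definition match_count :: "nat set \<Rightarrow> (nat \<Rightarrow> nat) \<Rightarrow> nat" where
  "match_count I a = card {\<sigma>\<in>perfect_matchings I. matched \<sigma> a}"

text \<open>Two distinct matchings give some index \<open>x\<close> two different partners. Both
  partners carry the negative of \<open>a x\<close> modulo \<open>q\<close> and so have equal
  entries.\<close>

lemma match_count_ge_2_coincident:
  assumes "a \<in> tuples I" "match_count I a \<ge> 2"
  shows "a \<in> coincident I"
proof -
  obtain \<sigma> \<tau> where st: "\<sigma> \<in> perfect_matchings I" "matched \<sigma> a" "\<tau> \<in> perfect_matchings I" "matched \<tau> a" "\<sigma> \<noteq> \<tau>"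
  proof -
    have "\<exists>S\<subseteq>{\<sigma>\<in>perfect_matchings I. matched \<sigma> a}. card S = 2"
      using assms(2) by (metis match_count_def obtain_subset_with_card_n)
    then show thesis using that by (auto simp: card_2_iff)
  qed
  have *: "a \<in> coincident I"
    if s: "\<sigma> \<in> perfect_matchings I" "matched \<sigma> a" and t: "\<tau> \<in> perfect_matchings I" "matched \<tau> a"
      and p: "p \<in> \<sigma>" "p' \<in> \<tau>" "p \<noteq> p'" "x = fst p" "x = fst p' \<or> x = snd p'" for \<sigma> \<tau> p p' x
  proof -
    define y where "y = snd p"
    define z where "z = (if x = fst p' then snd p' else fst p')"
    have d: "fst p \<in> I" "snd p \<in> I" "fst p < snd p" using perfect_matchingsD(1)[OF s(1) p(1)] by auto
    have d': "fst p' \<in> I" "snd p' \<in> I" "fst p' < snd p'" using perfect_matchingsD(1)[OF t(1) p(2)] by auto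
    have xyz: "x \<in> I" "y \<in> I" "z \<in> I" "x \<noteq> y" "x \<noteq> z"
      using d d' p by (auto simp: y_def z_def)
    have yz: "y \<noteq> z"
      using d d' p by (auto simp: y_def z_def prod_eq_iff split: if_splits)
    have xy: "q dvd a x + a y" using s(2) p by (auto simp: matched_def y_def)
    have xz: "q dvd a x + a z" using t(2) p by (auto simp: matched_def z_def add.commute split: if_splits)
    have "a y < q" "a z < q" using assms(1) xyz by (auto simp: tuples_def PiE_def Pi_def)
    then have "a z = a y" using xy xz by (intro cong_partner_unique[of _ _ "a x"]) (auto simp: add.commute)
    then show ?thesis using assms(1) xyz yz xy unfolding coincident_def by blast
  qed
  obtain \<sigma>' \<tau>' p p' x where c: "{\<sigma>', \<tau>'} = {\<sigma>, \<tau>}" "p \<in> \<sigma>'" "p' \<in> \<tau>'" "p \<noteq> p'" "x = fst p" "x = fst p' \<or> x = snd p'"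
    by (rule distinct_matchings_cross[OF st(1,3,5)])
  then have "\<sigma>' \<in> perfect_matchings I" "matched \<sigma>' a" "\<tau>' \<in> perfect_matchings I" "matched \<tau>' a"
    using st by (auto simp: doubleton_eq_iff)
  then show ?thesis using * c(2-6) by blast
qed

text \<open>A tuple with exactly one matching has defect 0. Without a matching the defect is 1 and
  the tuple is unmatched; with several it is at most the number of all matchings and the tuple is
  coincident.\<close>

theorem sum_match_defect_le:
  assumes I: "finite I" "card I = k"
  shows "(\<Sum>a\<in>tuples I. \<bar>1 - real (match_count I a)\<bar> * (\<Prod>l\<in>I. wt (a l)))
    \<le> (unmatched_const k + real (card (perfect_matchings I)) * (real k ^ 3 * sqrt 8 ^ (k - 2))) *
      (h powr (real k / 2 - 1 / (7 * real k)) * rho q ^ (2 ^ k - k - 1))"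
proof -
  let ?f = "\<lambda>a. \<Prod>l\<in>I. wt (a l)"
  let ?B = "h powr (real k / 2 - 1 / (7 * real k)) * rho q ^ (2 ^ k - k - 1)"
  let ?N = "real (card (perfect_matchings I))"
  have finT: "finite (tuples I)" using finite_tuples I by simp
  have finM: "finite (perfect_matchings I)" using finite_perfect_matchings[OF I(1)] .
  have "(\<Sum>a\<in>tuples I. \<bar>1 - real (match_count I a)\<bar> * ?f a)
      \<le> (\<Sum>a\<in>tuples I. (if a \<in> unmatched I then ?f a else 0) + ?N * (if a \<in> coincident I then ?f a else 0))"
  proof (rule sum_mono)
    fix a assume a: "a \<in> tuples I"
    have f0: "0 \<le> ?f a" by (rule prod_wt_nonneg)
    have cN: "match_count I a \<le> card (perfect_matchings I)"
      unfolding match_count_def using finM by (intro card_mono) auto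
    consider "match_count I a = 0" | "match_count I a = 1" | "match_count I a \<ge> 2" by linarith
    then show "\<bar>1 - real (match_count I a)\<bar> * ?f a
      \<le> (if a \<in> unmatched I then ?f a else 0) + ?N * (if a \<in> coincident I then ?f a else 0)"
    proof cases
      case 1
      then have "{\<sigma>\<in>perfect_matchings I. matched \<sigma> a} = {}" using finM by (simp add: match_count_def)
      then have "a \<in> unmatched I" using a by (auto simp: unmatched_def)
      then show ?thesis using 1 f0 by simp
    next
      case 2
      then show ?thesis using f0 by simp
    next
      case 3
      then have "a \<in> coincident I" using match_count_ge_2_coincident a by blast
      moreover have "\<bar>1 - real (match_count I a)\<bar> * ?f a \<le> ?N * ?f a"
        using 3 cN f0 by (intro mult_right_mono) auto
      ultimately show ?thesis using f0 by simp
    qed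
  qed
  also have "\<dots> = sum ?f (unmatched I) + ?N * sum ?f (coincident I)"
  proof -
    have "unmatched I \<subseteq> tuples I" "coincident I \<subseteq> tuples I" by (auto simp: unmatched_def coincident_def)
    then have "(\<Sum>a\<in>tuples I. if a \<in> unmatched I then ?f a else 0) = sum ?f (unmatched I)"
      "(\<Sum>a\<in>tuples I. if a \<in> coincident I then ?f a else 0) = sum ?f (coincident I)"
      using finT by (simp_all add: sum.inter_restrict[symmetric] Int_absorb1)
    then show ?thesis by (simp add: sum.distrib flip: sum_distrib_left)
  qed
  also have "\<dots> \<le> unmatched_const k * ?B + ?N * (real k ^ 3 * sqrt 8 ^ (k - 2) * ?B)"
    using sum_unmatched_le[OF I] sum_coincident_le[OF I] by (intro add_mono mult_left_mono) auto
  also have "\<dots> = (unmatched_const k + ?N * (real k ^ 3 * sqrt 8 ^ (k - 2))) * ?B"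
    by (simp only: distrib_right mult.assoc)
  finally show ?thesis .
qed

end

section \<open>Reduction to residues modulo \<open>q\<close>\<close>

text \<open>A weak form of Jordan's inequality. Up to 1/3 the cosine is at least 1/2, so
  \<open>sin x - x / 2\<close> increases; beyond that the sine is at least
  \<open>sin (pi / 6) = 1 / 2\<close>.\<close>

lemma sin_pi_ge:
  assumes "0 \<le> s" "s \<le> 1 / 2"
  shows "s / 2 \<le> sin (pi * s)"
proof (cases "s \<le> 1 / 3")
  case True
  have "sin 0 - 0 / 2 \<le> sin (pi * s) - (pi * s) / 2"
  proof (rule DERIV_nonneg_imp_nondecreasing[where f = "\<lambda>x. sin x - x / 2"])
    fix x assume x: "0 \<le> x" "x \<le> pi * s"
    have "x \<le> pi / 3" using x True by (smt (verit) mult_left_mono pi_gt_zero times_divide_eq_right mult_cancel_left2)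
    then have "cos (pi / 3) \<le> cos x" using x by (intro cos_monotone_0_pi_le) auto
    then have "0 \<le> cos x - 1 / 2" by (simp add: cos_60)
    then show "\<exists>y. ((\<lambda>x. sin x - x / 2) has_real_derivative y) (at x) \<and> 0 \<le> y"
      by (intro exI[of _ "cos x - 1 / 2"] conjI) (auto intro!: derivative_eq_intros)
  qed (use assms in simp)
  moreover have "s / 2 \<le> (pi * s) / 2"
    using assms pi_ge_two mult_right_mono[of 1 pi s] by simp
  ultimately show ?thesis by simp
next
  case False
  have "pi * (1 / 6) \<le> pi * s" using False by (intro mult_left_mono) auto
  moreover have "pi * s \<le> pi * (1 / 2)" using assms by (intro mult_left_mono) auto
  ultimately have "sin (pi / 6) \<le> sin (pi * s)" by (intro sin_monotone_2pi_le) auto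
  then show ?thesis using assms by (simp add: sin_30)
qed

text \<open>The norm equals twice the absolute value of \<open>sin (pi * x)\<close>, which depends
  only on the distance of \<open>x\<close> to the nearest integer.\<close>

lemma norm_one_minus_e_ge: "dist_int x \<le> norm (1 - e x)"
proof -
  define n where "n = round x"
  define s where "s = x - of_int n"
  have ds: "dist_int x = \<bar>s\<bar>" by (simp add: dist_int_def s_def n_def)
  have e: "e x = cis (2 * (pi * x))"
    by (simp add: e_def cis_conv_exp algebra_simps)
  have "(norm (1 - e x))\<^sup>2 = (2 * sin (pi * x))\<^sup>2"
  proof -
    have "(norm (1 - e x))\<^sup>2 = (1 - cos (2 * (pi * x)))\<^sup>2 + (sin (2 * (pi * x)))\<^sup>2"
      unfolding e by (simp add: cmod_power2)
    also have "\<dots> = 2 - 2 * cos (2 * (pi * x))"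
      using sin_cos_squared_add[of "2 * (pi * x)"] by (simp add: power2_eq_square algebra_simps)
    also have "\<dots> = (2 * sin (pi * x))\<^sup>2"
      by (simp add: cos_double_sin power_mult_distrib)
    finally show ?thesis .
  qed
  then have n1: "norm (1 - e x) = \<bar>2 * sin (pi * x)\<bar>"
    by (metis abs_of_nonneg norm_ge_zero power2_eq_iff_nonneg abs_ge_zero power2_abs)
  have "pi * x = pi * s + pi * of_int n" by (simp add: s_def algebra_simps)
  then have "\<bar>sin (pi * x)\<bar> = \<bar>sin (pi * s)\<bar>"
    by (simp add: sin_add cos_npi_int)
  also have "\<dots> = \<bar>sin (pi * \<bar>s\<bar>)\<bar>" by (cases "s \<ge> 0") auto
  also have "\<dots> \<ge> \<bar>s\<bar> / 2"
    using sin_pi_ge[of "\<bar>s\<bar>"] dist_int_le_half[of x] ds by linarith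
  finally show ?thesis using n1 ds by simp
qed

lemma e_add: "e (x + y) = e x * e y"
  by (simp add: e_def distrib_left exp_add)

lemma norm_e: "norm (e x) = 1"
  by (simp add: e_def)

text \<open>Multiplying by \<open>1 - e(r\<alpha>)\<close> telescopes the progression to its two end terms.\<close>

lemma norm_E_le:
  assumes "r \<ge> 1" "h \<ge> 3"
  shows "norm (E h r c x) \<le> 2 * peak h (real r * x)"
proof -
  define M where "M = {m. 1 \<le> m \<and> real m \<le> h \<and> [int m = c] (mod int r)}"
  have sub: "M \<subseteq> {1..nat \<lfloor>h\<rfloor>}" by (auto simp: M_def le_nat_floor)
  then have finM: "finite M" using finite_subset by blast
  have triv: "norm (E h r c x) \<le> h"
  proof -
    have "norm (E h r c x) \<le> (\<Sum>m\<in>M. norm (e (real m * x)))" unfolding E_def M_def by (rule norm_sum)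
    also have "\<dots> = real (card M)" by (simp add: norm_e)
    also have "\<dots> \<le> real (nat \<lfloor>h\<rfloor>)" using card_mono[OF _ sub] by simp
    also have "\<dots> \<le> h" using assms by (intro of_nat_floor) simp
    finally show ?thesis .
  qed
  let ?M' = "(\<lambda>m. m + r) ` M"
  have cong_eq: "m = m'" if "[int m = c] (mod int r)" "[int m' = c] (mod int r)" "m \<le> m'" "m' < m + r" for m m'
  proof -
    have "[int m' = int m] (mod int r)" using that cong_sym cong_trans by blast
    then have "[m' = m] (mod r)" by (simp add: cong_int_iff)
    then have "r dvd m' - m" using that(3) by (simp add: cong_altdef_nat)
    then have "m' - m = 0" using that(4) dvd_imp_le[of r "m' - m"] by linarith
    then show ?thesis using that(3) by simp
  qed
  \<comment> \<open>A member of \<open>M\<close> not reached by the shift is at most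
    \<open>r\<close>, and the class has only one member among \<open>1, \<dots>, r\<close>.\<close>
  have c1: "card (M - ?M') \<le> 1"
  proof -
    have le: "m \<le> r" if "m \<in> M - ?M'" for m
    proof (rule ccontr)
      assume "\<not> m \<le> r"
      moreover have "[int m - int r = c] (mod int r)"
      proof -
        have "int r dvd int m - c" using that by (auto simp: M_def cong_iff_dvd_diff)
        then have "int r dvd (int m - c) - int r" by (rule dvd_diff) simp
        then show ?thesis by (simp add: cong_iff_dvd_diff algebra_simps)
      qed
      ultimately have "m - r \<in> M" using that by (simp add: M_def of_nat_diff)
      then have "m \<in> ?M'" using \<open>\<not> m \<le> r\<close> by (intro image_eqI[of _ _ "m - r"]) auto
      then show False using that by simp
    qed
    have "m = m'" if "m \<in> M - ?M'" "m' \<in> M - ?M'" "m \<le> m'" for m m'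
      using le[OF that(2)] that by (intro cong_eq) (auto simp: M_def)
    then have "m = m'" if "m \<in> M - ?M'" "m' \<in> M - ?M'" for m m'
      using that by (metis linear)
    then show ?thesis using finM by (simp add: card_le_Suc0_iff_eq)
  qed
  \<comment> \<open>A shifted member outside \<open>M\<close> exceeds \<open>h\<close> but not
    \<open>h + r\<close>, an interval that meets the class at most once.\<close>
  have c2: "card (?M' - M) \<le> 1"
  proof -
    have gt: "real m > h" "real m \<le> h + real r" "[int m = c] (mod int r)" if m: "m \<in> ?M' - M" for m
    proof -
      obtain l where l: "l \<in> M" "m = l + r" using m by auto
      show cm: "[int m = c] (mod int r)"
      proof -
        have "int r dvd int l - c" using l by (auto simp: M_def cong_iff_dvd_diff)
        then have "int r dvd (int l - c) + int r" by (rule dvd_add) simp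
        then show ?thesis using l by (simp add: cong_iff_dvd_diff algebra_simps)
      qed
      show "real m \<le> h + real r" using l by (auto simp: M_def)
      show "real m > h"
      proof (rule ccontr)
        assume "\<not> real m > h"
        then have "m \<in> M" using cm l assms by (auto simp: M_def)
        then show False using m by simp
      qed
    qed
    have "m = m'" if "m \<in> ?M' - M" "m' \<in> ?M' - M" "m \<le> m'" for m m'
    proof (rule cong_eq)
      have "real m' < real m + real r" using gt[OF that(1)] gt[OF that(2)] by linarith
      then show "m' < m + r" by linarith
    qed (use gt that in auto)
    then have "m = m'" if "m \<in> ?M' - M" "m' \<in> ?M' - M" for m m'
      using that by (metis linear)
    then show ?thesis using finM by (simp add: card_le_Suc0_iff_eq)
  qed
  have tel: "(1 - e (real r * x)) * E h r c x = (\<Sum>m\<in>M - ?M'. e (real m * x)) - (\<Sum>m\<in>?M' - M. e (real m * x))"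
  proof -
    have "e (real r * x) * E h r c x = (\<Sum>m\<in>M. e (real (m + r) * x))"
      unfolding E_def M_def[symmetric] sum_distrib_left
      by (intro sum.cong) (auto simp: distrib_right e_add)
    also have "\<dots> = (\<Sum>m\<in>?M'. e (real m * x))" by (subst sum.reindex) (auto simp: inj_on_def)
    finally have "(1 - e (real r * x)) * E h r c x = (\<Sum>m\<in>M. e (real m * x)) - (\<Sum>m\<in>?M'. e (real m * x))"
      by (simp add: left_diff_distrib) (simp add: E_def M_def)
    moreover have "(\<Sum>m\<in>M. e (real m * x)) = (\<Sum>m\<in>M - ?M'. e (real m * x)) + (\<Sum>m\<in>M \<inter> ?M'. e (real m * x))"
      using finM by (subst sum.union_disjoint[symmetric]) (auto intro!: sum.cong)
    moreover have "(\<Sum>m\<in>?M'. e (real m * x)) = (\<Sum>m\<in>?M' - M. e (real m * x)) + (\<Sum>m\<in>M \<inter> ?M'. e (real m * x))"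
      using finM by (subst sum.union_disjoint[symmetric]) (auto intro!: sum.cong)
    ultimately show ?thesis by simp
  qed
  have "norm (1 - e (real r * x)) * norm (E h r c x) \<le> 2"
  proof -
    have b: "norm (\<Sum>m\<in>A. e (real m * x)) \<le> 1" if "card A \<le> 1" for A
    proof -
      have "norm (\<Sum>m\<in>A. e (real m * x)) \<le> (\<Sum>m\<in>A. norm (e (real m * x)))" by (rule norm_sum)
      also have "\<dots> = real (card A)" by (simp add: norm_e)
      finally show ?thesis using that by simp
    qed
    have "norm ((1 - e (real r * x)) * E h r c x) \<le> 1 + 1"
      unfolding tel by (rule order_trans[OF norm_triangle_ineq4 add_mono]) (intro b c1 c2)+
    then show ?thesis by (simp add: norm_mult)
  qed
  then have "dist_int (real r * x) * norm (E h r c x) \<le> 2"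
    using mult_right_mono[OF norm_one_minus_e_ge[of "real r * x"], of "norm (E h r c x)"] by simp
  moreover have "(1 / h) * norm (E h r c x) \<le> 2" using triv assms by (simp add: field_simps)
  ultimately have "max (1 / h) (dist_int (real r * x)) * norm (E h r c x) \<le> 2" by (simp add: max_def)
  moreover have "0 < max (1 / h) (dist_int (real r * x))" using assms by (simp add: less_max_iff_disj)
  ultimately show ?thesis by (simp add: peak_def field_simps)
qed

section \<open>Products over the pairs of a matching\<close>

lemma prod_perfect_matching:
  fixes f :: "'a::linorder \<Rightarrow> 'b::comm_monoid_mult"
  assumes "\<sigma> \<in> perfect_matchings I" "finite I"
  shows "(\<Prod>x\<in>I. f x) = (\<Prod>p\<in>\<sigma>. f (fst p) * f (snd p))"
proof -
  note D = perfect_matchingsD[OF assms(1)]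
  have "finite \<sigma>" using assms D(1) by (intro finite_subset[of \<sigma> "I \<times> I"]) (auto simp: mem_Times_iff)
  have I: "I = (\<Union>p\<in>\<sigma>. {fst p, snd p})" using D(1,2) by blast
  have "(\<Prod>x\<in>I. f x) = (\<Prod>p\<in>\<sigma>. \<Prod>x\<in>{fst p, snd p}. f x)"
    unfolding I
  proof (rule prod.UNION_disjoint)
    show "\<forall>p\<in>\<sigma>. \<forall>p'\<in>\<sigma>. p \<noteq> p' \<longrightarrow> {fst p, snd p} \<inter> {fst p', snd p'} = {}"
      using D(1,3) by blast
  qed (use \<open>finite \<sigma>\<close> in auto)
  also have "\<dots> = (\<Prod>p\<in>\<sigma>. f (fst p) * f (snd p))"
    using D(1) by (intro prod.cong) force+
  finally show ?thesis .
qed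

lemma sum_perfect_matching:
  fixes f :: "'a::linorder \<Rightarrow> 'b::comm_monoid_add"
  assumes "\<sigma> \<in> perfect_matchings I" "finite I"
  shows "(\<Sum>x\<in>I. f x) = (\<Sum>p\<in>\<sigma>. f (fst p) + f (snd p))"
proof -
  note D = perfect_matchingsD[OF assms(1)]
  have "finite \<sigma>" using assms D(1) by (intro finite_subset[of \<sigma> "I \<times> I"]) (auto simp: mem_Times_iff)
  have I: "I = (\<Union>p\<in>\<sigma>. {fst p, snd p})" using D(1,2) by blast
  have "(\<Sum>x\<in>I. f x) = (\<Sum>p\<in>\<sigma>. \<Sum>x\<in>{fst p, snd p}. f x)"
    unfolding I
  proof (rule sum.UNION_disjoint)
    show "\<forall>p\<in>\<sigma>. \<forall>p'\<in>\<sigma>. p \<noteq> p' \<longrightarrow> {fst p, snd p} \<inter> {fst p', snd p'} = {}"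
      using D(1,3) by blast
  qed (use \<open>finite \<sigma>\<close> in auto)
  also have "\<dots> = (\<Sum>p\<in>\<sigma>. f (fst p) + f (snd p))"
    using D(1) by (intro sum.cong) force+
  finally show ?thesis .
qed

context cyclic_weights
begin

text \<open>Distributivity: choosing a cancelling pair of residues for each pair of \<sigma> amounts
  to choosing a tuple matched by \<sigma>, whose total is then 0 modulo \<open>q\<close>. The
  auxiliary \<open>pr x\<close> is the pair of \<sigma> containing \<open>x\<close>, needed to read
  the tuple off the choices.\<close>

lemma prod_pair_sums:
  fixes f :: "nat \<Rightarrow> nat \<Rightarrow> complex"
  assumes \<sigma>: "\<sigma> \<in> perfect_matchings I" and fin: "finite I"
  shows "(\<Prod>p\<in>\<sigma>. \<Sum>(u, v) | u < q \<and> v < q \<and> q dvd u + v. f (fst p) u * f (snd p) v)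
    = (\<Sum>a | a \<in> tuples I \<and> matched \<sigma> a. \<Prod>i\<in>I. f i (a i))"
proof -
  note D = perfect_matchingsD[OF \<sigma>]
  let ?Z = "{(u, v). u < q \<and> v < q \<and> q dvd u + v}"
  have finZ: "finite ?Z" by (rule finite_subset[of _ "{..<q} \<times> {..<q}"]) auto
  have fin\<sigma>: "finite \<sigma>" using fin D(1) by (intro finite_subset[of \<sigma> "I \<times> I"]) (auto simp: mem_Times_iff)
  define pr where "pr x = (THE p. p \<in> \<sigma> \<and> (x = fst p \<or> x = snd p))" for x
  have pr_eq: "pr x = p" if "p \<in> \<sigma>" "x = fst p \<or> x = snd p" for x p
    unfolding pr_def
  proof (rule the_equality)
    have "x \<in> I" using D(1)[OF that(1)] that(2) by auto
    then show "p' = p" if "p' \<in> \<sigma> \<and> (x = fst p' \<or> x = snd p')" for p'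
      using D(3)[of x p' p] that \<open>p \<in> \<sigma>\<close> \<open>x = fst p \<or> x = snd p\<close> by blast
  qed (use that in auto)
  have pr: "pr x \<in> \<sigma>" "x = fst (pr x) \<or> x = snd (pr x)" if "x \<in> I" for x
  proof -
    obtain p where "p \<in> \<sigma>" "x = fst p \<or> x = snd p" using D(2)[OF \<open>x \<in> I\<close>] by blast
    then show "pr x \<in> \<sigma>" "x = fst (pr x) \<or> x = snd (pr x)" using pr_eq by auto
  qed
  have "(\<Prod>p\<in>\<sigma>. \<Sum>z\<in>?Z. f (fst p) (fst z) * f (snd p) (snd z))
      = (\<Sum>w\<in>PiE \<sigma> (\<lambda>_. ?Z). \<Prod>p\<in>\<sigma>. f (fst p) (fst (w p)) * f (snd p) (snd (w p)))"
    using fin\<sigma> finZ by (intro prod_sum_PiE) auto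
  also have "\<dots> = (\<Sum>a | a \<in> tuples I \<and> matched \<sigma> a. \<Prod>i\<in>I. f i (a i))"
  proof (rule sum.reindex_bij_witness[where i = "\<lambda>a. \<lambda>p\<in>\<sigma>. (a (fst p), a (snd p))"
        and j = "\<lambda>w. \<lambda>x\<in>I. if x = fst (pr x) then fst (w (pr x)) else snd (w (pr x))"])
    fix w assume w: "w \<in> PiE \<sigma> (\<lambda>_. ?Z)"
    let ?a = "\<lambda>x\<in>I. if x = fst (pr x) then fst (w (pr x)) else snd (w (pr x))"
    have af: "?a (fst p) = fst (w p)" and as: "?a (snd p) = snd (w p)" if "p \<in> \<sigma>" for p
      using D(1)[OF that] pr_eq[OF that] by auto
    show "(\<lambda>p\<in>\<sigma>. (?a (fst p), ?a (snd p))) = w"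
    proof
      fix p
      show "(\<lambda>p\<in>\<sigma>. (?a (fst p), ?a (snd p))) p = w p"
      proof (cases "p \<in> \<sigma>")
        case True
        then show ?thesis by (simp only: restrict_apply' af as prod.collapse)
      next
        case False
        then show ?thesis using PiE_arb[OF w False] by simp
      qed
    qed
    have wZ: "fst (w p) < q" "snd (w p) < q" "q dvd fst (w p) + snd (w p)" if "p \<in> \<sigma>" for p
      using PiE_mem[OF w that] by (auto simp: case_prod_unfold)
    have m: "matched \<sigma> ?a" unfolding matched_def
    proof
      fix p assume p: "p \<in> \<sigma>"
      show "q dvd ?a (fst p) + ?a (snd p)" unfolding af[OF p] as[OF p] using wZ[OF p] by simp
    qed
    have "q dvd (\<Sum>x\<in>I. ?a x)"
      unfolding sum_perfect_matching[OF \<sigma> fin] using m by (intro dvd_sum) (auto simp only: matched_def)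
    moreover have "?a \<in> PiE I (\<lambda>_. {..<q})"
    proof (rule PiE_I)
      fix x assume "x \<in> I"
      then show "?a x \<in> {..<q}" using wZ[OF pr(1)] by simp
    qed simp
    ultimately show "?a \<in> {a. a \<in> tuples I \<and> matched \<sigma> a}" using m unfolding tuples_def by blast
    have "(\<Prod>i\<in>I. f i (?a i)) = (\<Prod>p\<in>\<sigma>. f (fst p) (?a (fst p)) * f (snd p) (?a (snd p)))"
      by (rule prod_perfect_matching[OF \<sigma> fin])
    also have "\<dots> = (\<Prod>p\<in>\<sigma>. f (fst p) (fst (w p)) * f (snd p) (snd (w p)))"
    proof (rule prod.cong[OF refl])
      fix p assume p: "p \<in> \<sigma>"
      show "f (fst p) (?a (fst p)) * f (snd p) (?a (snd p)) = f (fst p) (fst (w p)) * f (snd p) (snd (w p))"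
        unfolding af[OF p] as[OF p] ..
    qed
    finally show "(\<Prod>i\<in>I. f i (?a i)) = (\<Prod>p\<in>\<sigma>. f (fst p) (fst (w p)) * f (snd p) (snd (w p)))" .
  next
    fix a assume a: "a \<in> {a. a \<in> tuples I \<and> matched \<sigma> a}"
    let ?w = "\<lambda>p\<in>\<sigma>. (a (fst p), a (snd p))"
    show "(\<lambda>x\<in>I. if x = fst (pr x) then fst (?w (pr x)) else snd (?w (pr x))) = a"
    proof
      fix x
      show "(\<lambda>x\<in>I. if x = fst (pr x) then fst (?w (pr x)) else snd (?w (pr x))) x = a x"
      proof (cases "x \<in> I")
        case True
        then show ?thesis using pr[OF True] by auto
      next
        case False
        then show ?thesis using a by (auto simp: tuples_def PiE_def extensional_def)
      qed
    qed
    have "a x < q" if "x \<in> I" for x using a that by (auto simp: tuples_def PiE_def Pi_def)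
    then show "?w \<in> PiE \<sigma> (\<lambda>_. ?Z)"
      using a D(1) by (auto simp: matched_def)
  qed
  finally show ?thesis by (simp add: case_prod_unfold)
qed

end

section \<open>The sums V as sums over residues modulo \<open>q\<close>\<close>

context cyclic_weights
begin

definition coef :: "nat \<Rightarrow> int \<Rightarrow> nat \<Rightarrow> complex" where
  "coef r c x = (if q dvd x then 0 else
     of_int (moebius_mu (dn x)) / of_nat (totient (dn x)) * E h r c (real x / real q))"

text \<open>One direction of the correspondence between reduced fractions \<open>b / n\<close> with
  \<open>n > 1\<close> dividing \<open>q\<close> and nonzero residues modulo \<open>q\<close>;
  \<open>fraction_of_residue\<close> is the inverse.\<close>

lemma residue_of_fraction:
  assumes n: "n dvd q" "1 < n" and b: "1 \<le> b" "b \<le> n" "coprime b n"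
  defines "x \<equiv> b * (q div n)"
  shows "x < q" "\<not> q dvd x" "dn x = n" "x div gcd x q = b" "real b / real n = real x / real q"
proof -
  define m where "m = q div n"
  have q: "q = n * m" using n by (simp add: m_def)
  have m0: "m > 0" using q q_gt_0 by (auto intro!: gr0I)
  have x: "x = b * m" by (simp add: x_def m_def)
  have "b \<noteq> n" using b n by auto
  then show xq: "x < q" using b m0 unfolding x q by simp
  show "\<not> q dvd x" using xq b m0 x by (auto dest!: dvd_imp_le)
  have g: "gcd x q = m" 
  proof -
    have "gcd n b = 1" using b(3) by (metis coprime_imp_gcd_eq_1 gcd.commute)
    then show ?thesis unfolding x q by (simp add: gcd_mult_right)
  qed
  show "dn x = n" using m0 unfolding den_def g by (simp add: q)
  show "x div gcd x q = b" using m0 unfolding g by (simp add: x)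
  show "real b / real n = real x / real q" using m0 by (simp add: x q)
qed

lemma fraction_of_residue:
  assumes x: "x < q" "\<not> q dvd x"
  shows "dn x dvd q" "1 < dn x" "1 \<le> x div gcd x q" "x div gcd x q \<le> dn x" "coprime (x div gcd x q) (dn x)"
    "(x div gcd x q) * (q div dn x) = x"
proof -
  have x0: "x > 0" using x(2) by (auto intro!: gr0I)
  have g0: "gcd x q > 0" using q_gt_0 by simp
  show d: "dn x dvd q" by (rule den_dvd[OF q_gt_0])
  show "1 < dn x" using den_gt_0[OF q_gt_0, of x] den_eq_1_iff[OF q_gt_0, of x] x(2) by linarith
  show "1 \<le> x div gcd x q" using x0 g0 by (simp add: Suc_le_eq div_greater_zero_iff gcd_le1_nat)
  show "x div gcd x q \<le> dn x" unfolding den_def using x(1) by (intro div_le_mono) simp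
  show "coprime (x div gcd x q) (dn x)" unfolding den_def using x0 by (intro div_gcd_coprime) simp
  have "q div dn x = gcd x q" unfolding den_def using q_gt_0 by (simp add: div_div_eq_right)
  then show "(x div gcd x q) * (q div dn x) = x" by simp
qed

text \<open>Denominators and numerators are encoded together in one residue per index, and
  integrality of the sum becomes divisibility by \<open>q\<close>. Coprimality of \<open>r\<close>
  and \<open>q\<close> supplies the condition on each denominator. Tuples with a zero entry are
  added for free, since \<open>coef\<close> vanishes there.\<close>

lemma V_eq_sum_tuples:
  assumes "coprime r q"
  shows "V k q h r c = (\<Sum>a\<in>tuples {1..k}. \<Prod>i=1..k. coef r (c i) (a i))"
proof -
  let ?I = "{1..k}"
  let ?D = "PiE ?I (\<lambda>_. {n. 1 < n \<and> n dvd q \<and> coprime n r})"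
  let ?A = "\<lambda>d. {a. a \<in> PiE ?I (\<lambda>i. {b. 1 \<le> b \<and> b \<le> d i \<and> coprime b (d i)}) \<and>
               (\<Sum>i=1..k. real (a i) / real (d i)) \<in> \<int>}"
  let ?T = "{x\<in>tuples ?I. \<forall>i\<in>?I. \<not> q dvd x i}"
  let ?w = "\<lambda>n. of_int (moebius_mu n) / of_nat (totient n) :: complex"
  have finD: "finite ?D" using q_gt_0 by (intro finite_PiE) (auto intro: finite_subset[of _ "{n. n dvd q}"])
  have finA: "finite (?A d)" if "d \<in> ?D" for d
    by (rule finite_subset[of _ "PiE ?I (\<lambda>i. {b. 1 \<le> b \<and> b \<le> d i \<and> coprime b (d i)})"])
      (auto intro!: finite_PiE intro: finite_subset[of _ "{..d _}"])
  have cop: "coprime n r" if "n dvd q" for n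
    using assms that by (meson coprime_commute coprime_divisors dvd_refl)
  have int_iff: "(\<Sum>i\<in>?I. real (x i) / real q) \<in> \<int> \<longleftrightarrow> q dvd (\<Sum>i\<in>?I. x i)" for x :: "nat \<Rightarrow> nat"
  proof -
    have *: "real N / real q \<in> \<int> \<longleftrightarrow> q dvd N" for N
      using of_int_div_of_int_in_Ints_iff[of "int N" "int q", where ?'a = real] q_gt_0 by simp
    have "(\<Sum>i\<in>?I. real (x i) / real q) = real (\<Sum>i\<in>?I. x i) / real q" by (simp add: sum_divide_distrib)
    then show ?thesis by (simp only: *)
  qed
  have "V k q h r c = (\<Sum>d\<in>?D. \<Sum>a\<in>?A d. \<Prod>i\<in>?I. ?w (d i) * E h r (c i) (real (a i) / real (d i)))"
    by (simp only: V_def sum_distrib_left prod.distrib)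
  also have "\<dots> = (\<Sum>z\<in>Sigma ?D ?A. \<Prod>i\<in>?I. ?w (fst z i) * E h r (c i) (real (snd z i) / real (fst z i)))"
    using finD finA by (subst sum.Sigma) (auto simp: case_prod_unfold)
  also have "\<dots> = (\<Sum>x\<in>?T. \<Prod>i\<in>?I. coef r (c i) (x i))"
  proof (rule sum.reindex_bij_witness[where j = "\<lambda>z. \<lambda>i\<in>?I. snd z i * (q div fst z i)"
        and i = "\<lambda>x. (\<lambda>i\<in>?I. dn (x i), \<lambda>i\<in>?I. x i div gcd (x i) q)"])
    fix z assume z: "z \<in> Sigma ?D ?A"
    have d: "fst z i dvd q" "1 < fst z i" and a: "1 \<le> snd z i" "snd z i \<le> fst z i" "coprime (snd z i) (fst z i)"
      if "i \<in> ?I" for i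
      using z that by (auto simp: PiE_def Pi_def mem_Sigma_iff)
    note R = residue_of_fraction[OF d a]
    let ?x = "\<lambda>i\<in>?I. snd z i * (q div fst z i)"
    have ext: "fst z i = undefined" "snd z i = undefined" if "i \<notin> ?I" for i
      using z that by (auto simp: PiE_def extensional_def mem_Sigma_iff)
    show "(\<lambda>i\<in>?I. dn (?x i), \<lambda>i\<in>?I. ?x i div gcd (?x i) q) = z"
    proof (rule prod_eqI)
      show "fst (\<lambda>i\<in>?I. dn (?x i), \<lambda>i\<in>?I. ?x i div gcd (?x i) q) = fst z"
      proof
        fix i show "fst (\<lambda>i\<in>?I. dn (?x i), \<lambda>i\<in>?I. ?x i div gcd (?x i) q) i = fst z i"
          using R(3)[of i] ext(1)[of i] by (cases "i \<in> ?I") auto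
      qed
      show "snd (\<lambda>i\<in>?I. dn (?x i), \<lambda>i\<in>?I. ?x i div gcd (?x i) q) = snd z"
      proof
        fix i show "snd (\<lambda>i\<in>?I. dn (?x i), \<lambda>i\<in>?I. ?x i div gcd (?x i) q) i = snd z i"
          using R(4)[of i] ext(2)[of i] by (cases "i \<in> ?I") auto
      qed
    qed
    have "(\<Sum>i\<in>?I. real (?x i) / real q) = (\<Sum>i\<in>?I. real (snd z i) / real (fst z i))"
    proof (rule sum.cong[OF refl])
      fix i assume i: "i \<in> ?I"
      show "real (?x i) / real q = real (snd z i) / real (fst z i)"
        using R(5)[OF i i i i i] i by simp
    qed
    then have "q dvd (\<Sum>i\<in>?I. ?x i)" using z int_iff[of ?x] by (auto simp: mem_Sigma_iff)
    moreover have "?x i < q \<and> \<not> q dvd ?x i" if "i \<in> ?I" for i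
      using R(1)[of i] R(2)[of i] that by simp
    moreover from this have "?x \<in> PiE ?I (\<lambda>_. {..<q})" by (intro PiE_I) auto
    ultimately show "?x \<in> ?T" unfolding tuples_def by blast
    show "(\<Prod>i\<in>?I. coef r (c i) (?x i)) = (\<Prod>i\<in>?I. ?w (fst z i) * E h r (c i) (real (snd z i) / real (fst z i)))"
    proof (rule prod.cong[OF refl])
      fix i assume i: "i \<in> ?I"
      let ?y = "snd z i * (q div fst z i)"
      have "\<not> q dvd ?y" "dn ?y = fst z i" "real (snd z i) / real (fst z i) = real ?y / real q"
        using R(2,3,5)[OF i i i i i] by auto
      then show "coef r (c i) (?x i) = ?w (fst z i) * E h r (c i) (real (snd z i) / real (fst z i))"
        using i by (simp add: coef_def)
    qed
  next
    fix x assume x: "x \<in> ?T"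
    then have lt: "x i < q" "\<not> q dvd x i" if "i \<in> ?I" for i using that by (auto simp: tuples_def PiE_def Pi_def)
    note R = fraction_of_residue[OF lt]
    let ?z = "(\<lambda>i\<in>?I. dn (x i), \<lambda>i\<in>?I. x i div gcd (x i) q)"
    show "(\<lambda>i\<in>?I. snd ?z i * (q div fst ?z i)) = x"
    proof
      fix i show "(\<lambda>i\<in>?I. snd ?z i * (q div fst ?z i)) i = x i"
        using R(6)[of i] x by (cases "i \<in> ?I") (auto simp: tuples_def PiE_def extensional_def)
    qed
    have fz: "fst ?z \<in> ?D" using R(1,2) cop by auto
    have "(\<Sum>i\<in>?I. real (snd ?z i) / real (fst ?z i)) = (\<Sum>i\<in>?I. real (x i) / real q)"
    proof (rule sum.cong[OF refl])
      fix i assume i: "i \<in> ?I"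
      have "real (x i div gcd (x i) q) / real (dn (x i)) = real (x i) / real q"
        using residue_of_fraction(5)[of "dn (x i)" "x i div gcd (x i) q"] R[OF i i] by simp
      then show "real (snd ?z i) / real (fst ?z i) = real (x i) / real q" using i by simp
    qed
    then have "(\<Sum>i\<in>?I. real (snd ?z i) / real (fst ?z i)) \<in> \<int>"
      using x int_iff[of x] by (simp add: tuples_def)
    moreover have "snd ?z \<in> PiE ?I (\<lambda>i. {b. 1 \<le> b \<and> b \<le> fst ?z i \<and> coprime b (fst ?z i)})"
      using R(3,4,5) by auto
    ultimately have "snd ?z \<in> ?A (fst ?z)" by blast
    from SigmaI[of _ ?D _ ?A, OF fz this] show "?z \<in> Sigma ?D ?A" by (simp only: prod.collapse)
  qed
  also have "\<dots> = (\<Sum>x\<in>tuples ?I. \<Prod>i\<in>?I. coef r (c i) (x i))"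
  proof (rule sum.mono_neutral_left)
    show "\<forall>x\<in>tuples ?I - ?T. (\<Prod>i\<in>?I. coef r (c i) (x i)) = 0"
    proof
      fix x assume "x \<in> tuples ?I - ?T"
      then obtain i where "i \<in> ?I" "q dvd x i" by auto
      then show "(\<Prod>i\<in>?I. coef r (c i) (x i)) = 0" by (intro prod_zero) (auto simp: coef_def)
    qed
  qed (auto simp: finite_tuples)
  finally show ?thesis .
qed

lemma V_2_eq_sum_pairs:
  assumes "coprime r q"
  shows "V 2 q h r (\<lambda>l. if l = 1 then x else y) = (\<Sum>(u, v) | u < q \<and> v < q \<and> q dvd u + v. coef r x u * coef r y v)"
proof -
  have I: "{1..2::nat} = {1, 2}" by auto
  have "V 2 q h r (\<lambda>l. if l = 1 then x else y)
      = (\<Sum>a\<in>tuples {1, 2}. coef r x (a 1) * coef r y (a 2))"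
    unfolding V_eq_sum_tuples[OF assms] I by simp
  also have "\<dots> = (\<Sum>z\<in>{(u, v). u < q \<and> v < q \<and> q dvd u + v}. coef r x (fst z) * coef r y (snd z))"
  proof (rule sum.reindex_bij_witness[where j = "\<lambda>a. (a 1, a 2)" and i = "\<lambda>z. \<lambda>i\<in>{1, 2}. if i = 1 then fst z else snd z"])
    fix a assume a: "a \<in> tuples {1, 2}"
    show "(\<lambda>i\<in>{1, 2}. if i = 1 then fst (a 1, a 2) else snd (a 1, a 2)) = a"
      using a by (intro ext) (auto simp: tuples_def PiE_def extensional_def)
    show "(a 1, a 2) \<in> {(u, v). u < q \<and> v < q \<and> q dvd u + v}"
      using a by (auto simp: tuples_def PiE_def Pi_def)
  next
    fix z assume "z \<in> {(u, v). u < q \<and> v < q \<and> q dvd u + v}"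
    then show "(\<lambda>i\<in>{1, 2}. if i = 1 then fst z else snd z) \<in> tuples {1, 2}"
      by (auto simp: tuples_def)
  qed auto
  finally show ?thesis by (simp add: case_prod_unfold)
qed

text \<open>Interchanging the sums over matchings and tuples counts each tuple once for every
  matching that it satisfies.\<close>

lemma V_minus_matchings_eq:
  assumes "coprime r q"
  shows "V k q h r c - (\<Sum>\<sigma>\<in>perfect_matchings {1..k}. \<Prod>(i, j)\<in>\<sigma>. V 2 q h r (\<lambda>l. if l = 1 then c i else c j))
    = (\<Sum>a\<in>tuples {1..k}. of_real (1 - real (match_count {1..k} a)) * (\<Prod>i=1..k. coef r (c i) (a i)))"
proof -
  let ?I = "{1..k}"
  let ?f = "\<lambda>a. \<Prod>i=1..k. coef r (c i) (a i)"
  have finT: "finite (tuples ?I)" by (simp add: finite_tuples)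
  have finM: "finite (perfect_matchings ?I)" by (rule finite_perfect_matchings) simp
  have "(\<Prod>(i, j)\<in>\<sigma>. V 2 q h r (\<lambda>l. if l = 1 then c i else c j)) = (\<Sum>a\<in>tuples ?I. if matched \<sigma> a then ?f a else 0)"
    if "\<sigma> \<in> perfect_matchings ?I" for \<sigma>
  proof -
    have "(\<Prod>(i, j)\<in>\<sigma>. V 2 q h r (\<lambda>l. if l = 1 then c i else c j))
        = (\<Prod>p\<in>\<sigma>. \<Sum>(u, v) | u < q \<and> v < q \<and> q dvd u + v. coef r (c (fst p)) u * coef r (c (snd p)) v)"
      by (simp only: V_2_eq_sum_pairs[OF assms] case_prod_unfold)
    also have "\<dots> = (\<Sum>a | a \<in> tuples ?I \<and> matched \<sigma> a. ?f a)"
      using prod_pair_sums[OF that, of "\<lambda>i. coef r (c i)"] by simp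
    also have "\<dots> = (\<Sum>a\<in>tuples ?I. if matched \<sigma> a then ?f a else 0)"
      using sum.inter_filter[OF finT, of ?f "matched \<sigma>"] by simp
    finally show ?thesis .
  qed
  then have "(\<Sum>\<sigma>\<in>perfect_matchings ?I. \<Prod>(i, j)\<in>\<sigma>. V 2 q h r (\<lambda>l. if l = 1 then c i else c j))
      = (\<Sum>\<sigma>\<in>perfect_matchings ?I. \<Sum>a\<in>tuples ?I. if matched \<sigma> a then ?f a else 0)"
    by (rule sum.cong[OF refl])
  also have "\<dots> = (\<Sum>a\<in>tuples ?I. \<Sum>\<sigma>\<in>perfect_matchings ?I. if matched \<sigma> a then ?f a else 0)"
    by (rule sum.swap)
  also have "\<dots> = (\<Sum>a\<in>tuples ?I. of_nat (match_count ?I a) * ?f a)"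
  proof (rule sum.cong[OF refl])
    fix a
    have "(\<Sum>\<sigma>\<in>perfect_matchings ?I. if matched \<sigma> a then ?f a else 0) = (\<Sum>\<sigma>\<in>{\<sigma>\<in>perfect_matchings ?I. matched \<sigma> a}. ?f a)"
      by (rule sum.inter_filter[OF finM, symmetric])
    then show "(\<Sum>\<sigma>\<in>perfect_matchings ?I. if matched \<sigma> a then ?f a else 0) = of_nat (match_count ?I a) * ?f a"
      by (simp add: match_count_def)
  qed
  finally show ?thesis
    unfolding V_eq_sum_tuples[OF assms] by (simp add: sum_subtractf[symmetric] left_diff_distrib)
qed

text \<open>For a denominator \<open>n\<close> one has
  \<open>1 / \<phi>(n) = rho n / n \<le> rho q / n\<close>. Multiplication by \<open>r\<close>,
  coprime to \<open>q\<close>, preserves the denominator and moves the peak from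
  \<open>r * x / q\<close> to the residue \<open>r * x mod q\<close>.\<close>

lemma norm_coef_le:
  assumes "r \<ge> 1" "coprime r q"
  shows "norm (coef r c x) \<le> 2 * rho q * wt (r * x mod q)"
proof (cases "q dvd x")
  case True
  then show ?thesis using wt_nonneg by (simp add: coef_def rho_def)
next
  case False
  have cq: "coprime q r" using assms(2) by (simp add: coprime_commute)
  have nd: "\<not> q dvd r * x mod q"
    using False cq by (simp add: dvd_mod_iff coprime_dvd_mult_right_iff)
  have dn: "dn (r * x mod q) = dn x"
    unfolding den_mod unfolding den_def using cq by (simp add: gcd_mult_left_left_cancel)
  let ?n = "dn x"
  have n0: "?n > 0" by (rule den_gt_0[OF q_gt_0])
  have "1 / real (totient ?n) \<le> rho q / real ?n"
  proof -
    have "rho ?n \<le> rho q" using squarefree_q den_dvd[OF q_gt_0] by (rule rho_mono_dvd)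
    then have "rho ?n / real ?n \<le> rho q / real ?n" by (intro divide_right_mono) auto
    then show ?thesis using n0 by (simp add: rho_def)
  qed
  moreover have "norm (of_int (moebius_mu ?n) :: complex) \<le> 1"
    by (simp add: moebius_mu_def norm_power)
  ultimately have "norm (of_int (moebius_mu ?n) / of_nat (totient ?n) :: complex) \<le> rho q / real ?n"
    using divide_right_mono[of "norm (of_int (moebius_mu ?n) :: complex)" 1 "real (totient ?n)"]
    by (simp add: norm_divide)
  moreover have "norm (E h r c (real x / real q)) \<le> 2 * pk (r * x mod q)"
    using norm_E_le[OF assms(1) h_ge_3, of c "real x / real q"] unfolding pk_mod by (simp add: pk_def)
  ultimately have "norm (coef r c x) \<le> (rho q / real ?n) * (2 * pk (r * x mod q))"
    using False n0 unfolding coef_def by (simp only: if_False norm_mult) (intro mult_mono, auto simp: rho_def)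
  also have "\<dots> = 2 * rho q * wt (r * x mod q)"
    using nd dn by (simp add: wt_def)
  finally show ?thesis .
qed

text \<open>Multiplication of all entries by \<open>r\<close> permutes the residues modulo
  \<open>q\<close> and respects sums and cancelling pairs, hence the number of matchings. As the
  weights are nonnegative, an injection of the tuples into themselves is enough.\<close>

lemma norm_V_minus_matchings_le:
  assumes r: "r \<ge> 1" "coprime r q"
  shows "norm (V k q h r c - (\<Sum>\<sigma>\<in>perfect_matchings {1..k}. \<Prod>(i, j)\<in>\<sigma>. V 2 q h r (\<lambda>l. if l = 1 then c i else c j)))
    \<le> (2 * rho q) ^ k * (\<Sum>a\<in>tuples {1..k}. \<bar>1 - real (match_count {1..k} a)\<bar> * (\<Prod>i=1..k. wt (a i)))"
proof -
  let ?I = "{1..k}"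
  define \<psi> where "\<psi> a = (\<lambda>i\<in>?I. r * a i mod q)" for a :: "nat \<Rightarrow> nat"
  define G where "G a = \<bar>1 - real (match_count ?I a)\<bar> * (\<Prod>i=1..k. wt (a i))" for a
  have cq: "coprime q r" using r(2) by (simp add: coprime_commute)
  have finT: "finite (tuples ?I)" by (simp add: finite_tuples)
  have dvd_r: "q dvd r * x mod q + r * y mod q \<longleftrightarrow> q dvd x + y" for x y
  proof -
    have "q dvd r * x mod q + r * y mod q \<longleftrightarrow> q dvd r * (x + y)"
      by (simp add: dvd_eq_mod_eq_0 mod_add_eq distrib_left)
    also have "\<dots> \<longleftrightarrow> q dvd x + y" using cq by (simp add: coprime_dvd_mult_right_iff)
    finally show ?thesis .
  qed
  have mc: "match_count ?I (\<psi> a) = match_count ?I a" for a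
  proof -
    have "matched \<sigma> (\<psi> a) \<longleftrightarrow> matched \<sigma> a" if "\<sigma> \<in> perfect_matchings ?I" for \<sigma>
      unfolding matched_def
    proof (rule ball_cong[OF refl])
      fix p assume "p \<in> \<sigma>"
      then have "fst p \<in> ?I" "snd p \<in> ?I" using perfect_matchingsD(1)[OF that] by blast+
      then show "q dvd \<psi> a (fst p) + \<psi> a (snd p) \<longleftrightarrow> q dvd a (fst p) + a (snd p)"
        by (simp only: \<psi>_def restrict_apply' dvd_r)
    qed
    then have "{\<sigma>\<in>perfect_matchings ?I. matched \<sigma> (\<psi> a)} = {\<sigma>\<in>perfect_matchings ?I. matched \<sigma> a}" by blast
    then show ?thesis by (simp add: match_count_def)
  qed
  have lt: "a i < q" if "a \<in> tuples ?I" "i \<in> ?I" for a i using that by (auto simp: tuples_def PiE_def Pi_def)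
  have inj: "inj_on \<psi> (tuples ?I)"
  proof (rule inj_onI)
    fix a b assume a: "a \<in> tuples ?I" and b: "b \<in> tuples ?I" and eq: "\<psi> a = \<psi> b"
    show "a = b"
    proof
      fix i
      show "a i = b i"
      proof (cases "i \<in> ?I")
        case True
        then have "[r * a i = r * b i] (mod q)" using fun_cong[OF eq, of i] by (simp add: \<psi>_def cong_def)
        then have "[a i = b i] (mod q)" using r(2) by (simp add: cong_mult_lcancel_nat)
        then show ?thesis using lt[OF a True] lt[OF b True] by (simp add: cong_def)
      next
        case False
        then show ?thesis using a b by (auto simp: tuples_def PiE_def extensional_def)
      qed
    qed
  qed
  have img: "\<psi> ` tuples ?I \<subseteq> tuples ?I"
  proof
    fix b assume "b \<in> \<psi> ` tuples ?I"
    then obtain a where a: "a \<in> tuples ?I" "b = \<psi> a" by auto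
    have "(\<Sum>i\<in>?I. \<psi> a i) = (\<Sum>i\<in>?I. r * a i mod q)" by (simp add: \<psi>_def)
    moreover have "q dvd (\<Sum>i\<in>?I. r * a i mod q)"
    proof -
      have "q dvd r * (\<Sum>i\<in>?I. a i)" using a by (simp add: tuples_def)
      then show ?thesis by (simp add: dvd_eq_mod_eq_0 mod_sum_eq sum_distrib_left)
    qed
    ultimately show "b \<in> tuples ?I" using a(2) q_gt_0 by (auto simp: tuples_def \<psi>_def)
  qed
  have "norm (\<Sum>a\<in>tuples ?I. of_real (1 - real (match_count ?I a)) * (\<Prod>i=1..k. coef r (c i) (a i)) :: complex)
      \<le> (\<Sum>a\<in>tuples ?I. \<bar>1 - real (match_count ?I a)\<bar> * (\<Prod>i=1..k. norm (coef r (c i) (a i))))"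
    by (rule order_trans[OF norm_sum]) (simp only: norm_mult norm_of_real prod_norm[symmetric] order_refl)
  also have "\<dots> \<le> (\<Sum>a\<in>tuples ?I. (2 * rho q) ^ k * G (\<psi> a))"
  proof (rule sum_mono)
    fix a
    have "(\<Prod>i=1..k. norm (coef r (c i) (a i))) \<le> (\<Prod>i=1..k. 2 * rho q * wt (\<psi> a i))"
      using norm_coef_le[OF r] by (intro prod_mono) (simp add: \<psi>_def)
    also have "\<dots> = (2 * rho q) ^ k * (\<Prod>i=1..k. wt (\<psi> a i))" by (simp add: prod.distrib)
    finally have "\<bar>1 - real (match_count ?I a)\<bar> * (\<Prod>i=1..k. norm (coef r (c i) (a i)))
       \<le> \<bar>1 - real (match_count ?I a)\<bar> * ((2 * rho q) ^ k * (\<Prod>i=1..k. wt (\<psi> a i)))"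
      by (intro mult_left_mono) auto
    then show "\<bar>1 - real (match_count ?I a)\<bar> * (\<Prod>i=1..k. norm (coef r (c i) (a i))) \<le> (2 * rho q) ^ k * G (\<psi> a)"
      unfolding G_def mc by (simp only: mult.left_commute)
  qed
  also have "\<dots> = (2 * rho q) ^ k * (\<Sum>b\<in>\<psi> ` tuples ?I. G b)"
    using inj by (simp add: sum_distrib_left sum.reindex)
  also have "\<dots> \<le> (2 * rho q) ^ k * (\<Sum>b\<in>tuples ?I. G b)"
  proof (intro mult_left_mono sum_mono2 finT img)
    show "0 \<le> G b" for b unfolding G_def by (intro mult_nonneg_nonneg prod_wt_nonneg) auto
  qed (simp add: rho_def)
  finally show ?thesis unfolding V_minus_matchings_eq[OF r(2)] G_def .
qed

end

theorem theorem1p1: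
  fixes r k :: nat
  assumes "r \<ge> 1" and "k \<ge> 1"
  shows "\<exists>C::real. \<forall>(c :: nat \<Rightarrow> int) (q :: nat) (h :: real).
           q \<ge> 1 \<longrightarrow> squarefree q \<longrightarrow> coprime r q \<longrightarrow> h \<ge> 3 \<longrightarrow>
           norm (V k q h r c -
                 (\<Sum>\<sigma> \<in> perfect_matchings {1..k}.
                    \<Prod>(i, j) \<in> \<sigma>. V 2 q h r (\<lambda>l. if l = 1 then c i else c j)))
             \<le> C * (h powr (real k / 2 - 1 / (7 * real k)) *
                    (real q / real (totient q)) powr (2 ^ k + real k / 2))"
proof -
  define C0 where "C0 = unmatched_const k + real (card (perfect_matchings {1..k})) * (real k ^ 3 * sqrt 8 ^ (k - 2))"
  have C0: "C0 \<ge> 0" using unmatched_const_nonneg[of k] by (simp add: C0_def)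
  show ?thesis
  \<comment> \<open>The power of 2 collects the factor 2 of each \<open>coef\<close> bound.\<close>
  proof (intro exI[of _ "2 ^ k * C0"] allI impI)
    fix c :: "nat \<Rightarrow> int" and q :: nat and h :: real
    assume q: "q \<ge> 1" "squarefree q" "coprime r q" and h: "h \<ge> 3"
    interpret cyclic_weights q h using q h by unfold_locales
    let ?B = "h powr (real k / 2 - 1 / (7 * real k))"
    have rho1: "rho q \<ge> 1" using rho_ge_1 q by simp
    have "norm (V k q h r c - (\<Sum>\<sigma>\<in>perfect_matchings {1..k}. \<Prod>(i, j)\<in>\<sigma>. V 2 q h r (\<lambda>l. if l = 1 then c i else c j)))
      \<le> (2 * rho q) ^ k * (\<Sum>a\<in>tuples {1..k}. \<bar>1 - real (match_count {1..k} a)\<bar> * (\<Prod>i=1..k. wt (a i)))"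
      by (rule norm_V_minus_matchings_le[OF assms(1) q(3)])
    also have "\<dots> \<le> (2 * rho q) ^ k * (C0 * (?B * rho q ^ (2 ^ k - k - 1)))"
      using sum_match_defect_le[of "{1..k}" k] rho1 unfolding C0_def by (intro mult_left_mono) auto
    also have "\<dots> = 2 ^ k * C0 * (?B * (rho q ^ k * rho q ^ (2 ^ k - k - 1)))"
      by (simp only: power_mult_distrib ac_simps)
    \<comment> \<open>The \<open>k\<close> factors from comparing 1/\<phi> with the reciprocal of
      the denominator and the \<open>2 ^ k - k - 1\<close> from the inequality add up to
      \<open>2 ^ k - 1\<close>, which is below the exponent claimed.\<close>
    also have "rho q ^ k * rho q ^ (2 ^ k - k - 1) \<le> rho q powr (2 ^ k + real k / 2)"
    proof -
      have "rho q ^ k * rho q ^ (2 ^ k - k - 1) = rho q ^ (2 ^ k - 1)"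
      proof -
        have "k < 2 ^ k" by (rule less_exp)
        moreover have "k + (x - k - 1) = x - 1" if "k < x" for x :: nat using that by arith
        ultimately have "k + (2 ^ k - k - 1) = 2 ^ k - 1" by blast
        then show ?thesis by (simp only: power_add[symmetric])
      qed
      also have "\<dots> = rho q powr real (2 ^ k - 1)" using rho1 by (intro powr_realpow[symmetric]) simp
      also have "\<dots> \<le> rho q powr (2 ^ k + real k / 2)"
        using rho1 by (intro powr_mono) (auto simp: of_nat_diff)
      finally show ?thesis .
    qed
    finally show "norm (V k q h r c - (\<Sum>\<sigma>\<in>perfect_matchings {1..k}. \<Prod>(i, j)\<in>\<sigma>. V 2 q h r (\<lambda>l. if l = 1 then c i else c j)))
      \<le> 2 ^ k * C0 * (?B * (real q / real (totient q)) powr (2 ^ k + real k / 2))"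
      using C0 by (simp add: rho_def mult_left_mono)
  qed
qed

end
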